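(* Let $r\ge r^\star$, where $r^\star=\operatorname{rank}(X^\star)$ and $X^\star$ is the maximum-rank solution to the convex instance (SDP-$(n+1)$), with $\operatorname{tr}(X^\star)<R^2$. If $x=(u_0,\{u_k\}_{k=1}^\ell,\{\operatorname{vec}(V_k)\}_{k=1}^\ell)$ is globally optimal for (BM-$r$) and satisfies $$\mathbf{e}_i^T(W_ku_k+b_ku_0)\ne0,\qquad \mathbf{e}_i^TW_kV_k\ne0\qquad\text{for all }k\in\{1,\dots,\ell-1\},\ i\in\{1,\dots,n_{k+1}\},$$ then the dual multipliers $y$ and $z$ that certify $x$ to be first-order optimal must also certify $x$ to be globally optimal, as in $$\phi_r[c]=u_0\cdot(w_\ell^Tu_\ell)=z_0+R^2\cdot\min\{0,\lambda_{\min}[S(y,z)]\}.$$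
   Context: Data: $\ell\ge 2$; layer sizes $n_1,\dots,n_\ell$ with $n=\sum_{k=1}^\ell n_k$; $W_k\in\mathbb{R}^{n_{k+1}\times n_k}$ and $b_k\in\mathbb{R}^{n_{k+1}}$ for $k=1,\dots,\ell-1$; $w_\ell\in\mathbb{R}^{n_\ell}$; $\hat x\in\mathbb{R}^{n_1}$; radius $\rho$; bound $R>0$. $\|\cdot\|$ is the Euclidean (Frobenius) norm; vector inequalities are componentwise; $\mathbf{e}_i$ is the $i$-th canonical basis vector; $\odot$ is the elementwise product; $\operatorname{diag}$ of a matrix is its diagonal as a vector and of a vector is the diagonal matrix. Problem (SDP-$r$), $1\le r\le n+1$: $\phi_r[c]=\min w_\ell^Tx_\ell$ over symmetric positive semidefinite $(n+1)\times(n+1)$ matrices $$X=\begin{bmatrix}x_0&x_1^T&\cdots&x_\ell^T\\ x_1&X_{1,1}&\cdots&X_{1,\ell}\\ \vdots&\vdots&\ddots&\vdots\\ x_\ell&X_{1,\ell}^T&\cdots&X_{\ell,\ell}\end{bmatrix}\succeq0,\qquad \operatorname{rank}(X)\le r$$ (with $x_0\in\mathbb{R}$, $x_k\in\mathbb{R}^{n_k}$, $X_{i,j}\in\mathbb{R}^{n_i\times n_j}$) subject to $\operatorname{tr}(X_{1,1})-2x_1^T\hat x+\|\hat x\|^2x_0\le\rho^2x_0$; for all $k\in\{1,\dots,\ell-1\}$, $x_{k+1}\ge0$, $x_{k+1}\ge W_kx_k+b_kx_0$, $\operatorname{diag}(X_{k+1,k+1}-W_kX_{k,k+1}-b_kx_{k+1}^T)=0$;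 and $x_0=1$, $\operatorname{tr}(X)\le R^2$. For $r=n+1$ the rank constraint is vacuous. Problem (BM-$r$): variables $u_0\in\mathbb{R}$, $u_k\in\mathbb{R}^{n_k}$, $V_k\in\mathbb{R}^{n_k\times(r-1)}$, $k=1,\dots,\ell$, collected in $x=(u_0,\{u_k\}_{k=1}^\ell,\{\operatorname{vec}(V_k)\}_{k=1}^\ell)$. It is $\min_{\|x\|\le R}f(x)$ s.t. $g(x)\le0$, $h(x)=0$, with $f(x)=u_0\,(w_\ell^Tu_\ell)$, $g=(g_0,\{g_{k,1},g_{k,2}\}_{k=1}^{\ell-1})$, $h=(h_0,\{h_k\}_{k=1}^{\ell-1})$, $g_0(x)=\|u_1-u_0\hat x\|^2+\|V_1\|^2-\rho^2$, $g_{k,1}(x)=-u_0u_{k+1}$, $g_{k,2}(x)=u_0(W_ku_k+b_ku_0-u_{k+1})$, $h_0(x)=1-u_0^2$, $h_k(x)=\operatorname{diag}[(u_{k+1}-W_ku_k-b_ku_0)u_{k+1}^T+(V_{k+1}-W_kV_k)V_{k+1}^T]$. It is obtained from (SDP-$r$) by substituting $X=UU^T$ with $U=\begin{bmatrix}u_0&0\\ u&V\end{bmatrix}$, $u=(u_1,\dots,u_\ell)$, $V=(V_1,\dots,V_\ell)$ stacked vertically, and has the same optimal value $\phi_r[c]$. Multipliers $y=(y_0,\{y_{k,1},y_{k,2}\}_{k=1}^{\ell-1})$ and $z=(z_0,\{z_k\}_{k=1}^{\ell-1})$ (with $y_0,z_0\in\mathbb{R}$, $y_{k,1},y_{k,2},z_k\in\mathbb{R}^{n_{k+1}}$)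 certify a feasible $x$ to be first-order optimal if $\nabla f(x)+\nabla g(x)y+\nabla h(x)z=0$, $y\odot g(x)=0$, $y\ge0$, where $\nabla g,\nabla h$ have gradients of components as columns. The slack matrix is the symmetric $(n+1)\times(n+1)$ matrix $$S(y,z)=\frac12\begin{bmatrix}s_0&s_1^T&s_2^T&\cdots&s_\ell^T\\ s_1&S_{1,1}&S_{1,2}&&\\ s_2&S_{1,2}^T&S_{2,2}&\ddots&\\ \vdots&&\ddots&\ddots&S_{\ell-1,\ell}\\ s_\ell&&&S_{\ell-1,\ell}^T&S_{\ell,\ell}\end{bmatrix}$$ (blank blocks zero), where, with $Z_k=\operatorname{diag}(z_k)$, $s_0=2[y_0(\|\hat x\|^2-\rho^2)+\sum_{k=1}^{\ell-1}b_k^Ty_{k,2}-z_0]$, $s_1=W_1^Ty_{1,2}-2\hat xy_0$, $s_{k+1}=W_{k+1}^Ty_{k+1,2}-(Z_kb_k+y_{k,1}+y_{k,2})$ for $k\in\{1,\dots,\ell-2\}$, $s_\ell=w_\ell-[Z_{\ell-1}b_{\ell-1}+y_{\ell-1,1}+y_{\ell-1,2}]$, $S_{1,1}=2y_0I$, and $S_{k,k+1}=-W_k^TZ_k$, $S_{k+1,k+1}=2Z_k$ for $k\in\{1,\dots,\ell-1\}$. Standing assumption: $R$ is chosen large enough that $\operatorname{tr}(X)<R^2$ holds at optimality for (SDP-$r$), equivalently $\|x\|<R$ at optimality for (BM-$r$).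
   Formalization: The constraint g_0 is taken with -ρ²u_0² instead of the printed -ρ² (same feasible set, as u_0²=1); with the printed form z_0 shifts by ρ²y_0 and the claimed identity fails whenever ρ²y_0>0. *)

theory Defs
  imports
    "HOL-Analysis.Derivative"
    "Jordan_Normal_Form.DL_Rank"
    "Jordan_Normal_Form.Spectral_Radius"
begin

definition vnorm :: "real vec \<Rightarrow> real" where
  "vnorm v = sqrt (v \<bullet> v)"

definition fnorm :: "real mat \<Rightarrow> real" where
  "fnorm A = sqrt (\<Sum>i<dim_row A. \<Sum>j<dim_col A. (A $$ (i, j))\<^sup>2)"

definition mtrace :: "real mat \<Rightarrow> real" where
  "mtrace A = (\<Sum>i<dim_row A. A $$ (i, i))"

definition diag_vec :: "real mat \<Rightarrow> real vec" where
  "diag_vec A = vec (dim_row A) (\<lambda>i. A $$ (i, i))"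

definition vec_diag :: "real vec \<Rightarrow> real mat" where
  "vec_diag v = mat_diag (dim_vec v) (\<lambda>i. v $ i)"

definition outer :: "real vec \<Rightarrow> real vec \<Rightarrow> real mat" where
  "outer u v = mat (dim_vec u) (dim_vec v) (\<lambda>(i, j). u $ i * v $ j)"

definition hadamard :: "real vec \<Rightarrow> real vec \<Rightarrow> real vec" where
  "hadamard u v = vec (dim_vec u) (\<lambda>i. u $ i * v $ i)"

definition psd :: "nat \<Rightarrow> real mat \<Rightarrow> bool" where
  "psd m A \<longleftrightarrow> A \<in> carrier_mat m m \<and> transpose_mat A = A \<and>
     (\<forall>v \<in> carrier_vec m. 0 \<le> v \<bullet> (A *\<^sub>v v))"

text \<open>Only applied to symmetric matrices, whose spectrum is real and non-empty.\<close>

definition lambda_min :: "real mat \<Rightarrow> real" where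
  "lambda_min A = Min (spectrum A)"

definition grad :: "(real vec \<Rightarrow> real) \<Rightarrow> real vec \<Rightarrow> real vec" where
  "grad F x = vec (dim_vec x) (\<lambda>i. deriv (\<lambda>t. F (x + t \<cdot>\<^sub>v unit_vec (dim_vec x) i)) 0)"

text \<open>The gradients of the components of \<open>G\<close> are the columns (so this is the transposed Jacobian).\<close>

definition grads :: "(real vec \<Rightarrow> real vec) \<Rightarrow> real vec \<Rightarrow> real mat" where
  "grads G x = mat (dim_vec x) (dim_vec (G x)) (\<lambda>(i, j). grad (\<lambda>x'. G x' $ j) x $ i)"


text \<open>Layers are numbered \<open>1, \<dots>, layers P\<close>; inside a layer, vectors and matrices are indexed from \<open>0\<close>.
  Values of \<open>width\<close>, \<open>weight\<close>, \<open>bias\<close> outside these ranges are irrelevant.\<close>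

record relu_data =
  layers :: nat
  width :: "nat \<Rightarrow> nat"
  weight :: "nat \<Rightarrow> real mat"
  bias :: "nat \<Rightarrow> real vec"
  wlast :: "real vec"
  center :: "real vec"
  radius :: real
  bound :: real

definition wf_data :: "relu_data \<Rightarrow> bool" where
  "wf_data P \<longleftrightarrow> 2 \<le> layers P \<and> (\<forall>k \<in> {1..layers P}. 1 \<le> width P k) \<and>
     (\<forall>k \<in> {1..<layers P}. weight P k \<in> carrier_mat (width P (k + 1)) (width P k) \<and>
        bias P k \<in> carrier_vec (width P (k + 1))) \<and>
     wlast P \<in> carrier_vec (width P (layers P)) \<and>
     center P \<in> carrier_vec (width P 1) \<and> 0 < bound P"

definition ntotal :: "relu_data \<Rightarrow> nat" where
  "ntotal P = (\<Sum>k \<in> {1..layers P}. width P k)"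

text \<open>Number of coordinates in the layers before layer \<open>k\<close>.\<close>

definition offset :: "relu_data \<Rightarrow> nat \<Rightarrow> nat" where
  "offset P k = (\<Sum>j \<in> {1..<k}. width P j)"


section \<open>The semidefinite problem\<close>

text \<open>Row and column \<open>0\<close> of \<open>X\<close> are the border; layer \<open>k\<close> starts at index \<open>1 + offset P k\<close>.\<close>

definition X0 :: "real mat \<Rightarrow> real" where
  "X0 X = X $$ (0, 0)"

definition Xvec :: "relu_data \<Rightarrow> real mat \<Rightarrow> nat \<Rightarrow> real vec" where
  "Xvec P X k = vec (width P k) (\<lambda>i. X $$ (1 + offset P k + i, 0))"

definition Xblk :: "relu_data \<Rightarrow> real mat \<Rightarrow> nat \<Rightarrow> nat \<Rightarrow> real mat" where
  "Xblk P X k m = mat (width P k) (width P m)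
     (\<lambda>(i, j). X $$ (1 + offset P k + i, 1 + offset P m + j))"

definition sdp_obj :: "relu_data \<Rightarrow> real mat \<Rightarrow> real" where
  "sdp_obj P X = wlast P \<bullet> Xvec P X (layers P)"

definition sdp_feasible :: "relu_data \<Rightarrow> nat \<Rightarrow> real mat \<Rightarrow> bool" where
  "sdp_feasible P r X \<longleftrightarrow>
     psd (ntotal P + 1) X \<and> vec_space.rank (ntotal P + 1) X \<le> r \<and>
     mtrace (Xblk P X 1 1) - 2 * (Xvec P X 1 \<bullet> center P) + (vnorm (center P))\<^sup>2 * X0 X
       \<le> (radius P)\<^sup>2 * X0 X \<and>
     (\<forall>k \<in> {1..<layers P}.
        0\<^sub>v (width P (k + 1)) \<le> Xvec P X (k + 1) \<and>
        weight P k *\<^sub>v Xvec P X k + X0 X \<cdot>\<^sub>v bias P k \<le> Xvec P X (k + 1) \<and>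
        diag_vec (Xblk P X (k + 1) (k + 1) - weight P k * Xblk P X k (k + 1)
                  - outer (bias P k) (Xvec P X (k + 1))) = 0\<^sub>v (width P (k + 1))) \<and>
     X0 X = 1 \<and> mtrace X \<le> (bound P)\<^sup>2"

definition sdp_optimal :: "relu_data \<Rightarrow> nat \<Rightarrow> real mat \<Rightarrow> bool" where
  "sdp_optimal P r X \<longleftrightarrow> sdp_feasible P r X \<and>
     (\<forall>X'. sdp_feasible P r X' \<longrightarrow> sdp_obj P X \<le> sdp_obj P X')"

text \<open>The optimal value; the feasible set is compact, so the infimum is a minimum when it is non-empty.\<close>

definition phi :: "relu_data \<Rightarrow> nat \<Rightarrow> real" where
  "phi P r = Inf (sdp_obj P ` {X. sdp_feasible P r X})"

definition max_rank_solution :: "relu_data \<Rightarrow> real mat \<Rightarrow> bool" where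
  "max_rank_solution P X \<longleftrightarrow> sdp_optimal P (ntotal P + 1) X \<and>
     (\<forall>X'. sdp_optimal P (ntotal P + 1) X' \<longrightarrow>
        vec_space.rank (ntotal P + 1) X' \<le> vec_space.rank (ntotal P + 1) X)"


section \<open>The factored problem\<close>

text \<open>A point is one flat vector \<open>(u\<^sub>0, u\<^sub>1, \<dots>, u\<^sub>\<ell>, vec V\<^sub>1, \<dots>, vec V\<^sub>\<ell>)\<close>, with column-major \<open>vec\<close>.\<close>

definition bm_dim :: "relu_data \<Rightarrow> nat \<Rightarrow> nat" where
  "bm_dim P r = 1 + ntotal P + ntotal P * (r - 1)"

definition u0 :: "real vec \<Rightarrow> real" where
  "u0 x = x $ 0"

definition uvec :: "relu_data \<Rightarrow> real vec \<Rightarrow> nat \<Rightarrow> real vec" where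
  "uvec P x k = vec (width P k) (\<lambda>i. x $ (1 + offset P k + i))"

definition Vmat :: "relu_data \<Rightarrow> nat \<Rightarrow> real vec \<Rightarrow> nat \<Rightarrow> real mat" where
  "Vmat P r x k = mat (width P k) (r - 1)
     (\<lambda>(i, j). x $ (1 + ntotal P + offset P k * (r - 1) + j * width P k + i))"

definition bm_f :: "relu_data \<Rightarrow> real vec \<Rightarrow> real" where
  "bm_f P x = u0 x * (wlast P \<bullet> uvec P x (layers P))"

text \<open>Substituting \<open>X = U U\<^sup>T\<close> turns the right-hand side \<open>\<rho>\<^sup>2 x\<^sub>0\<close> of the ball constraint into
  \<open>\<rho>\<^sup>2 u\<^sub>0\<^sup>2\<close>. Writing it as \<open>\<rho>\<^sup>2\<close> gives the same feasible set (lemma \<open>bm_g0_le_0_iff\<close>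
  below), but shifts the multiplier of \<open>1 - u\<^sub>0\<^sup>2 = 0\<close> by \<open>\<rho>\<^sup>2 y\<^sub>0\<close>. The term
  \<open>- y\<^sub>0 \<rho>\<^sup>2\<close> in the corner of the slack matrix belongs to the homogeneous form used here.\<close>

definition bm_g0 :: "relu_data \<Rightarrow> nat \<Rightarrow> real vec \<Rightarrow> real" where
  "bm_g0 P r x = (vnorm (uvec P x 1 - u0 x \<cdot>\<^sub>v center P))\<^sup>2 + (fnorm (Vmat P r x 1))\<^sup>2
     - (radius P)\<^sup>2 * (u0 x)\<^sup>2"

definition bm_g1 :: "relu_data \<Rightarrow> real vec \<Rightarrow> nat \<Rightarrow> real vec" where
  "bm_g1 P x k = (- u0 x) \<cdot>\<^sub>v uvec P x (k + 1)"

definition bm_g2 :: "relu_data \<Rightarrow> real vec \<Rightarrow> nat \<Rightarrow> real vec" where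
  "bm_g2 P x k =
     u0 x \<cdot>\<^sub>v (weight P k *\<^sub>v uvec P x k + u0 x \<cdot>\<^sub>v bias P k - uvec P x (k + 1))"

definition bm_h0 :: "real vec \<Rightarrow> real" where
  "bm_h0 x = 1 - (u0 x)\<^sup>2"

lemma bm_g0_le_0_iff:
  assumes "bm_h0 x = 0"
  shows "bm_g0 P r x \<le> 0 \<longleftrightarrow>
    (vnorm (uvec P x 1 - u0 x \<cdot>\<^sub>v center P))\<^sup>2 + (fnorm (Vmat P r x 1))\<^sup>2 - (radius P)\<^sup>2 \<le> 0"
  using assms by (simp add: bm_g0_def bm_h0_def)

definition bm_hk :: "relu_data \<Rightarrow> nat \<Rightarrow> real vec \<Rightarrow> nat \<Rightarrow> real vec" where
  "bm_hk P r x k = diag_vec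
     (outer (uvec P x (k + 1) - weight P k *\<^sub>v uvec P x k - u0 x \<cdot>\<^sub>v bias P k) (uvec P x (k + 1))
      + (Vmat P r x (k + 1) - weight P k * Vmat P r x k) * transpose_mat (Vmat P r x (k + 1)))"

text \<open>\<open>(a, A\<^sub>1, B\<^sub>1, \<dots>, A\<^bsub>\<ell>-1\<^esub>, B\<^bsub>\<ell>-1\<^esub>)\<close> and \<open>(a, A\<^sub>1, \<dots>, A\<^bsub>\<ell>-1\<^esub>)\<close> as flat vectors; used alike for
  constraint values and for multipliers.\<close>

definition stack2 :: "relu_data \<Rightarrow> real \<Rightarrow> (nat \<Rightarrow> real vec) \<Rightarrow> (nat \<Rightarrow> real vec) \<Rightarrow> real vec" where
  "stack2 P a A B = vec_of_list
     (a # concat (map (\<lambda>k. list_of_vec (A k) @ list_of_vec (B k)) [1..<layers P]))"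

definition stack1 :: "relu_data \<Rightarrow> real \<Rightarrow> (nat \<Rightarrow> real vec) \<Rightarrow> real vec" where
  "stack1 P a A = vec_of_list (a # concat (map (\<lambda>k. list_of_vec (A k)) [1..<layers P]))"

definition bm_g :: "relu_data \<Rightarrow> nat \<Rightarrow> real vec \<Rightarrow> real vec" where
  "bm_g P r x = stack2 P (bm_g0 P r x) (bm_g1 P x) (bm_g2 P x)"

definition bm_h :: "relu_data \<Rightarrow> nat \<Rightarrow> real vec \<Rightarrow> real vec" where
  "bm_h P r x = stack1 P (bm_h0 x) (bm_hk P r x)"

definition bm_feasible :: "relu_data \<Rightarrow> nat \<Rightarrow> real vec \<Rightarrow> bool" where
  "bm_feasible P r x \<longleftrightarrow> x \<in> carrier_vec (bm_dim P r) \<and> vnorm x \<le> bound P \<and>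
     bm_g P r x \<le> 0\<^sub>v (dim_vec (bm_g P r x)) \<and> bm_h P r x = 0\<^sub>v (dim_vec (bm_h P r x))"

definition bm_optimal :: "relu_data \<Rightarrow> nat \<Rightarrow> real vec \<Rightarrow> bool" where
  "bm_optimal P r x \<longleftrightarrow> bm_feasible P r x \<and>
     (\<forall>x'. bm_feasible P r x' \<longrightarrow> bm_f P x \<le> bm_f P x')"


section \<open>Multipliers and slack matrix\<close>

record multipliers =
  y0 :: real
  y1 :: "nat \<Rightarrow> real vec"
  y2 :: "nat \<Rightarrow> real vec"
  z0 :: real
  zk :: "nat \<Rightarrow> real vec"

definition wf_mult :: "relu_data \<Rightarrow> multipliers \<Rightarrow> bool" where
  "wf_mult P m \<longleftrightarrow> (\<forall>k \<in> {1..<layers P}.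
     y1 m k \<in> carrier_vec (width P (k + 1)) \<and> y2 m k \<in> carrier_vec (width P (k + 1)) \<and>
     zk m k \<in> carrier_vec (width P (k + 1)))"

definition yvec :: "relu_data \<Rightarrow> multipliers \<Rightarrow> real vec" where
  "yvec P m = stack2 P (y0 m) (y1 m) (y2 m)"

definition zvec :: "relu_data \<Rightarrow> multipliers \<Rightarrow> real vec" where
  "zvec P m = stack1 P (z0 m) (zk m)"

definition certifies_first_order :: "relu_data \<Rightarrow> nat \<Rightarrow> real vec \<Rightarrow> multipliers \<Rightarrow> bool" where
  "certifies_first_order P r x m \<longleftrightarrow> bm_feasible P r x \<and> wf_mult P m \<and>
     grad (bm_f P) x + grads (bm_g P r) x *\<^sub>v yvec P m + grads (bm_h P r) x *\<^sub>v zvec P m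
       = 0\<^sub>v (bm_dim P r) \<and>
     hadamard (yvec P m) (bm_g P r x) = 0\<^sub>v (dim_vec (yvec P m)) \<and>
     0\<^sub>v (dim_vec (yvec P m)) \<le> yvec P m"

definition slack_corner :: "relu_data \<Rightarrow> multipliers \<Rightarrow> real" where
  "slack_corner P m = 2 * (y0 m * ((vnorm (center P))\<^sup>2 - (radius P)\<^sup>2)
     + (\<Sum>k \<in> {1..<layers P}. bias P k \<bullet> y2 m k) - z0 m)"

definition slack_vec :: "relu_data \<Rightarrow> multipliers \<Rightarrow> nat \<Rightarrow> real vec" where
  "slack_vec P m k =
     (if k = 1 then
        transpose_mat (weight P 1) *\<^sub>v y2 m 1 - (2 * y0 m) \<cdot>\<^sub>v center P
      else if k < layers P then
        transpose_mat (weight P k) *\<^sub>v y2 m k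
        - (vec_diag (zk m (k - 1)) *\<^sub>v bias P (k - 1) + y1 m (k - 1) + y2 m (k - 1))
      else
        wlast P - (vec_diag (zk m (k - 1)) *\<^sub>v bias P (k - 1) + y1 m (k - 1) + y2 m (k - 1)))"

definition slack_blk :: "relu_data \<Rightarrow> multipliers \<Rightarrow> nat \<Rightarrow> nat \<Rightarrow> real mat" where
  "slack_blk P m k k' =
     (if k = k' then
        (if k = 1 then (2 * y0 m) \<cdot>\<^sub>m 1\<^sub>m (width P 1) else 2 \<cdot>\<^sub>m vec_diag (zk m (k - 1)))
      else if k' = k + 1 then - (transpose_mat (weight P k) * vec_diag (zk m k))
      else if k = k' + 1 then transpose_mat (- (transpose_mat (weight P k') * vec_diag (zk m k')))
      else 0\<^sub>m (width P k) (width P k'))"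

text \<open>Index \<open>a \<ge> 1\<close> of an \<open>(n+1) \<times> (n+1)\<close> matrix is coordinate \<open>coord_of P a\<close> of layer \<open>layer_of P a\<close>.\<close>

definition layer_of :: "relu_data \<Rightarrow> nat \<Rightarrow> nat" where
  "layer_of P a = (LEAST k. a < 1 + offset P (k + 1))"

definition coord_of :: "relu_data \<Rightarrow> nat \<Rightarrow> nat" where
  "coord_of P a = a - (1 + offset P (layer_of P a))"

definition slack :: "relu_data \<Rightarrow> multipliers \<Rightarrow> real mat" where
  "slack P m = (1 / 2) \<cdot>\<^sub>m mat (ntotal P + 1) (ntotal P + 1) (\<lambda>(a, b).
     if a = 0 \<and> b = 0 then slack_corner P m
     else if a = 0 then slack_vec P m (layer_of P b) $ coord_of P b
     else if b = 0 then slack_vec P m (layer_of P a) $ coord_of P a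
     else slack_blk P m (layer_of P a) (layer_of P b) $$ (coord_of P a, coord_of P b))"

end

theory Submission
  imports Defs
begin

text \<open>Pulled back along \<open>X = U U\<^sup>T\<close>, every constraint of (BM-\<open>r\<close>) is an affine form in \<open>X\<close>, and the Lagrangian
  is \<open>z\<^sub>0 + \<langle>S(y, z), X\<rangle>\<close>. Since \<open>X\<^sup>\<star>\<close> has rank at most \<open>r\<close>, it factors as a feasible point of
  (BM-\<open>r\<close>), so \<open>U U\<^sup>T\<close> also solves the convex problem. Separation in the convex problem yields
  Fritz John multipliers, whose slack form is nonnegative on the positive semidefinite cone and vanishes
  to first order at \<open>U\<close>. The nonvanishing assumptions make the active constraint gradients of (BM-\<open>r\<close>)
  linearly independent at \<open>x\<close>. Hence the objective multiplier is nonzero, and the normalised multipliers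
  are the only ones that certify \<open>x\<close>; so \<open>S(y, z) \<succeq> 0\<close>, \<open>S(y, z) U = 0\<close> and \<open>z\<^sub>0 = \<phi>\<^sub>r[c]\<close>.\<close>

text \<open>The obstacle is that no strictly feasible matrix is assumed for the convex problem, so
  separation alone only gives multipliers whose objective coefficient \<open>c\<close> may vanish.
  The missing constraint qualification is supplied by the nonconvex side, at the given point:
  \<open>multipliers_zero\<close> kills every multiplier with \<open>c = 0\<close> that is
  stationary and complementary at \<open>U\<close>. It assumes no signs, and therefore serves twice:
  to show \<open>c \<noteq> 0\<close>, and to compare two certificates, in whose difference the
  objective cancels and the signs are arbitrary. The second use turns one good certificate into a
  statement about all of them.

  The trace bound is discarded before separating, so that the convex multipliers have exactly the
  components of those of (BM-r). All constraints are homogeneous in X except \<open>x_0 = 1\<close>;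
  hence the only constant is \<open>z Corner\<close>, and scaling inside the cone identifies it as
  \<open>c * \<phi>\<close>. The term with R^2 drops out because a positive semidefinite matrix with
  a nonzero kernel vector has smallest eigenvalue exactly 0.\<close>

unbundle no vec_syntax and no inner_syntax

section \<open>Multipliers for convex problems\<close>

text \<open>K need not be closed, so the inequality is weak. A new coordinate \<open>a\<close> is
  handled as follows: unless K lies on one side of \<open>f a = 0\<close>, its slice by that
  hyperplane is nonempty and has a separating functional by induction, and \<open>\<mu>\<close> is
  the coefficient of \<open>a\<close> that extends this functional to all of K.\<close>

lemma separate_zero:
  fixes K :: "('i \<Rightarrow> real) set"
  assumes "finite I" "K \<noteq> {}"
    and "\<And>f g t. f \<in> K \<Longrightarrow> g \<in> K \<Longrightarrow> 0 < t \<Longrightarrow> t < 1 \<Longrightarrow> (\<lambda>i. (1 - t) * f i + t * g i) \<in> K"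
    and "\<And>f. f \<in> K \<Longrightarrow> \<exists>i\<in>I. f i \<noteq> 0"
  shows "\<exists>c. (\<exists>i\<in>I. c i \<noteq> 0) \<and> (\<forall>f\<in>K. 0 \<le> (\<Sum>i\<in>I. c i * f i))"
  using assms
proof (induction I arbitrary: K rule: finite_induct)
  case empty
  then show ?case by fastforce
next
  case (insert a I)
  note conv = insert.prems(2)
  consider "\<forall>f\<in>K. 0 \<le> f a" | "\<forall>f\<in>K. f a \<le> 0"
    | f0 g0 where "f0 \<in> K" "0 < f0 a" "g0 \<in> K" "g0 a < 0"
    by (meson not_less)
  then show ?case
  proof cases
    case 1
    show ?thesis
      by (rule exI[of _ "\<lambda>i. if i = a then 1 else 0"])
        (use 1 insert.hyps in \<open>auto simp: mult_delta_left\<close>)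
  next
    case 2
    show ?thesis
      by (rule exI[of _ "\<lambda>i. if i = a then - 1 else 0"])
        (use 2 insert.hyps in \<open>auto simp: mult_delta_left\<close>)
  next
    case 3
    define K' where "K' = {f \<in> K. f a = 0}"
    \<comment> \<open>\<open>t\<close> marks the point where the segment from \<open>f\<close> to
      \<open>g\<close> crosses the hyperplane.\<close>
    have comb: "\<exists>t. 0 < t \<and> t < 1 \<and> 1 - t = - g a / (f a - g a) \<and> t = f a / (f a - g a) \<and>
        (\<lambda>i. (1 - t) * f i + t * g i) \<in> K'"
      if "f \<in> K" "0 < f a" "g \<in> K" "g a < 0" for f g
    proof -
      define t where "t = f a / (f a - g a)"
      have t: "0 < t" "t < 1" "1 - t = - g a / (f a - g a)"
        using that by (auto simp: t_def field_simps)
      have "(1 - t) * f a + t * g a = 0"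
        unfolding t(3) by (simp add: t_def divide_simps)
      then have "(\<lambda>i. (1 - t) * f i + t * g i) \<in> K'"
        using conv[OF that(1,3) t(1,2)] by (simp add: K'_def)
      with t show ?thesis by (intro exI[of _ t]) (auto simp: t_def)
    qed
    have "K' \<noteq> {}" using comb[OF 3] by blast
    moreover have "\<exists>i\<in>I. f i \<noteq> 0" if "f \<in> K'" for f
      using that insert.prems(3)[of f] by (auto simp: K'_def)
    ultimately obtain c where c: "\<exists>i\<in>I. c i \<noteq> 0" "\<And>f. f \<in> K' \<Longrightarrow> 0 \<le> (\<Sum>i\<in>I. c i * f i)"
    proof -
      assume K': "K' \<noteq> {}" "\<And>f. f \<in> K' \<Longrightarrow> \<exists>i\<in>I. f i \<noteq> 0"
      have "(\<lambda>i. (1 - t) * f i + t * g i) \<in> K'" if "f \<in> K'" "g \<in> K'" "0 < t" "t < 1" for f g t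
        using conv[of f g t] that by (simp add: K'_def)
      then show ?thesis using insert.IH[of K', OF K'(1) _ K'(2)] that by blast
    qed
    define L where "L f = (\<Sum>i\<in>I. c i * f i)" for f
    \<comment> \<open>Points with \<open>f a > 0\<close> bound \<open>\<mu>\<close> from below and
      points with \<open>g a < 0\<close> bound it from above. Nonnegativity of \<open>L\<close> at
      the crossing point says that these bounds are compatible.\<close>
    have key: "- L f / f a \<le> - L g / g a" if fg: "f \<in> K" "0 < f a" "g \<in> K" "g a < 0" for f g
    proof -
      obtain t where t: "1 - t = - g a / (f a - g a)" "t = f a / (f a - g a)"
          "(\<lambda>i. (1 - t) * f i + t * g i) \<in> K'"
        using comb[OF fg] by blast
      have "0 \<le> (1 - t) * L f + t * L g"
        using c(2)[OF t(3)] by (simp add: L_def sum_distrib_left sum.distrib[symmetric] algebra_simps)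
      also have "\<dots> = (- g a * L f + f a * L g) / (f a - g a)"
        unfolding t(1) unfolding t(2) by (simp add: add_divide_distrib diff_divide_distrib)
      finally have "0 \<le> - g a * L f + f a * L g" using that by (simp add: zero_le_divide_iff)
      then have "- L f * - g a \<le> L g * f a" by (simp add: mult.commute)
      then have "- L f / f a \<le> L g / - g a" using that by (simp only: pos_divide_le_eq times_divide_eq_left pos_le_divide_eq neg_0_less_iff_less)
      then show ?thesis by simp
    qed
    define \<mu> where "\<mu> = Sup ((\<lambda>f. - L f / f a) ` {f \<in> K. 0 < f a})"
    have up: "- L f / f a \<le> \<mu>" if "f \<in> K" "0 < f a" for f
      unfolding \<mu>_def
      by (rule cSup_upper) (use that key[OF _ _ 3(3,4)] in \<open>auto intro!: bdd_aboveI2[where M = "- L g0 / g0 a"]\<close>)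
    have lo: "\<mu> \<le> - L g / g a" if "g \<in> K" "g a < 0" for g
      unfolding \<mu>_def
      by (rule cSup_least) (use 3 that key in auto)
    have "0 \<le> (\<Sum>i\<in>insert a I. (c(a := \<mu>)) i * f i)" if "f \<in> K" for f
    proof -
      have "(\<Sum>i\<in>insert a I. (c(a := \<mu>)) i * f i) = \<mu> * f a + L f"
        using insert.hyps by (auto simp: L_def intro!: sum.cong)
      also have "0 \<le> \<dots>"
      proof (cases "f a" "0 :: real" rule: linorder_cases)
        case less
        then show ?thesis using lo[OF that] by (simp add: field_simps)
      next
        case equal
        then show ?thesis using c(2)[of f] that by (simp add: K'_def L_def)
      next
        case greater
        then show ?thesis using up[OF that] by (simp add: field_simps)
      qed
      finally show ?thesis .
    qed
    moreover have "\<exists>i\<in>insert a I. (c(a := \<mu>)) i \<noteq> 0"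
      using c(1) insert.hyps by auto
    ultimately show ?thesis by blast
  qed
qed

text \<open>Separates 0 from the vectors with components \<open>f X - p + s\<close>,
  \<open>g i X + t i\<close>, \<open>h j X\<close>, where \<open>s > 0\<close> and
  \<open>t i \<ge> 0\<close>: such a vector being 0 would exhibit a feasible point with value below
  \<open>p\<close>. Letting \<open>s\<close> and \<open>t i\<close> grow gives the signs of the
  coefficients. Nothing here excludes \<open>c = 0\<close>.\<close>

lemma fritz_john_multipliers:
  fixes f :: "'a \<Rightarrow> real" and g :: "'i \<Rightarrow> 'a \<Rightarrow> real" and h :: "'j \<Rightarrow> 'a \<Rightarrow> real"
  assumes fin: "finite I" "finite J" and ne: "D \<noteq> {}"
    and conv: "\<And>X Y t. X \<in> D \<Longrightarrow> Y \<in> D \<Longrightarrow> 0 < t \<Longrightarrow> t < 1 \<Longrightarrow>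
      \<exists>Z\<in>D. f Z = (1 - t) * f X + t * f Y \<and> (\<forall>i\<in>I. g i Z = (1 - t) * g i X + t * g i Y) \<and>
        (\<forall>j\<in>J. h j Z = (1 - t) * h j X + t * h j Y)"
    and opt: "\<And>X. X \<in> D \<Longrightarrow> (\<And>i. i \<in> I \<Longrightarrow> g i X \<le> 0) \<Longrightarrow> (\<And>j. j \<in> J \<Longrightarrow> h j X = 0) \<Longrightarrow> p \<le> f X"
  shows "\<exists>c y z. 0 \<le> c \<and> (\<forall>i\<in>I. 0 \<le> y i) \<and>
    (c \<noteq> 0 \<or> (\<exists>i\<in>I. y i \<noteq> 0) \<or> (\<exists>j\<in>J. z j \<noteq> 0)) \<and>
    (\<forall>X\<in>D. c * p \<le> c * f X + (\<Sum>i\<in>I. y i * g i X) + (\<Sum>j\<in>J. z j * h j X))"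
proof -
  define val :: "'a \<Rightarrow> real \<Rightarrow> ('i \<Rightarrow> real) \<Rightarrow> unit + 'i + 'j \<Rightarrow> real" where
    "val X s t = case_sum (\<lambda>_. f X - p + s) (case_sum (\<lambda>i. g i X + t i) (\<lambda>j. h j X))" for X s t
  \<comment> \<open>Only the values at indices from \<open>I\<close> and \<open>J\<close> are
    prescribed, because \<open>conv\<close> controls \<open>g\<close> and \<open>h\<close> nowhere
    else and K must be convex as a set of functions.\<close>
  define K where "K = {k. \<exists>X\<in>D. \<exists>s>0. \<exists>t. (\<forall>i\<in>I. 0 \<le> t i) \<and> (\<forall>q\<in>{()} <+> (I <+> J). k q = val X s t q)}"
  define S where "S = {()} <+> (I <+> J)"
  have mem: "val X s t \<in> K" if "X \<in> D" "0 < s" "\<And>i. i \<in> I \<Longrightarrow> 0 \<le> t i" for X s t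
    using that by (auto simp: K_def)
  have "\<exists>c. (\<exists>i\<in>S. c i \<noteq> 0) \<and> (\<forall>k\<in>K. 0 \<le> (\<Sum>i\<in>S. c i * k i))"
  proof (rule separate_zero)
    show "finite S" using fin by (simp add: S_def)
    show "K \<noteq> {}" using ne mem[of _ 1 "\<lambda>_. 0"] by auto
  next
    fix k l and t :: real
    assume k: "k \<in> K" and l: "l \<in> K" and t: "0 < t" "t < 1"
    obtain X s a where X: "X \<in> D" "0 < s" "\<forall>i\<in>I. 0 \<le> a i" "\<forall>q\<in>{()} <+> (I <+> J). k q = val X s a q"
      using k by (auto simp: K_def)
    obtain Y u b where Y: "Y \<in> D" "0 < u" "\<forall>i\<in>I. 0 \<le> b i" "\<forall>q\<in>{()} <+> (I <+> J). l q = val Y u b q"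
      using l by (auto simp: K_def)
    obtain Z where Z: "Z \<in> D" "f Z = (1 - t) * f X + t * f Y"
      "\<forall>i\<in>I. g i Z = (1 - t) * g i X + t * g i Y" "\<forall>j\<in>J. h j Z = (1 - t) * h j X + t * h j Y"
      using conv[OF X(1) Y(1) t] by blast
    have "\<forall>q\<in>{()} <+> (I <+> J). (1 - t) * k q + t * l q
        = val Z ((1 - t) * s + t * u) (\<lambda>i. (1 - t) * a i + t * b i) q"
    proof
      fix q assume q: "q \<in> {()} <+> (I <+> J)"
      then have "k q = val X s a q" "l q = val Y u b q" using X(4) Y(4) by blast+
      then show "(1 - t) * k q + t * l q
        = val Z ((1 - t) * s + t * u) (\<lambda>i. (1 - t) * a i + t * b i) q"
        using q Z by (auto simp: val_def algebra_simps)
    qed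
    moreover have "0 < (1 - t) * s + t * u" using X Y t by (simp add: add_pos_pos)
    moreover have "\<forall>i\<in>I. 0 \<le> (1 - t) * a i + t * b i" using X Y t by auto
    ultimately show "(\<lambda>i. (1 - t) * k i + t * l i) \<in> K"
      unfolding K_def
      by (intro CollectI bexI[OF _ Z(1)] exI[of _ "(1 - t) * s + t * u"]
          exI[of _ "\<lambda>i. (1 - t) * a i + t * b i"] conjI)
  next
    fix k assume "k \<in> K"
    then obtain X s a where X: "X \<in> D" "0 < s" "\<forall>i\<in>I. 0 \<le> a i" "\<forall>q\<in>S. k q = val X s a q"
      by (auto simp: K_def S_def)
    show "\<exists>q\<in>S. k q \<noteq> 0"
    proof (rule ccontr)
      assume "\<not> ?thesis"
      then have z: "val X s a q = 0" if "q \<in> S" for q using X(4) that by auto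
      have "g i X \<le> 0" if "i \<in> I" for i
      proof -
        have "Inr (Inl i) \<in> S" using that by (auto simp: S_def)
        from z[OF this] show ?thesis using X(3) that by (auto simp: val_def)
      qed
      moreover have "h j X = 0" if "j \<in> J" for j
      proof -
        have "Inr (Inr j) \<in> S" using that by (auto simp: S_def)
        from z[OF this] show ?thesis by (auto simp: val_def)
      qed
      ultimately have "p \<le> f X" using opt X(1) by blast
      then show False using z[of "Inl ()"] X(2) by (auto simp: S_def val_def)
    qed
  qed
  then obtain c where c: "\<exists>i\<in>S. c i \<noteq> 0" "\<And>k. k \<in> K \<Longrightarrow> 0 \<le> (\<Sum>i\<in>S. c i * k i)" by blast
  define c0 y z where "c0 = c (Inl ())" and "y i = c (Inr (Inl i))" and "z j = c (Inr (Inr j))" for i j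
  have ge: "0 \<le> c0 * (f X - p + s) + (\<Sum>i\<in>I. y i * (g i X + t i)) + (\<Sum>j\<in>J. z j * h j X)"
    if "X \<in> D" "0 < s" "\<And>i. i \<in> I \<Longrightarrow> 0 \<le> t i" for X s t
    using c(2)[OF mem[OF that]] fin
    by (simp add: S_def sum.Plus val_def c0_def y_def z_def add.assoc)
  obtain X where X: "X \<in> D" using ne by blast
  define B where "B = c0 * (f X - p) + (\<Sum>i\<in>I. y i * g i X) + (\<Sum>j\<in>J. z j * h j X)"
  have c0: "0 \<le> c0"
  proof (rule ccontr)
    assume "\<not> 0 \<le> c0"
    \<comment> \<open>With this slack the separating value would be
      \<open>B - \<bar>B\<bar> - 1\<close>, which is negative.\<close>
    then obtain s where "0 < s" "c0 * s = - (\<bar>B\<bar> + 1)"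
      using that[of "(\<bar>B\<bar> + 1) / - c0"] by (simp add: divide_simps)
    then show False using ge[OF X, of s "\<lambda>_. 0"] by (simp add: B_def algebra_simps)
  qed
  have y: "0 \<le> y i" if "i \<in> I" for i
  proof (rule ccontr)
    assume neg: "\<not> 0 \<le> y i"
    \<comment> \<open>The slack \<open>s\<close> has to be positive and is set to 1 here, whence the
      extra \<open>c0\<close>.\<close>
    define \<tau> where "\<tau> = (\<bar>B + c0\<bar> + 1) / - y i"
    have tau: "0 \<le> \<tau>" "y i * \<tau> = - (\<bar>B + c0\<bar> + 1)" using neg by (auto simp: \<tau>_def divide_simps)
    have "(\<Sum>k\<in>I. y k * (g k X + (if k = i then \<tau> else 0)))
        = (\<Sum>k\<in>I. y k * g k X) + y i * \<tau>"
      using fin that by (simp add: distrib_left sum.distrib mult_delta_right)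
    moreover have "0 \<le> c0 * (f X - p + 1) + (\<Sum>k\<in>I. y k * (g k X + (if k = i then \<tau> else 0)))
        + (\<Sum>j\<in>J. z j * h j X)"
      using tau by (intro ge[OF X]) auto
    ultimately show False using tau(2) by (simp add: B_def algebra_simps)
  qed
  have "c0 * p \<le> c0 * f X + (\<Sum>i\<in>I. y i * g i X) + (\<Sum>j\<in>J. z j * h j X)" if "X \<in> D" for X
  \<comment> \<open>The slack \<open>s\<close> tends to 0; the denominator \<open>c0 + 1\<close>
    keeps \<open>c0 * s \<le> e\<close> even if \<open>c0 = 0\<close>.\<close>
  proof (rule field_le_epsilon)
    fix e :: real assume e: "0 < e"
    have "c0 * (e / (c0 + 1)) \<le> e" using e c0 by (simp add: field_simps)
    moreover have "0 < e / (c0 + 1)" using e c0 by simp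
    ultimately show "c0 * p \<le> c0 * f X + (\<Sum>i\<in>I. y i * g i X) + (\<Sum>j\<in>J. z j * h j X) + e"
      using ge[OF that, of "e / (c0 + 1)" "\<lambda>_. 0"] by (simp add: algebra_simps)
  qed
  moreover have "c0 \<noteq> 0 \<or> (\<exists>i\<in>I. y i \<noteq> 0) \<or> (\<exists>j\<in>J. z j \<noteq> 0)"
    using c(1) by (auto simp: S_def c0_def y_def z_def)
  ultimately show ?thesis using c0 y by blast
qed

section \<open>Positive semidefinite matrices and low-rank factors\<close>

lemma quadratic_nonneg_imp_linear_zero:
  fixes b c :: real
  assumes "\<And>t. 0 \<le> t * b + t\<^sup>2 * c"
  shows "b = 0"
proof (rule ccontr)
  assume b: "b \<noteq> 0"
  \<comment> \<open>A step \<open>t = - s * b\<close> against the slope, short enough for the linear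
    term to dominate the quadratic one.\<close>
  define s where "s = 1 / (\<bar>c\<bar> + 1)"
  have s: "0 < s" "s * c < 1" by (auto simp: s_def divide_simps)
  have "0 \<le> (- s * b) * b + (- s * b)\<^sup>2 * c" using assms .
  also have "\<dots> = s * b\<^sup>2 * (s * c - 1)" by (simp add: power2_eq_square algebra_simps)
  also have "\<dots> < 0" using s b by (simp add: mult_less_0_iff)
  finally show False by simp
qed

definition bilin :: "nat \<Rightarrow> (nat \<Rightarrow> nat \<Rightarrow> real) \<Rightarrow> (nat \<Rightarrow> real) \<Rightarrow> (nat \<Rightarrow> real) \<Rightarrow> real" where
  "bilin N X v w = (\<Sum>a<N. \<Sum>b<N. v a * X a b * w b)"

text \<open>Matrices as functions make convex combinations, Schur complements and tangents free of
  dimension conditions. Symmetry is demanded separately because a quadratic form does not see the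
  antisymmetric part.\<close>

definition psd_fun :: "nat \<Rightarrow> (nat \<Rightarrow> nat \<Rightarrow> real) \<Rightarrow> bool" where
  "psd_fun N X \<longleftrightarrow> (\<forall>a<N. \<forall>b<N. X a b = X b a) \<and> (\<forall>w. 0 \<le> bilin N X w w)"

lemma bilin_perturb:
  assumes "\<forall>a<N. \<forall>b<N. X a b = X b a" and "s < N"
  shows "bilin N X (\<lambda>a. w a + (if a = s then t else 0)) (\<lambda>a. w a + (if a = s then t else 0))
    = bilin N X w w + t * (2 * (\<Sum>b<N. X s b * w b)) + t\<^sup>2 * X s s"
proof -
  have row: "(\<Sum>b<N. (w a + (if a = s then t else 0)) * X a b * (w b + (if b = s then t else 0)))
     = (\<Sum>b<N. w a * X a b * w b) + w a * X a s * t + (if a = s then t * (\<Sum>b<N. X a b * w b) + t\<^sup>2 * X a s else 0)"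
    for a
    using assms(2)
    by (simp add: algebra_simps sum.distrib mult_delta_right sum_distrib_left power2_eq_square)
  have "(\<Sum>a<N. w a * X a s * t) = t * (\<Sum>b<N. X s b * w b)"
    using assms by (simp add: sum_distrib_left mult_ac)
  then show ?thesis
    unfolding bilin_def row using assms(2) by (simp add: sum.distrib algebra_simps)
qed

text \<open>A zero of a nonnegative form is a minimum, so the derivative along each coordinate
  vanishes there.\<close>

lemma psd_fun_null:
  assumes "psd_fun N X" "bilin N X w w = 0" "a < N"
  shows "(\<Sum>b<N. X a b * w b) = 0"
proof -
  have sym: "\<forall>a<N. \<forall>b<N. X a b = X b a" using assms(1) by (simp add: psd_fun_def)
  have "0 \<le> t * (2 * (\<Sum>b<N. X a b * w b)) + t\<^sup>2 * X a a" for t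
  proof -
    have "0 \<le> bilin N X (\<lambda>b. w b + (if b = a then t else 0)) (\<lambda>b. w b + (if b = a then t else 0))"
      using assms(1) unfolding psd_fun_def by blast
    then show ?thesis
      unfolding bilin_perturb[OF sym assms(3), where w = w and t = t] using assms(2) by simp
  qed
  then show ?thesis using quadratic_nonneg_imp_linear_zero by fastforce
qed

lemma bilin_unit:
  assumes "s < N"
  shows "bilin N X (\<lambda>a. if a = s then 1 else 0) (\<lambda>a. if a = s then 1 else 0) = X s s"
  using assms by (simp add: bilin_def mult_delta_right mult_delta_left)

lemma psd_fun_diag_nonneg: "psd_fun N X \<Longrightarrow> s < N \<Longrightarrow> 0 \<le> X s s"
  using bilin_unit[of s N X] by (metis psd_fun_def)

lemma psd_fun_diag_zero:
  assumes "psd_fun N X" "s < N" "X s s = 0" "a < N"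
  shows "X a s = 0"
  using psd_fun_null[OF assms(1) _ assms(4), of "\<lambda>a. if a = s then 1 else 0"] assms
  by (simp add: bilin_unit mult_delta_right)

text \<open>The Schur complement evaluated at \<open>w\<close> is the form of \<open>X\<close>
  minimised over changes of coordinate \<open>s\<close>; the minimum is at the shift
  \<open>- \<beta> / X s s\<close>.\<close>

lemma psd_fun_schur:
  assumes X: "psd_fun N X" and s: "s < N" "0 < X s s"
  shows "psd_fun N (\<lambda>a b. X a b - X s a * X s b / X s s)"
proof -
  have sym: "\<forall>a<N. \<forall>b<N. X a b = X b a" using X by (simp add: psd_fun_def)
  have "0 \<le> bilin N (\<lambda>a b. X a b - X s a * X s b / X s s) w w" for w
  proof -
    define \<beta> where "\<beta> = (\<Sum>b<N. X s b * w b)"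
    have "\<beta> * \<beta> = (\<Sum>a<N. \<Sum>b<N. X s a * w a * (X s b * w b))"
      by (simp add: \<beta>_def sum_product)
    then have "bilin N (\<lambda>a b. X a b - X s a * X s b / X s s) w w = bilin N X w w - \<beta> * \<beta> / X s s"
      by (simp add: bilin_def sum_divide_distrib algebra_simps sum_subtractf)
    also have "\<dots> = bilin N X (\<lambda>a. w a + (if a = s then - \<beta> / X s s else 0)) (\<lambda>a. w a + (if a = s then - \<beta> / X s s else 0))"
      unfolding bilin_perturb[OF sym s(1), where w = w and t = "- \<beta> / X s s"] \<beta>_def[symmetric]
      using s by (simp add: power2_eq_square)
    finally show ?thesis using X by (simp add: psd_fun_def)
  qed
  then show ?thesis using sym by (simp add: psd_fun_def mult.commute)
qed

text \<open>Phrased by kernel vectors supported in \<open>I\<close>, so that passing from a Schur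
  complement back to the matrix changes a single coordinate of \<open>w\<close>.\<close>

definition columns_independent :: "nat \<Rightarrow> (nat \<Rightarrow> nat \<Rightarrow> real) \<Rightarrow> nat set \<Rightarrow> bool" where
  "columns_independent N X I \<longleftrightarrow>
    (\<forall>w. (\<forall>b. b \<notin> I \<longrightarrow> w b = 0) \<longrightarrow> (\<forall>a<N. (\<Sum>b<N. X a b * w b) = 0) \<longrightarrow> (\<forall>b. w b = 0))"

text \<open>Pivots are taken in increasing order; the columns of the pivots are independent, so their
  number is bounded by the rank.\<close>

lemma pivoted_cholesky:
  assumes "psd_fun N X" "s \<le> N" "\<And>a b. a < s \<Longrightarrow> b < N \<Longrightarrow> X a b = 0"
  shows "\<exists>I v. I \<subseteq> {s..<N} \<and>
    (\<forall>a<N. \<forall>b<N. X a b = (\<Sum>j<card I. v j a * v j b)) \<and>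
    (\<forall>j<card I. \<forall>a<s. v j a = 0) \<and>
    columns_independent N X I \<and>
    (s < N \<longrightarrow> 0 < X s s \<longrightarrow> I \<noteq> {} \<and> (\<forall>j. 0 < j \<longrightarrow> j < card I \<longrightarrow> v j s = (0 :: real)))"
  using assms
proof (induction "N - s" arbitrary: s X)
  case 0
  then show ?case by (intro exI[of _ "{}"]) (auto simp: not_less columns_independent_def)
next
  case (Suc n)
  then have sN: "s < N" and n: "n = N - Suc s" "Suc s \<le> N" by auto
  have sym: "\<And>a b. a < N \<Longrightarrow> b < N \<Longrightarrow> X a b = X b a" using Suc.prems(1) by (simp add: psd_fun_def)
  show ?case
  proof (cases "X s s = 0")
    case True
    \<comment> \<open>A zero pivot forces its whole row and column to vanish, so the index is
      skipped without adding a vector.\<close>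
    have "X a b = 0" if "a < Suc s" "b < N" for a b
      using that Suc.prems(3)[of a b] psd_fun_diag_zero[OF Suc.prems(1) sN True that(2)] sym[OF sN that(2)]
      by (cases "a = s") auto
    from Suc.hyps(1)[OF n(1) Suc.prems(1) n(2) this]
    obtain I v where IH: "I \<subseteq> {Suc s..<N}" "\<forall>a<N. \<forall>b<N. X a b = (\<Sum>j<card I. v j a * v j b)"
      "\<forall>j<card I. \<forall>a<Suc s. v j a = 0"
      "columns_independent N X I"
      by blast
    show ?thesis
      by (rule exI[of _ I], rule exI[of _ v]) (use IH True in auto)
  next
    case False
    then have pos: "0 < X s s" using psd_fun_diag_nonneg[OF Suc.prems(1) sN] by simp
    define Y where "Y a b = X a b - X s a * X s b / X s s" for a b
    have Y: "psd_fun N Y" unfolding Y_def using psd_fun_schur[OF Suc.prems(1) sN pos] .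
    have Y0: "Y a b = 0" if "a < Suc s" "b < N" for a b
      using that Suc.prems(3)[of a b] Suc.prems(3)[of a s] sym[of s a] sN pos
      by (cases "a = s") (auto simp: Y_def)
    from Suc.hyps(1)[OF n(1) Y n(2) Y0]
    obtain I v where IH: "I \<subseteq> {Suc s..<N}" "\<forall>a<N. \<forall>b<N. Y a b = (\<Sum>j<card I. v j a * v j b)"
      "\<forall>j<card I. \<forall>a<Suc s. v j a = 0"
      "columns_independent N Y I"
      by blast
    have fI: "finite I" "s \<notin> I" using IH(1) finite_subset by auto
    \<comment> \<open>The new vector comes first. All later ones vanish up to index
      \<open>s\<close>, so it alone has a nonzero entry there; with \<open>s = 0\<close> this is the
      shape \<open>(u_0, 0)\<close> of the first row of U.\<close>
    define v' where "v' j = (case j of 0 \<Rightarrow> (\<lambda>a. X s a / sqrt (X s s)) | Suc i \<Rightarrow> v i)" for j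
    have card: "card (insert s I) = Suc (card I)" using fI by simp
    have "X a b = (\<Sum>j<card (insert s I). v' j a * v' j b)" if "a < N" "b < N" for a b
    proof -
      have "X a b = Y a b + X s a / sqrt (X s s) * (X s b / sqrt (X s s))"
        using pos by (simp add: Y_def)
      then show ?thesis unfolding card sum.lessThan_Suc_shift using IH(2) that by (simp add: v'_def)
    qed
    moreover have "v' j a = 0" if "j < card (insert s I)" "a < s" for j a
      using that IH(3) Suc.prems(3)[of a s] sym[of s a] sN unfolding card
      by (cases j) (auto simp: v'_def)
    moreover have "v' j s = 0" if "0 < j" "j < card (insert s I)" for j
      using that IH(3) unfolding card by (cases j) (auto simp: v'_def)
    moreover have "w b = 0"
      if w: "\<forall>b. b \<notin> insert s I \<longrightarrow> w b = 0" "\<forall>a<N. (\<Sum>b<N. X a b * w b) = 0" for w b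
    proof -
      have Yw: "(\<Sum>b<N. Y a b * w b) = 0" if "a < N" for a
      proof -
        have "(\<Sum>b<N. Y a b * w b) = (\<Sum>b<N. X a b * w b) - X s a / X s s * (\<Sum>b<N. X s b * w b)"
          by (simp add: Y_def sum_distrib_left sum_subtractf algebra_simps)
        then show ?thesis using w(2) that sN by simp
      qed
      \<comment> \<open>Column \<open>s\<close> of \<open>Y\<close> is zero, so resetting
        \<open>w s\<close> to 0 keeps \<open>w\<close> in the kernel of \<open>Y\<close> and moves
        its support into \<open>I\<close>. Row \<open>s\<close> of \<open>X\<close> then determines
        \<open>w s\<close>.\<close>
      have Ys: "Y a s = 0" if "a < N" for a using that sym[OF sN that] pos by (simp add: Y_def)
      have "(w(s := 0)) b = 0" for b
      proof (rule IH(4)[unfolded columns_independent_def, rule_format (no_asm)])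
        show "\<forall>b. b \<notin> I \<longrightarrow> (w(s := 0)) b = 0" using w(1) by auto
        show "\<forall>a<N. (\<Sum>b<N. Y a b * (w(s := 0)) b) = 0"
        proof (intro allI impI)
          fix a assume a: "a < N"
          have "(\<Sum>b<N. Y a b * (w(s := 0)) b) = (\<Sum>b<N. Y a b * w b)"
            by (rule sum.cong) (use Ys[OF a] in auto)
          then show "(\<Sum>b<N. Y a b * (w(s := 0)) b) = 0" using Yw[OF a] by simp
        qed
      qed
      then have ws: "w b = 0" if "b \<noteq> s" for b using that by (metis fun_upd_other)
      have "(\<Sum>b<N. X s b * w b) = (\<Sum>b<N. if b = s then X s s * w s else 0)"
        by (rule sum.cong) (use ws in auto)
      then have "w s = 0" using w(2) sN pos by auto
      with ws show ?thesis by (cases "b = s") auto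
    qed
    ultimately show ?thesis
      using IH(1) sN unfolding columns_independent_def by (intro exI[of _ "insert s I"] exI[of _ v']) auto
  qed
qed

lemma independent_columns_le_rank:
  fixes A :: "real mat"
  assumes A: "A \<in> carrier_mat N N" and I: "I \<subseteq> {..<N}"
    and ind: "columns_independent N (\<lambda>a b. A $$ (a, b)) I"
  shows "card I \<le> vec_space.rank N A"
proof -
  interpret vec_space "TYPE(real)" N .
  have fI: "finite I" using I finite_subset by auto
  have restrict: "(\<Sum>b<N. A $$ (a, b) * (if b \<in> I then w b else 0)) = (\<Sum>b\<in>I. A $$ (a, b) * w b)" for a w
    by (rule sum.mono_neutral_cong_right) (use I in auto)
  have indI: "w b = 0" if "\<And>a. a < N \<Longrightarrow> (\<Sum>b\<in>I. A $$ (a, b) * w b) = 0" "b \<in> I" for w b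
    using ind[unfolded columns_independent_def, rule_format, of "\<lambda>b. if b \<in> I then w b else 0" b]
      restrict that by simp
  have colI: "col A b \<in> carrier_vec N" "\<And>a. a < N \<Longrightarrow> col A b $ a = A $$ (a, b)" if "b \<in> I" for b
    using A I that by auto
  \<comment> \<open>Linear independence speaks of the set of columns, so coinciding columns have to
    be excluded first; they would give the relation with coefficients 1 and -1.\<close>
  have inj: "inj_on (col A) I"
  proof (rule inj_onI, rule ccontr)
    fix b c assume bc: "b \<in> I" "c \<in> I" "col A b = col A c" "b \<noteq> c"
    have "(if b = b then 1 else if b = c then - 1 else 0 :: real) = 0"
    proof (rule indI[OF _ bc(1), of "\<lambda>d. if d = b then 1 else if d = c then - 1 else 0"])
      fix a assume a: "a < N"
      have "(\<Sum>d\<in>I. A $$ (a, d) * (if d = b then 1 else if d = c then - 1 else 0))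
          = (\<Sum>d\<in>I. (if d = b then A $$ (a, d) else 0) + (if d = c then - A $$ (a, d) else 0))"
        by (rule sum.cong) (use bc in auto)
      also have "\<dots> = A $$ (a, b) - A $$ (a, c)" using fI bc by (simp add: sum.distrib)
      also have "\<dots> = 0" using colI(2)[OF bc(1) a] colI(2)[OF bc(2) a] bc(3) by simp
      finally show "(\<Sum>d\<in>I. A $$ (a, d) * (if d = b then 1 else if d = c then - 1 else 0)) = 0" .
    qed
    then show False by simp
  qed
  have "\<forall>v\<in>col A ` I. c v = 0" if c: "lincomb c (col A ` I) = 0\<^sub>v N" for c
  proof -
    have "(\<Sum>b\<in>I. A $$ (a, b) * c (col A b)) = 0" if a: "a < N" for a
    proof -
      have "0 = lincomb c (col A ` I) $ a" using c a by simp
      also have "\<dots> = (\<Sum>x\<in>col A ` I. c x * x $ a)"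
        by (rule lincomb_index[OF a]) (use colI in auto)
      also have "\<dots> = (\<Sum>b\<in>I. A $$ (a, b) * c (col A b))"
        unfolding sum.reindex[OF inj] by (rule sum.cong) (use colI(2)[OF _ a] in \<open>auto simp: mult.commute\<close>)
      finally show ?thesis by simp
    qed
    from indI[OF this] show ?thesis by blast
  qed
  then have "lin_indpt (col A ` I)"
    by (intro finite_lin_indpt2) (use fI colI in \<open>auto simp: module_vec_simps\<close>)
  moreover have "col A ` I \<subseteq> set (cols A)" using A I by (auto simp: cols_def)
  ultimately have "card (col A ` I) \<le> rank A" using rank_ge_card_indpt[OF A] by blast
  then show ?thesis by (simp add: card_image[OF inj])
qed

section \<open>Gram matrices: the substitution X = U U^T\<close>

definition gram :: "nat \<Rightarrow> (nat \<Rightarrow> nat \<Rightarrow> real) \<Rightarrow> nat \<Rightarrow> nat \<Rightarrow> real" where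
  "gram r U a b = (\<Sum>j<r. U a j * U b j)"

lemma psd_fun_gram: "psd_fun N (gram r U)"
proof -
  have "bilin N (gram r U) w w = (\<Sum>j<r. (\<Sum>a<N. w a * U a j)\<^sup>2)" for w
  proof -
    have "bilin N (gram r U) w w = (\<Sum>a<N. \<Sum>b<N. \<Sum>j<r. (w a * U a j) * (w b * U b j))"
      by (simp add: bilin_def gram_def sum_distrib_left sum_distrib_right mult_ac)
    also have "\<dots> = (\<Sum>a<N. \<Sum>j<r. \<Sum>b<N. (w a * U a j) * (w b * U b j))"
      by (rule sum.cong[OF refl sum.swap])
    also have "\<dots> = (\<Sum>j<r. \<Sum>a<N. \<Sum>b<N. (w a * U a j) * (w b * U b j))"
      by (rule sum.swap)
    finally show ?thesis by (simp add: power2_eq_square sum_product)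
  qed
  then show ?thesis by (simp add: psd_fun_def sum_nonneg gram_def mult.commute)
qed

text \<open>Each column of U contributes one matrix of rank at most 1, and rank is
  subadditive.\<close>

lemma rank_gram_le: "vec_space.rank N (mat N N (\<lambda>(a, b). gram r U a b)) \<le> r"
proof (induction r)
  case 0
  have "mat N N (\<lambda>(a, b). gram 0 U a b) = 0\<^sub>m N N" by (auto simp: gram_def)
  then show ?case using vec_space.rank_0I by (metis order_refl)
next
  case (Suc r)
  have eq: "mat N N (\<lambda>(a, b). gram (Suc r) U a b)
      = mat N N (\<lambda>(a, b). gram r U a b) + mat N N (\<lambda>(a, b). U a r * U b r)"
    by (auto simp: gram_def)
  have "vec_space.rank N (mat N N (\<lambda>(a, b). U a r * U b r)) \<le> 1"
    by (rule vec_space.rank_le_1_product_entries[of _ _ _ "\<lambda>a. U a r" "\<lambda>b. U b r"]) auto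
  moreover have "vec_space.rank N (mat N N (\<lambda>(a, b). gram (Suc r) U a b))
    \<le> vec_space.rank N (mat N N (\<lambda>(a, b). gram r U a b)) + vec_space.rank N (mat N N (\<lambda>(a, b). U a r * U b r))"
    unfolding eq by (rule vec_space.rank_subadditive) auto
  ultimately show ?case using Suc by linarith
qed

lemma psd_iff_psd_fun: "psd N A \<longleftrightarrow> A \<in> carrier_mat N N \<and> psd_fun N (\<lambda>a b. A $$ (a, b))"
proof (cases "A \<in> carrier_mat N N")
  case A: True
  have q: "v \<bullet> (A *\<^sub>v v) = bilin N (\<lambda>a b. A $$ (a, b)) (\<lambda>a. v $ a) (\<lambda>a. v $ a)" if "v \<in> carrier_vec N" for v
    using A that by (simp add: bilin_def scalar_prod_def sum_distrib_left mult_ac atLeast0LessThan)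
  have "bilin N (\<lambda>a b. A $$ (a, b)) w w = vec N w \<bullet> (A *\<^sub>v vec N w)" for w
    by (simp add: q bilin_def)
  then have "(\<forall>v \<in> carrier_vec N. 0 \<le> v \<bullet> (A *\<^sub>v v)) \<longleftrightarrow> (\<forall>w. 0 \<le> bilin N (\<lambda>a b. A $$ (a, b)) w w)"
    using q by (metis vec_carrier)
  moreover have "transpose_mat A = A \<longleftrightarrow> (\<forall>a<N. \<forall>b<N. A $$ (a, b) = A $$ (b, a))"
    using A by (auto simp: mat_eq_iff)
  ultimately show ?thesis using A by (simp add: psd_def psd_fun_def)
qed (simp add: psd_def)

section \<open>Layers and constraint forms\<close>

definition ix :: "relu_data \<Rightarrow> nat \<Rightarrow> nat \<Rightarrow> nat" where
  "ix P k i = 1 + offset P k + i"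

lemma offset_1 [simp]: "offset P (Suc 0) = 0"
  by (simp add: offset_def)

lemma offset_Suc: "1 \<le> k \<Longrightarrow> offset P (Suc k) = offset P k + width P k"
  by (simp add: offset_def)

lemma offset_mono: "j \<le> k \<Longrightarrow> offset P j \<le> offset P k"
  unfolding offset_def by (rule sum_mono2) auto

lemma ntotal_offset: "ntotal P = offset P (Suc (layers P))"
  by (simp add: ntotal_def offset_def atLeastLessThanSuc_atLeastAtMost)

lemma offset_block_less:
  assumes "1 \<le> k" "i < width P k" "k < k'"
  shows "offset P k + i < offset P k'"
  using offset_mono[of "Suc k" k' P] offset_Suc[OF assms(1), of P] assms by linarith

lemma ix_less: "1 \<le> k \<Longrightarrow> k \<le> layers P \<Longrightarrow> i < width P k \<Longrightarrow> ix P k i < Suc (ntotal P)"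
  using offset_block_less[of k i P "Suc (layers P)"] by (simp add: ix_def ntotal_offset)

lemma ix_neq_0 [simp]: "ix P k i \<noteq> 0" "0 \<noteq> ix P k i" "0 < ix P k i"
  by (auto simp: ix_def)

lemma ix_eq_iff:
  assumes "1 \<le> k" "1 \<le> k'" "i < width P k" "i' < width P k'"
  shows "ix P k i = ix P k' i' \<longleftrightarrow> k = k' \<and> i = i'"
  using offset_block_less[OF assms(1,3), of k'] offset_block_less[OF assms(2,4), of k]
  by (cases k k' rule: linorder_cases) (auto simp: ix_def)

lemma layer_of_ix: "1 \<le> k \<Longrightarrow> i < width P k \<Longrightarrow> layer_of P (ix P k i) = k"
  unfolding layer_of_def
proof (rule Least_equality)
  assume k: "1 \<le> k" "i < width P k"
  then show "ix P k i < 1 + offset P (k + 1)" by (simp add: ix_def offset_Suc)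
  fix m assume "ix P k i < 1 + offset P (m + 1)"
  then have "\<not> offset P (Suc m) \<le> offset P k" by (simp add: ix_def)
  then show "k \<le> m" using offset_mono[of "Suc m" k P] by linarith
qed

lemma coord_of_ix: "1 \<le> k \<Longrightarrow> i < width P k \<Longrightarrow> coord_of P (ix P k i) = i"
  by (simp add: coord_of_def layer_of_ix) (simp add: ix_def)

lemma sum_lessThan_add: "(\<Sum>a<m + n. F a) = (\<Sum>a<m. F a) + (\<Sum>i<n. F (m + i))"
  for F :: "nat \<Rightarrow> 'a :: comm_monoid_add"
  by (induction n) (simp_all add: add.assoc)

lemma sum_ix:
  fixes F :: "nat \<Rightarrow> real"
  shows "(\<Sum>a<Suc (ntotal P). F a) = F 0 + (\<Sum>k\<in>{1..layers P}. \<Sum>i<width P k. F (ix P k i))"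
proof -
  have "(\<Sum>a<Suc (offset P (Suc L)). F a) = F 0 + (\<Sum>k\<in>{1..L}. \<Sum>i<width P k. F (ix P k i))" for L
  proof (induction L)
    case (Suc L)
    have "Suc (offset P (Suc (Suc L))) = Suc (offset P (Suc L)) + width P (Suc L)"
      by (simp add: offset_Suc)
    then show ?case using Suc by (simp only: sum_lessThan_add) (simp add: ix_def)
  qed simp
  then show ?thesis by (simp only: ntotal_offset)
qed

lemma ix_cases:
  assumes "a < Suc (ntotal P)" "a \<noteq> 0"
  obtains k i where "1 \<le> k" "k \<le> layers P" "i < width P k" "a = ix P k i"
proof -
  \<comment> \<open>Surjectivity by counting: the indicator of \<open>a\<close> has sum 1, and
    \<open>sum_ix\<close> distributes this sum over the blocks, so some block index must equal
    \<open>a\<close>.\<close>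
  have "(\<Sum>b<Suc (ntotal P). if b = a then 1 else 0 :: real) = 1" using assms by simp
  then have "(\<Sum>k\<in>{1..layers P}. \<Sum>i<width P k. if ix P k i = a then 1 else 0 :: real) \<noteq> 0"
    unfolding sum_ix using assms by simp
  then obtain k i where "k \<in> {1..layers P}" "i < width P k" "ix P k i = a"
    by (auto elim!: sum.not_neutral_contains_not_neutral split: if_splits)
  then show ?thesis using that by auto
qed

section \<open>Labels of the constraints and their linear forms\<close>

datatype constraint = Corner | Unit1 nat nat | Unit2 nat nat

text \<open>For inequalities, \<open>Corner\<close> is the ball constraint and \<open>Unit1\<close>, \<open>Unit2\<close> are the two ReLU
  inequalities of a neuron; for equalities, \<open>Corner\<close> is the normalisation \<open>x\<^sub>0 = 1\<close> and \<open>Unit1\<close> the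
  ReLU complementarity. The order of the lists is the one of \<open>stack2\<close> and \<open>stack1\<close>.\<close>

definition ineqs :: "relu_data \<Rightarrow> constraint list" where
  "ineqs P = Corner # concat (map (\<lambda>k. map (Unit1 k) [0..<width P (k + 1)]
     @ map (Unit2 k) [0..<width P (k + 1)]) [1..<layers P])"

definition eqs :: "relu_data \<Rightarrow> constraint list" where
  "eqs P = Corner # concat (map (\<lambda>k. map (Unit1 k) [0..<width P (k + 1)]) [1..<layers P])"

lemma set_ineqs: "l \<in> set (ineqs P) \<longleftrightarrow> (case l of Corner \<Rightarrow> True
    | Unit1 k i \<Rightarrow> k \<in> {1..<layers P} \<and> i < width P (k + 1)
    | Unit2 k i \<Rightarrow> k \<in> {1..<layers P} \<and> i < width P (k + 1))"
  by (auto simp: ineqs_def image_iff split: constraint.split)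

lemma set_eqs: "l \<in> set (eqs P) \<longleftrightarrow> (case l of Corner \<Rightarrow> True
    | Unit1 k i \<Rightarrow> k \<in> {1..<layers P} \<and> i < width P (k + 1) | Unit2 k i \<Rightarrow> False)"
  by (auto simp: eqs_def image_iff split: constraint.split)

lemma distinct_concat_map:
  assumes "distinct xs" "\<And>x. distinct (f x)" "\<And>x y. x \<noteq> y \<Longrightarrow> set (f x) \<inter> set (f y) = {}"
  shows "distinct (concat (map f xs))"
  using assms(1)
proof (induction xs)
  case (Cons x xs)
  then have "set (f x) \<inter> set (f y) = {}" if "y \<in> set xs" for y
    using assms(3)[of x y] that by auto
  then show ?case using Cons assms(2) by auto
qed simp

lemma sum_list_concat_map: "sum_list (map F (concat xss)) = (\<Sum>xs\<leftarrow>xss. \<Sum>x\<leftarrow>xs. F x)"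
  by (induction xss) auto

lemma distinct_ineqs: "distinct (ineqs P)"
  unfolding ineqs_def distinct.simps
  by (intro conjI distinct_concat_map) (auto simp: distinct_map inj_on_def)

lemma distinct_eqs: "distinct (eqs P)"
  unfolding eqs_def distinct.simps
  by (intro conjI distinct_concat_map) (auto simp: distinct_map inj_on_def)

lemma sum_ineqs:
  fixes F :: "constraint \<Rightarrow> real"
  shows "(\<Sum>l\<in>set (ineqs P). F l) = F Corner + (\<Sum>k\<in>{1..<layers P}. \<Sum>i<width P (k + 1). F (Unit1 k i) + F (Unit2 k i))"
  unfolding sum.distinct_set_conv_list[OF distinct_ineqs]
  by (simp add: ineqs_def sum_list_concat_map o_def interv_sum_list_conv_sum_set_nat
      sum.distrib atLeast0LessThan)

lemma sum_eqs:
  fixes F :: "constraint \<Rightarrow> real"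
  shows "(\<Sum>l\<in>set (eqs P). F l) = F Corner + (\<Sum>k\<in>{1..<layers P}. \<Sum>i<width P (k + 1). F (Unit1 k i))"
  unfolding sum.distinct_set_conv_list[OF distinct_eqs]
  by (simp add: eqs_def sum_list_concat_map o_def interv_sum_list_conv_sum_set_nat
      sum.distrib atLeast0LessThan)

definition obj_form :: "relu_data \<Rightarrow> (nat \<Rightarrow> nat \<Rightarrow> real) \<Rightarrow> real" where
  "obj_form P X = (\<Sum>i<width P (layers P). wlast P $ i * X (ix P (layers P) i) 0)"

fun ineq_form :: "relu_data \<Rightarrow> constraint \<Rightarrow> (nat \<Rightarrow> nat \<Rightarrow> real) \<Rightarrow> real" where
  "ineq_form P Corner X = (\<Sum>i<width P 1. X (ix P 1 i) (ix P 1 i))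
     - 2 * (\<Sum>i<width P 1. center P $ i * X (ix P 1 i) 0)
     + ((vnorm (center P))\<^sup>2 - (radius P)\<^sup>2) * X 0 0"
| "ineq_form P (Unit1 k i) X = - X (ix P (k + 1) i) 0"
| "ineq_form P (Unit2 k i) X = (\<Sum>j<width P k. weight P k $$ (i, j) * X (ix P k j) 0)
     + bias P k $ i * X 0 0 - X (ix P (k + 1) i) 0"

text \<open>Linear parts only; the constants are in \<open>eq_const\<close>.\<close>

fun eq_form :: "relu_data \<Rightarrow> constraint \<Rightarrow> (nat \<Rightarrow> nat \<Rightarrow> real) \<Rightarrow> real" where
  "eq_form P Corner X = - X 0 0"
| "eq_form P (Unit1 k i) X = X (ix P (k + 1) i) (ix P (k + 1) i)
     - (\<Sum>j<width P k. weight P k $$ (i, j) * X (ix P k j) (ix P (k + 1) i))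
     - bias P k $ i * X (ix P (k + 1) i) 0"
| "eq_form P (Unit2 k i) X = 0"

definition eq_const :: "constraint \<Rightarrow> real" where
  "eq_const l = (if l = Corner then 1 else 0)"

text \<open>The coefficient \<open>c\<close> of the objective is kept variable: \<open>c = 1\<close>
  gives the usual Lagrangian, \<open>c = 0\<close> the abnormal one. Omitting the constants makes
  the form linear in \<open>X\<close>; they contribute just \<open>z Corner\<close>, by
  \<open>sum_eq_const\<close>.\<close>

definition lagrangian_form ::
  "relu_data \<Rightarrow> real \<Rightarrow> (constraint \<Rightarrow> real) \<Rightarrow> (constraint \<Rightarrow> real) \<Rightarrow> (nat \<Rightarrow> nat \<Rightarrow> real) \<Rightarrow> real" where
  "lagrangian_form P c y z X = c * obj_form P X + (\<Sum>l\<in>set (ineqs P). y l * ineq_form P l X)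
     + (\<Sum>l\<in>set (eqs P). z l * eq_form P l X)"

text \<open>The last conjunct restricts the dependence to the leading N by N entries. It lets a
  matrix be replaced by any function that agrees with it inside its dimensions.\<close>

definition lin_form :: "nat \<Rightarrow> ((nat \<Rightarrow> nat \<Rightarrow> real) \<Rightarrow> real) \<Rightarrow> bool" where
  "lin_form N F \<longleftrightarrow> (\<forall>X Y. F (\<lambda>a b. X a b + Y a b) = F X + F Y) \<and>
     (\<forall>c X. F (\<lambda>a b. c * X a b) = c * F X) \<and>
     (\<forall>X Y. (\<forall>a<N. \<forall>b<N. X a b = Y a b) \<longrightarrow> F X = F Y)"

named_theorems lin_form_intros

lemma lin_form_entry [lin_form_intros]: "a < N \<Longrightarrow> b < N \<Longrightarrow> lin_form N (\<lambda>X. X a b)"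
  by (simp add: lin_form_def)

lemma lin_form_zero [lin_form_intros]: "lin_form N (\<lambda>X. 0)"
  by (simp add: lin_form_def)

lemma lin_form_add [lin_form_intros]:
  "lin_form N F \<Longrightarrow> lin_form N G \<Longrightarrow> lin_form N (\<lambda>X. F X + G X)"
  unfolding lin_form_def by (simp add: algebra_simps) metis

lemma lin_form_scale [lin_form_intros]: "lin_form N F \<Longrightarrow> lin_form N (\<lambda>X. c * F X)"
  unfolding lin_form_def by (simp add: algebra_simps)

lemma lin_form_uminus [lin_form_intros]: "lin_form N F \<Longrightarrow> lin_form N (\<lambda>X. - F X)"
  using lin_form_scale[of N F "- 1"] by simp

lemma lin_form_diff [lin_form_intros]:
  "lin_form N F \<Longrightarrow> lin_form N G \<Longrightarrow> lin_form N (\<lambda>X. F X - G X)"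
  using lin_form_add[OF _ lin_form_uminus] by simp

lemma lin_form_sum [lin_form_intros]:
  "(\<And>q. q \<in> Q \<Longrightarrow> lin_form N (F q)) \<Longrightarrow> lin_form N (\<lambda>X. \<Sum>q\<in>Q. F q X)"
  by (induction Q rule: infinite_finite_induct) (auto intro: lin_form_zero lin_form_add)

lemma lin_form_D:
  assumes "lin_form N F"
  shows "F (\<lambda>a b. X a b + Y a b) = F X + F Y" "F (\<lambda>a b. c * X a b) = c * F X"
    "(\<And>a b. a < N \<Longrightarrow> b < N \<Longrightarrow> X a b = Y a b) \<Longrightarrow> F X = F Y"
  using assms unfolding lin_form_def by blast+

lemma lin_form_sum_arg:
  assumes "lin_form N F" "finite Q"
  shows "F (\<lambda>a b. \<Sum>q\<in>Q. X q a b) = (\<Sum>q\<in>Q. F (X q))"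
  using assms(2)
proof (induction Q)
  case empty
  show ?case using lin_form_D(2)[OF assms(1), of 0 "\<lambda>_ _. 0"] by simp
next
  case (insert q Q)
  then show ?case using lin_form_D(1)[OF assms(1)] by simp
qed

lemma lin_form_obj: "wf_data P \<Longrightarrow> lin_form (Suc (ntotal P)) (obj_form P)"
  unfolding obj_form_def [abs_def] by (intro lin_form_intros) (auto intro: ix_less simp: wf_data_def)

lemma lin_form_ineq:
  assumes "wf_data P" "l \<in> set (ineqs P)"
  shows "lin_form (Suc (ntotal P)) (ineq_form P l)"
proof (cases l)
  case Corner
  then have "ineq_form P l = (\<lambda>X. ineq_form P Corner X)" by (intro ext) (simp only:)
  then show ?thesis unfolding ineq_form.simps
    using assms(1) by (auto intro!: lin_form_intros ix_less simp: wf_data_def)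
next
  case (Unit1 k i)
  then have "ineq_form P l = (\<lambda>X. ineq_form P (Unit1 k i) X)" by (intro ext) (simp only:)
  then show ?thesis unfolding ineq_form.simps
    using assms Unit1 by (auto intro!: lin_form_intros ix_less simp: set_ineqs)
next
  case (Unit2 k i)
  then have "ineq_form P l = (\<lambda>X. ineq_form P (Unit2 k i) X)" by (intro ext) (simp only:)
  then show ?thesis unfolding ineq_form.simps
    using assms Unit2 by (auto intro!: lin_form_intros ix_less simp: set_ineqs)
qed

lemma lin_form_eq:
  assumes "l \<in> set (eqs P)"
  shows "lin_form (Suc (ntotal P)) (eq_form P l)"
proof (cases l)
  case Corner
  then have "eq_form P l = (\<lambda>X. eq_form P Corner X)" by (intro ext) (simp only:)
  then show ?thesis unfolding eq_form.simps by (auto intro!: lin_form_intros)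
next
  case (Unit1 k i)
  then have "eq_form P l = (\<lambda>X. eq_form P (Unit1 k i) X)" by (intro ext) (simp only:)
  then show ?thesis unfolding eq_form.simps
    using assms Unit1 by (auto intro!: lin_form_intros ix_less simp: set_eqs)
next
  case (Unit2 k i)
  then show ?thesis using assms by (simp add: set_eqs)
qed

lemma lin_form_lagrangian: "wf_data P \<Longrightarrow> lin_form (Suc (ntotal P)) (lagrangian_form P c y z)"
  unfolding lagrangian_form_def [abs_def]
  by (intro lin_form_intros lin_form_obj lin_form_ineq lin_form_eq)

text \<open>Tangent directions of \<open>U \<mapsto> U U\<^sup>T\<close>.\<close>

definition edge :: "(nat \<Rightarrow> real) \<Rightarrow> nat \<Rightarrow> nat \<Rightarrow> nat \<Rightarrow> real" where
  "edge v s a b = (if a = s then v b else 0) + (if b = s then v a else 0)"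

lemma gram_perturb:
  assumes "a < N" "b < N"
  shows "gram r (\<lambda>a j. U a j + t * E a j) a b
    = gram r U a b + t * (\<Sum>s<N. \<Sum>j<r. E s j * edge (\<lambda>a. U a j) s a b) + t\<^sup>2 * gram r E a b"
proof -
  have "(\<Sum>s<N. \<Sum>j<r. E s j * edge (\<lambda>a. U a j) s a b) = (\<Sum>j<r. \<Sum>s<N. E s j * edge (\<lambda>a. U a j) s a b)"
    by (rule sum.swap)
  also have "\<dots> = (\<Sum>j<r. E a j * U b j + E b j * U a j)"
    using assms by (simp add: edge_def distrib_left sum.distrib mult_delta_right)
  finally show ?thesis
    by (simp add: gram_def sum.distrib sum_distrib_left power2_eq_square algebra_simps)
qed

text \<open>U U^T is quadratic in U, so the expansion is exact. Its linear coefficient is the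
  gradient of the factored function, and its last term is what bounds a nonnegative form near one of
  its zeros.\<close>

lemma lin_form_gram_perturb:
  assumes "lin_form N F"
  shows "F (gram r (\<lambda>a j. U a j + t * E a j))
    = F (gram r U) + t * (\<Sum>s<N. \<Sum>j<r. E s j * F (edge (\<lambda>a. U a j) s)) + t\<^sup>2 * F (gram r E)"
proof -
  have "F (gram r (\<lambda>a j. U a j + t * E a j))
    = F (\<lambda>a b. (gram r U a b + t * (\<Sum>s<N. \<Sum>j<r. E s j * edge (\<lambda>a. U a j) s a b)) + t\<^sup>2 * gram r E a b)"
    by (rule lin_form_D(3)[OF assms]) (rule gram_perturb)
  then show ?thesis
    by (simp add: lin_form_D(1,2)[OF assms] lin_form_sum_arg[OF assms])
qed

text \<open>If \<open>z \<noteq> 0\<close>, stationarity gives \<open>q = p / 2\<close>, so complementarity forces \<open>c (c - a) > 0\<close>; both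
  inequalities are then inactive and stationarity gives \<open>c = a / 2\<close>, a contradiction.\<close>

lemma relu_unit_multipliers_zero:
  fixes p q :: "nat \<Rightarrow> real" and a c u y1 y2 z :: real
  assumes fin: "finite J" and u: "u \<noteq> 0" and a: "a \<noteq> 0"
    and p: "\<exists>j\<in>J. p j \<noteq> 0"
    and compl: "c * (c - a) + (\<Sum>j\<in>J. (q j - p j) * q j) = 0"
    and y: "y1 \<noteq> 0 \<longrightarrow> c = 0" "y2 \<noteq> 0 \<longrightarrow> c = a"
    and statV: "\<And>j. j \<in> J \<Longrightarrow> z * (2 * q j - p j) = 0"
    and statu: "z * (2 * c - a) - (y1 + y2) * u = 0"
  shows "y1 = 0 \<and> y2 = 0 \<and> z = 0"
proof (cases "z = 0")
  case True
  \<comment> \<open>Without signs, \<open>y1 = - y2 \<noteq> 0\<close> is still conceivable; it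
    would make both inequalities active, forcing \<open>c = 0\<close> and \<open>c = a\<close>,
    against \<open>a \<noteq> 0\<close>.\<close>
  then have "y1 + y2 = 0" using statu u by simp
  then show ?thesis using y a True by (cases "y1 = 0") auto
next
  case False
  then have "(q j - p j) * q j = - (p j)\<^sup>2 / 4" if "j \<in> J" for j
  proof -
    have "p j = 2 * q j" using statV[OF that] False by simp
    then show ?thesis by (simp add: power2_eq_square)
  qed
  then have "(\<Sum>j\<in>J. (q j - p j) * q j) = - (\<Sum>j\<in>J. (p j)\<^sup>2) / 4"
    by (simp add: sum_negf sum_divide_distrib)
  moreover have "0 < (\<Sum>j\<in>J. (p j)\<^sup>2)"
    using p fin by (meson sum_pos2 zero_le_power2 zero_less_power2)
  ultimately have pos: "0 < c * (c - a)" using compl by linarith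
  then have "y1 = 0" "y2 = 0" using y by auto
  then have "a = 2 * c" using statu False by simp
  then have "c * (c - a) = - c\<^sup>2" by (simp add: power2_eq_square)
  then show ?thesis using pos by simp
qed

text \<open>The multipliers are peeled off from
  the last layer to the first, since the rows of layer \<open>k + 1\<close> only involve layers \<open>k\<close>, \<open>k + 1\<close>
  and \<open>k + 2\<close>.\<close>

lemma multipliers_zero:
  assumes wf: "wf_data P" and r: "1 \<le> r"
    and U0: "U 0 0 \<noteq> 0" "\<And>j. 0 < j \<Longrightarrow> j < r \<Longrightarrow> U 0 j = 0"
    and compl: "\<And>k i. k \<in> {1..<layers P} \<Longrightarrow> i < width P (k + 1) \<Longrightarrow> eq_form P (Unit1 k i) (gram r U) = 0"
    and nzu: "\<And>k i. k \<in> {1..<layers P} \<Longrightarrow> i < width P (k + 1) \<Longrightarrow>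
      (\<Sum>j<width P k. weight P k $$ (i, j) * U (ix P k j) 0) + bias P k $ i * U 0 0 \<noteq> 0"
    and nzV: "\<And>k i. k \<in> {1..<layers P} \<Longrightarrow> i < width P (k + 1) \<Longrightarrow>
      \<exists>j\<in>{1..<r}. (\<Sum>m<width P k. weight P k $$ (i, m) * U (ix P k m) j) \<noteq> 0"
    and slackness: "\<And>l. l \<in> set (ineqs P) \<Longrightarrow> y l \<noteq> 0 \<Longrightarrow> ineq_form P l (gram r U) = 0"
    and stat: "\<And>a j. a < Suc (ntotal P) \<Longrightarrow> j < r \<Longrightarrow> (a = 0 \<Longrightarrow> j = 0) \<Longrightarrow>
      lagrangian_form P 0 y z (edge (\<lambda>a. U a j) a) = 0"
  shows "(\<forall>l\<in>set (ineqs P). y l = 0) \<and> (\<forall>l\<in>set (eqs P). z l = 0)"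
proof -
  let ?J = "{1..<r}"
  have split: "(\<Sum>j<r. f j) = f 0 + (\<Sum>j\<in>?J. f j)" for f :: "nat \<Rightarrow> real"
    using r sum.atLeast_Suc_lessThan[of 0 r f] by (simp add: atLeast0LessThan)
  have col0: "gram r U a 0 = U a 0 * U 0 0" for a
    unfolding gram_def split using U0(2) by simp
  have units: "y (Unit1 k i) = 0 \<and> y (Unit2 k i) = 0 \<and> z (Unit1 k i) = 0"
    if "k \<in> {1..<layers P}" "i < width P (k + 1)" for k i
    using that
  proof (induction "layers P - k" arbitrary: k i rule: less_induct)
    case less
    note ki = less.prems
    have IH: "y (Unit1 k' i') = 0 \<and> y (Unit2 k' i') = 0 \<and> z (Unit1 k' i') = 0"
      if "k < k'" "k' \<in> {1..<layers P}" "i' < width P (k' + 1)" for k' i'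
      using less.hyps[of k' i'] that ki by auto
    define s where "s = ix P (k + 1) i"
    have sN: "s < Suc (ntotal P)" and s0: "s \<noteq> 0" using ki by (auto simp: s_def intro!: ix_less)
    have s_iff: "ix P k' i' = s \<longleftrightarrow> k' = k + 1 \<and> i' = i" if "1 \<le> k'" "i' < width P k'" for k' i'
      unfolding s_def using that ki by (intro ix_eq_iff) auto
    \<comment> \<open>Row \<open>s\<close> occurs in the two inequalities of its own neuron and, as
      an input, in those of the next layer. The latter have zero multipliers by induction, and the
      ball constraint only sees layer 1.\<close>
    have ineqs: "(\<Sum>l\<in>set (ineqs P). y l * ineq_form P l (edge v s)) = - (y (Unit1 k i) + y (Unit2 k i)) * v 0" for v
    proof -
      have "(\<Sum>l\<in>set (ineqs P). y l * ineq_form P l (edge v s))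
          = (\<Sum>l\<in>{Unit1 k i, Unit2 k i}. y l * ineq_form P l (edge v s))"
      proof (rule sum.mono_neutral_right)
        show "{Unit1 k i, Unit2 k i} \<subseteq> set (ineqs P)" using ki by (auto simp: set_ineqs)
        show "\<forall>l\<in>set (ineqs P) - {Unit1 k i, Unit2 k i}. y l * ineq_form P l (edge v s) = 0"
        proof
          fix l assume l: "l \<in> set (ineqs P) - {Unit1 k i, Unit2 k i}"
          show "y l * ineq_form P l (edge v s) = 0"
          proof (cases l)
            case Corner
            then show ?thesis using ki s0 by (auto simp: edge_def s_iff intro!: sum.neutral)
          next
            case (Unit1 k' i')
            then show ?thesis using l s0 s_iff[of "k' + 1" i'] by (auto simp: edge_def set_ineqs)
          next
            case (Unit2 k' i')
            then have *: "k' \<in> {1..<layers P}" "i' < width P (k' + 1)" "\<not> (k' = k \<and> i' = i)"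
              using l by (auto simp: set_ineqs)
            show ?thesis
            proof (cases "k < k'")
              case True
              then show ?thesis using IH * Unit2 by simp
            next
              case False
              then show ?thesis using * Unit2 s0 s_iff[of "k' + 1" i']
                by (auto simp: edge_def s_iff intro!: sum.neutral)
            qed
          qed
        qed
      qed simp
      also have "\<dots> = - (y (Unit1 k i) + y (Unit2 k i)) * v 0"
      proof -
        have "(\<Sum>j<width P k. weight P k $$ (i, j) * edge v s (ix P k j) 0) = 0"
          using ki s0 by (intro sum.neutral) (auto simp: edge_def s_iff)
        then show ?thesis using s0 s_def by (simp add: edge_def algebra_simps)
      qed
      finally show ?thesis .
    qed
    have eqs: "(\<Sum>l\<in>set (eqs P). z l * eq_form P l (edge v s))
      = z (Unit1 k i) * (2 * v s - (\<Sum>j<width P k. weight P k $$ (i, j) * v (ix P k j)) - bias P k $ i * v 0)" for v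
    proof -
      have "(\<Sum>l\<in>set (eqs P). z l * eq_form P l (edge v s)) = (\<Sum>l\<in>{Unit1 k i}. z l * eq_form P l (edge v s))"
      proof (rule sum.mono_neutral_right)
        show "{Unit1 k i} \<subseteq> set (eqs P)" using ki by (auto simp: set_eqs)
        show "\<forall>l\<in>set (eqs P) - {Unit1 k i}. z l * eq_form P l (edge v s) = 0"
        proof
          fix l assume l: "l \<in> set (eqs P) - {Unit1 k i}"
          show "z l * eq_form P l (edge v s) = 0"
          proof (cases l)
            case Corner
            then show ?thesis using s0 by (simp add: edge_def)
          next
            case (Unit1 k' i')
            then have *: "k' \<in> {1..<layers P}" "i' < width P (k' + 1)" "\<not> (k' = k \<and> i' = i)"
              using l by (auto simp: set_eqs)
            show ?thesis
            proof (cases "k < k'")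
              case True
              then show ?thesis using IH * Unit1 by simp
            next
              case False
              then show ?thesis using * Unit1 s0 s_iff[of "k' + 1" i']
                by (auto simp: edge_def s_iff intro!: sum.neutral)
            qed
          next
            case (Unit2 k' i')
            then show ?thesis by simp
          qed
        qed
      qed simp
      also have "\<dots> = z (Unit1 k i) * (2 * v s - (\<Sum>j<width P k. weight P k $$ (i, j) * v (ix P k j)) - bias P k $ i * v 0)"
      proof -
        have "(\<Sum>j<width P k. weight P k $$ (i, j) * edge v s (ix P k j) s)
            = (\<Sum>j<width P k. weight P k $$ (i, j) * v (ix P k j))"
          using ki s0 by (intro sum.cong) (auto simp: edge_def s_iff)
        then show ?thesis using s0 s_def by (simp add: edge_def)
      qed
      finally show ?thesis .
    qed
    \<comment> \<open>\<open>p\<close> is the neuron's row of the weight matrix applied to the rows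
      of U in layer \<open>k\<close>, \<open>q\<close> is the row of U belonging to the neuron
      itself, and \<open>a\<close> is its preactivation.\<close>
    define p where "p j = (\<Sum>m<width P k. weight P k $$ (i, m) * U (ix P k m) j)" for j
    define q where "q j = U s j" for j
    define a where "a = p 0 + bias P k $ i * U 0 0"
    \<comment> \<open>Stationarity in entry \<open>(s, j)\<close> of U. For \<open>j > 0\<close> the
      factor \<open>U 0 j\<close> is zero, so bias and inequalities disappear and only the
      complementarity multiplier is left.\<close>
    have row: "z (Unit1 k i) * (2 * q j - p j - bias P k $ i * U 0 j)
        - (y (Unit1 k i) + y (Unit2 k i)) * U 0 j = 0" if "j < r" for j
      using stat[OF sN that] s0 unfolding lagrangian_form_def ineqs eqs p_def q_def
      by (simp add: algebra_simps)
    have gp: "(\<Sum>m<width P k. weight P k $$ (i, m) * gram r U (ix P k m) b) = (\<Sum>j<r. p j * U b j)" for b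
    proof -
      have "(\<Sum>m<width P k. weight P k $$ (i, m) * gram r U (ix P k m) b)
          = (\<Sum>m<width P k. \<Sum>j<r. weight P k $$ (i, m) * U (ix P k m) j * U b j)"
        by (simp add: gram_def sum_distrib_left mult.assoc)
      also have "\<dots> = (\<Sum>j<r. \<Sum>m<width P k. weight P k $$ (i, m) * U (ix P k m) j * U b j)"
        by (rule sum.swap)
      finally show ?thesis by (simp add: p_def sum_distrib_right)
    qed
    show ?case
    proof (rule relu_unit_multipliers_zero)
      show "finite ?J" by simp
      show "U 0 0 \<noteq> 0" by (rule U0)
      show "a \<noteq> 0" using nzu[OF ki] by (simp add: a_def p_def)
      show "\<exists>j\<in>?J. p j \<noteq> 0" using nzV[OF ki] by (simp add: p_def)
      show "q 0 * (q 0 - a) + (\<Sum>j\<in>?J. (q j - p j) * q j) = 0"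
      proof -
        have "0 = gram r U s s - (\<Sum>j<r. p j * q j) - bias P k $ i * (q 0 * U 0 0)"
          using compl[OF ki] gp[of s] unfolding eq_form.simps s_def[symmetric]
          by (simp add: col0 q_def)
        also have "\<dots> = (\<Sum>j<r. (q j - p j) * q j) - bias P k $ i * (q 0 * U 0 0)"
          by (simp add: gram_def q_def sum_subtractf algebra_simps)
        finally show ?thesis unfolding split by (simp add: a_def algebra_simps)
      qed
      show "y (Unit1 k i) \<noteq> 0 \<longrightarrow> q 0 = 0"
      proof
        assume "y (Unit1 k i) \<noteq> 0"
        then have "ineq_form P (Unit1 k i) (gram r U) = 0" using ki by (intro slackness) (auto simp: set_ineqs)
        then show "q 0 = 0" using U0(1) by (simp add: col0 q_def s_def)
      qed
      show "y (Unit2 k i) \<noteq> 0 \<longrightarrow> q 0 = a"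
      proof
        assume "y (Unit2 k i) \<noteq> 0"
        then have "ineq_form P (Unit2 k i) (gram r U) = 0" using ki by (intro slackness) (auto simp: set_ineqs)
        moreover have "(\<Sum>j<r. p j * U 0 j) = p 0 * U 0 0" unfolding split using U0(2) by simp
        ultimately have "(a - q 0) * U 0 0 = 0"
          using gp[of 0] by (simp add: col0 q_def s_def a_def algebra_simps)
        then show "q 0 = a" using U0(1) by simp
      qed
      show "z (Unit1 k i) * (2 * q j - p j) = 0" if "j \<in> ?J" for j
        using row[of j] U0(2)[of j] that by simp
      show "z (Unit1 k i) * (2 * q 0 - a) - (y (Unit1 k i) + y (Unit2 k i)) * U 0 0 = 0"
        using row[of 0] r by (simp add: a_def algebra_simps)
    qed
  qed
  have L2: "2 \<le> layers P" and w: "1 \<le> width P 1" "1 \<le> width P 2" using wf by (auto simp: wf_data_def)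
  have only_corner: "lagrangian_form P 0 y z X = y Corner * ineq_form P Corner X + z Corner * eq_form P Corner X" for X
    unfolding lagrangian_form_def sum_ineqs sum_eqs using units by simp
  \<comment> \<open>Only the ball and the normalisation remain. In the entries of \<open>V_1\<close>
    the derivative of the ball is \<open>2 * V_1\<close>, so a nonzero multiplier would give
    \<open>V_1 = 0\<close>, contradicting that the rows of \<open>W_1 V_1\<close> are
    nonzero.\<close>
  have "y Corner = 0"
  proof (rule ccontr)
    assume y: "y Corner \<noteq> 0"
    have "U (ix P 1 m) j = 0" if m: "m < width P 1" and j: "j \<in> ?J" for m j
    proof -
      define s where "s = ix P 1 m"
      have s: "s < Suc (ntotal P)" "s \<noteq> 0" using m L2 by (auto simp: s_def intro!: ix_less)
      have s_iff: "ix P 1 i = s \<longleftrightarrow> i = m" if "i < width P 1" for i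
        unfolding s_def using ix_eq_iff[of 1 1 i P m] that m by auto
      have "U 0 j = 0" using U0(2) j by simp
      have "(\<Sum>i<width P 1. edge (\<lambda>a. U a j) s (ix P 1 i) (ix P 1 i)) = (\<Sum>i<width P 1. if i = m then 2 * U s j else 0)"
        by (rule sum.cong) (auto simp: edge_def s_def ix_def)
      also have "\<dots> = 2 * U s j" using m by simp
      finally have 1: "(\<Sum>i<width P 1. edge (\<lambda>a. U a j) s (ix P 1 i) (ix P 1 i)) = 2 * U s j" .
      have 2: "(\<Sum>i<width P 1. center P $ i * edge (\<lambda>a. U a j) s (ix P 1 i) 0) = 0"
        using s \<open>U 0 j = 0\<close> by (intro sum.neutral) (auto simp: edge_def)
      have "edge (\<lambda>a. U a j) s 0 0 = 0" using s by (simp add: edge_def)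
      then have "y Corner * (2 * U s j) = 0"
        using stat[OF s(1), of j] j s(2) 1 2 unfolding only_corner by simp
      then show ?thesis using y by (simp add: s_def)
    qed
    then show False using nzV[of 1 0] L2 w by (auto simp: numeral_2_eq_2)
  qed
  \<comment> \<open>Stationarity in \<open>u_0\<close> now reads
    \<open>- 2 * z Corner * u_0 = 0\<close>.\<close>
  moreover have "z Corner = 0"
    using stat[of 0 0] r U0(1) \<open>y Corner = 0\<close> unfolding only_corner by (simp add: edge_def)
  ultimately show ?thesis using units by (auto simp: set_ineqs set_eqs split: constraint.splits)
qed

section \<open>Flat vectors\<close>

definition tabulate :: "'l list \<Rightarrow> ('l \<Rightarrow> real) \<Rightarrow> real vec" where
  "tabulate ls f = Matrix.vec (length ls) (\<lambda>j. f (ls ! j))"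

lemma dim_tabulate [simp]: "dim_vec (tabulate ls f) = length ls"
  by (simp add: tabulate_def)

lemma tabulate_index [simp]: "j < length ls \<Longrightarrow> tabulate ls f $ j = f (ls ! j)"
  by (simp add: tabulate_def)

lemma tabulate_cong: "(\<And>l. l \<in> set ls \<Longrightarrow> f l = g l) \<Longrightarrow> tabulate ls f = tabulate ls g"
  by (auto simp: tabulate_def)

lemma tabulate_eq_vec_of_list: "vec_of_list (map f ls) = tabulate ls f"
  by (rule eq_vecI) (simp_all add: index_vec_of_list del: vec_of_list_map)

lemma tabulate_le_0_iff: "tabulate ls f \<le> 0\<^sub>v (length ls) \<longleftrightarrow> (\<forall>l\<in>set ls. f l \<le> 0)"
  by (auto simp: less_eq_vec_def all_set_conv_all_nth)

lemma tabulate_ge_0_iff: "0\<^sub>v (length ls) \<le> tabulate ls f \<longleftrightarrow> (\<forall>l\<in>set ls. 0 \<le> f l)"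
  by (auto simp: less_eq_vec_def all_set_conv_all_nth)

lemma tabulate_eq_0_iff: "tabulate ls f = 0\<^sub>v (length ls) \<longleftrightarrow> (\<forall>l\<in>set ls. f l = 0)"
  by (auto simp: vec_eq_iff all_set_conv_all_nth)

lemma hadamard_tabulate: "hadamard (tabulate ls f) (tabulate ls g) = tabulate ls (\<lambda>l. f l * g l)"
  by (auto simp: hadamard_def)

fun unstack :: "real \<Rightarrow> (nat \<Rightarrow> real vec) \<Rightarrow> (nat \<Rightarrow> real vec) \<Rightarrow> constraint \<Rightarrow> real" where
  "unstack a A B Corner = a"
| "unstack a A B (Unit1 k i) = A k $ i"
| "unstack a A B (Unit2 k i) = B k $ i"

lemma stack2_tabulate:
  assumes "\<And>k. k \<in> {1..<layers P} \<Longrightarrow> dim_vec (A k) = width P (k + 1)"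
    and "\<And>k. k \<in> {1..<layers P} \<Longrightarrow> dim_vec (B k) = width P (k + 1)"
  shows "stack2 P a A B = tabulate (ineqs P) (unstack a A B)"
proof -
  have "map (\<lambda>k. list_of_vec (A k) @ list_of_vec (B k)) [1..<layers P]
    = map (\<lambda>k. map (unstack a A B) (map (Unit1 k) [0..<width P (k + 1)] @ map (Unit2 k) [0..<width P (k + 1)])) [1..<layers P]"
    using assms by (auto simp: list_of_vec_map)
  then show ?thesis
    unfolding stack2_def tabulate_eq_vec_of_list[symmetric] ineqs_def
    by (simp only: list.map unstack.simps map_concat map_map o_def)
qed

lemma stack1_tabulate:
  assumes "\<And>k. k \<in> {1..<layers P} \<Longrightarrow> dim_vec (A k) = width P (k + 1)"
  shows "stack1 P a A = tabulate (eqs P) (unstack a A B)"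
proof -
  have "map (\<lambda>k. list_of_vec (A k)) [1..<layers P]
    = map (\<lambda>k. map (unstack a A B) (map (Unit1 k) [0..<width P (k + 1)])) [1..<layers P]"
    using assms by (auto simp: list_of_vec_map)
  then show ?thesis
    unfolding stack1_def tabulate_eq_vec_of_list[symmetric] eqs_def
    by (simp only: list.map unstack.simps map_concat map_map o_def)
qed

text \<open>Address of entry \<open>(a, j)\<close> of U in the flat vector. Column 0 is
  \<open>(u_0, u)\<close> and is stored in place; column \<open>j > 0\<close> of U is column
  \<open>j - 1\<close> of V, stored layer by layer and column-major within a layer.\<close>

definition slot :: "relu_data \<Rightarrow> nat \<Rightarrow> nat \<Rightarrow> nat \<Rightarrow> nat" where
  "slot P r a j = (if j = 0 then a else 1 + ntotal P + offset P (layer_of P a) * (r - 1)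
     + (j - 1) * width P (layer_of P a) + coord_of P a)"

text \<open>The matrix \<open>U\<close> with rows \<open>(u\<^sub>0, 0)\<close> and \<open>(u, V)\<close>, read off the flat vector.\<close>

definition factor :: "relu_data \<Rightarrow> nat \<Rightarrow> real vec \<Rightarrow> nat \<Rightarrow> nat \<Rightarrow> real" where
  "factor P r x a j = (if a = 0 \<and> j \<noteq> 0 then 0 else x $ slot P r a j)"

text \<open>The entries of U that are variables; the border row has only \<open>u_0\<close>, the
  rest of it being fixed at zero.\<close>

definition free_entries :: "relu_data \<Rightarrow> nat \<Rightarrow> (nat \<times> nat) set" where
  "free_entries P r = {(a, j). a < Suc (ntotal P) \<and> j < r \<and> (a = 0 \<longrightarrow> j = 0)}"

lemma slot_ix:
  assumes "1 \<le> k" "i < width P k"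
  shows "slot P r (ix P k i) (Suc j)
    = 1 + ntotal P + offset P k * (r - 1) + j * width P k + i"
  using assms by (simp add: slot_def layer_of_ix coord_of_ix)

lemma slot_0 [simp]: "slot P r a 0 = a"
  by (simp add: slot_def)

lemma block_index_less:
  fixes i j w r :: nat
  assumes "i < w" "j < r"
  shows "j * w + i < r * w"
proof -
  have "j * w + i < Suc j * w" using assms by simp
  also have "\<dots> \<le> r * w" using assms by (intro mult_le_mono1) simp
  finally show ?thesis .
qed

lemma block_index_inj:
  fixes i j w :: nat
  assumes "j * w + i = j' * w + i'" "i < w" "i' < w"
  shows "j = j' \<and> i = i'"
proof -
  have "(j * w + i) div w = (j' * w + i') div w" "(j * w + i) mod w = (j' * w + i') mod w"
    using assms(1) by simp_all
  then show ?thesis using assms(2,3) by simp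
qed

lemma slot_block_less:
  assumes k: "1 \<le> k" "i < width P k" "k < k'" and j: "j < r - 1"
  shows "offset P k * (r - 1) + j * width P k + i < offset P k' * (r - 1)"
proof -
  have "offset P k * (r - 1) + (j * width P k + i) < offset P k * (r - 1) + (r - 1) * width P k"
    using block_index_less[OF k(2) j] by simp
  also have "\<dots> = offset P (Suc k) * (r - 1)" using offset_Suc[OF k(1), of P] by (simp add: algebra_simps)
  also have "\<dots> \<le> offset P k' * (r - 1)" using k(3) by (intro mult_le_mono1 offset_mono) simp
  finally show ?thesis by simp
qed

text \<open>Only injectivity is checked by hand. There are 1 + n r free entries, which is also the
  dimension of the flat vector, so surjectivity follows by counting.\<close>

lemma slot_bij:
  assumes r: "1 \<le> r"
  shows "bij_betw (\<lambda>(a, j). slot P r a j) (free_entries P r) {..<bm_dim P r}"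
proof -
  \<comment> \<open>The lower bound keeps the addresses of V apart from those of column 0, which are
    at most \<open>ntotal P\<close>.\<close>
  have below: "slot P r a (Suc j) < bm_dim P r \<and> ntotal P < slot P r a (Suc j)"
    if "(a, Suc j) \<in> free_entries P r" for a j
  proof -
    have a: "a < Suc (ntotal P)" "a \<noteq> 0" and j: "j < r - 1" using that by (auto simp: free_entries_def)
    from ix_cases[OF a] obtain k i where ki: "1 \<le> k" "k \<le> layers P" "i < width P k" "a = ix P k i"
      by blast
    have "offset P k * (r - 1) + j * width P k + i < ntotal P * (r - 1)"
      unfolding ntotal_offset using slot_block_less[OF ki(1,3) _ j] ki(2) by simp
    then show ?thesis unfolding ki(4) slot_ix[OF ki(1,3)] bm_dim_def by simp
  qed
  have inj: "inj_on (\<lambda>(a, j). slot P r a j) (free_entries P r)"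
  proof (rule inj_onI, clarify)
    fix a j a' j'
    assume aj: "(a, j) \<in> free_entries P r" "(a', j') \<in> free_entries P r"
      and eq: "slot P r a j = slot P r a' j'"
    show "a = a' \<and> j = j'"
    proof (cases "j = 0 \<or> j' = 0")
      case True
      then show ?thesis using aj eq below[of a "j - 1"] below[of a' "j' - 1"]
        by (cases j; cases j') (auto simp: free_entries_def)
    next
      case False
      then obtain m m' where m: "j = Suc m" "j' = Suc m'" by (meson not0_implies_Suc)
      have "a < Suc (ntotal P)" "a \<noteq> 0" and mr: "m < r - 1" "m' < r - 1"
        and "a' < Suc (ntotal P)" "a' \<noteq> 0"
        using aj m by (auto simp: free_entries_def)
      then obtain k i k' i' where ki: "1 \<le> k" "i < width P k" "a = ix P k i"
        and ki': "1 \<le> k'" "i' < width P k'" "a' = ix P k' i'"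
        by (metis ix_cases)
      have eq': "offset P k * (r - 1) + m * width P k + i = offset P k' * (r - 1) + m' * width P k' + i'"
        using eq unfolding m ki(3) ki'(3) slot_ix[OF ki(1,2)] slot_ix[OF ki'(1,2)] by simp
      have "k = k'"
        using slot_block_less[OF ki(1,2) _ mr(1), of k'] slot_block_less[OF ki'(1,2) _ mr(2), of k] eq'
        by (cases k k' rule: linorder_cases) auto
      then show ?thesis using block_index_inj[of m "width P k" i m' i'] eq' ki ki' m by auto
    qed
  qed
  have "free_entries P r = insert (0, 0) ({1..ntotal P} \<times> {..<r})"
    using r by (auto simp: free_entries_def)
  then have card: "card (free_entries P r) = bm_dim P r" and fin: "finite (free_entries P r)"
    using r by (auto simp: card_cartesian_product bm_dim_def algebra_simps)
  have "(\<lambda>(a, j). slot P r a j) ` free_entries P r \<subseteq> {..<bm_dim P r}"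
  proof clarify
    fix a j assume aj: "(a, j) \<in> free_entries P r"
    show "slot P r a j < bm_dim P r"
    proof (cases j)
      case 0
      then show ?thesis using aj by (simp add: free_entries_def bm_dim_def)
    qed (use aj below in simp)
  qed
  then have "(\<lambda>(a, j). slot P r a j) ` free_entries P r = {..<bm_dim P r}"
    by (rule card_subset_eq[rotated]) (use card inj in \<open>simp_all add: card_image\<close>)
  with inj show ?thesis by (simp add: bij_betw_def)
qed

lemma slot_less: "1 \<le> r \<Longrightarrow> (a, j) \<in> free_entries P r \<Longrightarrow> slot P r a j < bm_dim P r"
  using bij_betwE[OF slot_bij, of r P] by force

lemma slot_cases:
  assumes "1 \<le> r" "q < bm_dim P r"
  obtains a j where "(a, j) \<in> free_entries P r" "q = slot P r a j"
proof -
  have "q \<in> (\<lambda>(a, j). slot P r a j) ` free_entries P r"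
    using bij_betw_imp_surj_on[OF slot_bij[OF assms(1), of P]] assms(2) by simp
  then show thesis using that by (elim imageE) (auto split: prod.splits)
qed

lemma slot_eq_iff:
  assumes "1 \<le> r" "(a, j) \<in> free_entries P r" "(a', j') \<in> free_entries P r"
  shows "slot P r a j = slot P r a' j' \<longleftrightarrow> a = a' \<and> j = j'"
  using inj_on_eq_iff[OF bij_betw_imp_inj_on[OF slot_bij[OF assms(1), of P]] assms(2,3)] by simp

lemma factor_surj:
  assumes "1 \<le> r"
  shows "\<exists>x\<in>carrier_vec (bm_dim P r). \<forall>(a, j)\<in>free_entries P r. factor P r x a j = M a j"
proof -
  define g where "g = inv_into (free_entries P r) (\<lambda>(a, j). slot P r a j)"
  define x where "x = Matrix.vec (bm_dim P r) (\<lambda>q. M (fst (g q)) (snd (g q)))"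
  have "factor P r x a j = M a j" if "(a, j) \<in> free_entries P r" for a j
  proof -
    have "g (slot P r a j) = (a, j)"
      using inv_into_f_f[OF bij_betw_imp_inj_on[OF slot_bij[OF assms, of P]] that] by (simp add: g_def)
    then show ?thesis using that slot_less[OF assms that] by (auto simp: factor_def x_def free_entries_def)
  qed
  then show ?thesis by (intro bexI[of _ x]) (auto simp: x_def)
qed

lemma factor_unit:
  assumes "1 \<le> r" "(a, j) \<in> free_entries P r" "s < Suc (ntotal P)" "m < r"
  shows "factor P r (unit_vec (bm_dim P r) (slot P r a j)) s m = (if s = a \<and> m = j then 1 else 0)"
proof (cases "(s, m) \<in> free_entries P r")
  case True
  then show ?thesis
    using slot_less[OF assms(1) True] slot_less[OF assms(1,2)] slot_eq_iff[OF assms(1) True assms(2)]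
    by (auto simp: factor_def free_entries_def)
next
  case False
  then show ?thesis using assms by (auto simp: factor_def free_entries_def)
qed

lemma factor_add_smult:
  assumes "1 \<le> r" "x \<in> carrier_vec (bm_dim P r)" "v \<in> carrier_vec (bm_dim P r)"
    "s < Suc (ntotal P)" "m < r"
  shows "factor P r (x + t \<cdot>\<^sub>v v) s m = factor P r x s m + t * factor P r v s m"
proof (cases "(s, m) \<in> free_entries P r")
  case True
  then show ?thesis using slot_less[OF assms(1) True] assms by (auto simp: factor_def)
next
  case False
  then show ?thesis using assms by (auto simp: factor_def free_entries_def)
qed

text \<open>The fixed entries of U are zero, so the squared norm of the flat vector is the trace of
  U U^T. This matches the bound \<open>R\<close> on the one side with \<open>R^2\<close> on the
  other.\<close>

lemma vnorm_square_factor: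
  assumes "1 \<le> r" "x \<in> carrier_vec (bm_dim P r)"
  shows "(vnorm x)\<^sup>2 = (\<Sum>a<Suc (ntotal P). gram r (factor P r x) a a)"
proof -
  have "(vnorm x)\<^sup>2 = (\<Sum>q<bm_dim P r. (x $ q)\<^sup>2)"
    using assms(2) by (simp add: vnorm_def scalar_prod_def sum_nonneg power2_eq_square atLeast0LessThan)
  also have "\<dots> = (\<Sum>(a, j)\<in>free_entries P r. (x $ slot P r a j)\<^sup>2)"
    using sum.reindex_bij_betw[OF slot_bij[OF assms(1), of P], of "\<lambda>q. (x $ q)\<^sup>2"]
    by (simp add: case_prod_unfold)
  also have "\<dots> = (\<Sum>(a, j)\<in>{..<Suc (ntotal P)} \<times> {..<r}. (factor P r x a j)\<^sup>2)"
    by (rule sum.mono_neutral_cong_left) (auto simp: free_entries_def factor_def split: if_splits)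
  also have "\<dots> = (\<Sum>a<Suc (ntotal P). gram r (factor P r x) a a)"
    by (simp add: sum.cartesian_product[symmetric] gram_def power2_eq_square)
  finally show ?thesis .
qed

lemma u0_factor: "u0 x = factor P r x 0 0"
  by (simp add: u0_def factor_def)

lemma uvec_factor: "i < width P k \<Longrightarrow> uvec P x k $ i = factor P r x (ix P k i) 0"
  by (simp add: uvec_def factor_def ix_def)

lemma Vmat_factor: "1 \<le> k \<Longrightarrow> i < width P k \<Longrightarrow> j < r - 1 \<Longrightarrow>
    Vmat P r x k $$ (i, j) = factor P r x (ix P k i) (Suc j)"
  by (simp add: Vmat_def factor_def slot_ix)

lemma factor_row_0: "0 < j \<Longrightarrow> factor P r x 0 j = 0"
  by (simp add: factor_def)

lemma sum_lessThan_split_first: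
  fixes f :: "nat \<Rightarrow> real"
  assumes "1 \<le> r"
  shows "(\<Sum>j<r. f j) = f 0 + (\<Sum>j<r - 1. f (Suc j))"
  using sum.lessThan_Suc_shift[of f "r - 1"] assms by simp

text \<open>The border row of U has a single nonzero entry; this is the origin of the factor
  \<open>u_0\<close> in the objective and in the ReLU inequalities of (BM-r).\<close>

lemma gram_factor_0:
  "1 \<le> r \<Longrightarrow> gram r (factor P r x) a 0 = factor P r x a 0 * factor P r x 0 0"
  by (simp add: gram_def sum_lessThan_split_first factor_row_0)

lemma gram_factor:
  assumes "1 \<le> r" "1 \<le> k" "i < width P k" "1 \<le> k'" "i' < width P k'"
  shows "gram r (factor P r x) (ix P k i) (ix P k' i')
    = uvec P x k $ i * uvec P x k' $ i' + (\<Sum>j<r - 1. Vmat P r x k $$ (i, j) * Vmat P r x k' $$ (i', j))"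
  using assms by (simp add: gram_def sum_lessThan_split_first uvec_factor[of _ _ _ _ r] Vmat_factor)

lemma bm_f_form:
  assumes "wf_data P" "1 \<le> r"
  shows "bm_f P x = obj_form P (gram r (factor P r x))"
proof -
  have "bm_f P x = u0 x * (\<Sum>i<width P (layers P). wlast P $ i * uvec P x (layers P) $ i)"
    by (simp add: bm_f_def scalar_prod_def atLeast0LessThan uvec_def)
  also have "\<dots> = u0 x * (\<Sum>i<width P (layers P). wlast P $ i * factor P r x (ix P (layers P) i) 0)"
    by (simp add: uvec_factor[where r = r])
  finally show ?thesis
    using assms(2) by (simp add: obj_form_def gram_factor_0 u0_factor[of x P r] sum_distrib_left mult_ac)
qed

lemma ineq_form_gram_factor:
  assumes wf: "wf_data P" and r: "1 \<le> r" and l: "l \<in> set (ineqs P)"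
  shows "unstack (bm_g0 P r x) (bm_g1 P x) (bm_g2 P x) l = ineq_form P l (gram r (factor P r x))"
proof (cases l)
  case Corner
  have w: "1 \<le> width P 1" "center P \<in> carrier_vec (width P 1)" using wf by (auto simp: wf_data_def)
  let ?u = "\<lambda>i. uvec P x 1 $ i" and ?c = "\<lambda>i. center P $ i"
  have u: "(vnorm (uvec P x 1 - u0 x \<cdot>\<^sub>v center P))\<^sup>2 = (\<Sum>i<width P 1. (?u i - u0 x * ?c i)\<^sup>2)"
    using w by (simp add: vnorm_def scalar_prod_def sum_nonneg power2_eq_square atLeast0LessThan)
  have c: "(vnorm (center P))\<^sup>2 = (\<Sum>i<width P 1. (?c i)\<^sup>2)"
    using w by (simp add: vnorm_def scalar_prod_def sum_nonneg power2_eq_square atLeast0LessThan)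
  have V: "(fnorm (Vmat P r x 1))\<^sup>2 = (\<Sum>i<width P 1. \<Sum>j<r - 1. (Vmat P r x 1 $$ (i, j))\<^sup>2)"
    by (simp add: fnorm_def sum_nonneg Vmat_def)
  have "(\<Sum>i<width P 1. gram r (factor P r x) (ix P 1 i) (ix P 1 i))
      = (\<Sum>i<width P 1. (?u i)\<^sup>2) + (\<Sum>i<width P 1. \<Sum>j<r - 1. (Vmat P r x 1 $$ (i, j))\<^sup>2)"
    using r by (simp add: gram_factor sum.distrib power2_eq_square del: One_nat_def)
  moreover have "(\<Sum>i<width P 1. ?c i * gram r (factor P r x) (ix P 1 i) 0) = u0 x * (\<Sum>i<width P 1. ?c i * ?u i)"
    using r by (simp add: gram_factor_0 uvec_factor[of _ _ _ _ r] u0_factor[of x P r] sum_distrib_left mult_ac del: One_nat_def)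
  moreover have "gram r (factor P r x) 0 0 = (u0 x)\<^sup>2"
    using r by (simp add: gram_factor_0 u0_factor[of x P r] power2_eq_square)
  moreover have "(\<Sum>i<width P 1. (?u i - u0 x * ?c i)\<^sup>2)
      = (\<Sum>i<width P 1. (?u i)\<^sup>2) - 2 * (u0 x * (\<Sum>i<width P 1. ?c i * ?u i)) + (u0 x)\<^sup>2 * (\<Sum>i<width P 1. (?c i)\<^sup>2)"
    by (simp add: power2_eq_square algebra_simps sum.distrib sum_subtractf sum_distrib_left)
  ultimately show ?thesis
    unfolding Corner by (simp only: unstack.simps ineq_form.simps bm_g0_def u c V) (simp add: algebra_simps)
next
  case (Unit1 k i)
  then have "k \<in> {1..<layers P}" "i < width P (k + 1)" using l by (auto simp: set_ineqs)
  then show ?thesis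
    using r Unit1 uvec_factor[of i P "k + 1" x r]
    by (simp add: bm_g1_def gram_factor_0 u0_factor[of x P r] mult.commute uvec_def)
next
  case (Unit2 k i)
  then have ki: "k \<in> {1..<layers P}" "i < width P (k + 1)" using l by (auto simp: set_ineqs)
  have W: "weight P k \<in> carrier_mat (width P (k + 1)) (width P k)" "bias P k \<in> carrier_vec (width P (k + 1))"
    using wf ki by (auto simp: wf_data_def)
  have d: "dim_vec (uvec P x m) = width P m" for m by (simp add: uvec_def)
  have "(weight P k *\<^sub>v uvec P x k) $ i = (\<Sum>j<width P k. weight P k $$ (i, j) * factor P r x (ix P k j) 0)"
    using W ki d by (simp add: scalar_prod_def atLeast0LessThan uvec_factor[of _ _ _ _ r])
  then have "bm_g2 P x k $ i = u0 x * ((\<Sum>j<width P k. weight P k $$ (i, j) * factor P r x (ix P k j) 0)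
      + u0 x * bias P k $ i - factor P r x (ix P (k + 1) i) 0)"
    using W ki d uvec_factor[of i P "k + 1" x r] by (simp add: bm_g2_def)
  then show ?thesis
    using r Unit2 by (simp add: gram_factor_0 u0_factor[of x P r] sum_distrib_left algebra_simps)
qed

lemma eq_form_gram_factor:
  assumes wf: "wf_data P" and r: "1 \<le> r" and l: "l \<in> set (eqs P)"
  shows "unstack (bm_h0 x) (bm_hk P r x) B l = eq_const l + eq_form P l (gram r (factor P r x))"
proof (cases l)
  case Corner
  then show ?thesis using r
    by (simp add: bm_h0_def eq_const_def gram_factor_0 u0_factor[of x P r] power2_eq_square)
next
  case (Unit1 k i)
  then have ki: "k \<in> {1..<layers P}" "i < width P (k + 1)" using l by (auto simp: set_eqs)
  have W: "weight P k \<in> carrier_mat (width P (k + 1)) (width P k)" "bias P k \<in> carrier_vec (width P (k + 1))"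
    using wf ki by (auto simp: wf_data_def)
  have d: "dim_vec (uvec P x m) = width P m" "Vmat P r x m \<in> carrier_mat (width P m) (r - 1)" for m
    by (simp_all add: uvec_def Vmat_def)
  let ?u = "uvec P x" and ?V = "Vmat P r x" and ?W = "weight P k"
  have "bm_hk P r x k $ i
      = (?u (k + 1) $ i - (\<Sum>m<width P k. ?W $$ (i, m) * ?u k $ m) - u0 x * bias P k $ i) * ?u (k + 1) $ i
        + (\<Sum>j<r - 1. (?V (k + 1) $$ (i, j) - (\<Sum>m<width P k. ?W $$ (i, m) * ?V k $$ (m, j))) * ?V (k + 1) $$ (i, j))"
    using W ki d[of k] d[of "k + 1"]
    by (simp add: bm_hk_def diag_vec_def outer_def scalar_prod_def atLeast0LessThan)
  \<comment> \<open>The sums are regrouped so that each bracket is one entry of U U^T, a product of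
    u-parts plus an inner product of rows of V.\<close>
  also have "\<dots> = (?u (k + 1) $ i * ?u (k + 1) $ i + (\<Sum>j<r - 1. ?V (k + 1) $$ (i, j) * ?V (k + 1) $$ (i, j)))
      - (\<Sum>m<width P k. ?W $$ (i, m) * (?u k $ m * ?u (k + 1) $ i + (\<Sum>j<r - 1. ?V k $$ (m, j) * ?V (k + 1) $$ (i, j))))
      - bias P k $ i * (?u (k + 1) $ i * u0 x)"
  proof -
    have "(\<Sum>j<r - 1. (\<Sum>m<width P k. ?W $$ (i, m) * ?V k $$ (m, j)) * ?V (k + 1) $$ (i, j))
      = (\<Sum>m<width P k. ?W $$ (i, m) * (\<Sum>j<r - 1. ?V k $$ (m, j) * ?V (k + 1) $$ (i, j)))"
      unfolding sum_distrib_right sum_distrib_left by (subst sum.swap) (simp add: mult_ac)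
    moreover have "(\<Sum>m<width P k. ?W $$ (i, m) * ?u k $ m) * ?u (k + 1) $ i
      = (\<Sum>m<width P k. ?W $$ (i, m) * (?u k $ m * ?u (k + 1) $ i))"
      unfolding sum_distrib_right by (simp add: mult_ac)
    moreover have "(\<Sum>j<r - 1. (?V (k + 1) $$ (i, j) - (\<Sum>m<width P k. ?W $$ (i, m) * ?V k $$ (m, j))) * ?V (k + 1) $$ (i, j))
      = (\<Sum>j<r - 1. ?V (k + 1) $$ (i, j) * ?V (k + 1) $$ (i, j))
        - (\<Sum>j<r - 1. (\<Sum>m<width P k. ?W $$ (i, m) * ?V k $$ (m, j)) * ?V (k + 1) $$ (i, j))"
      by (simp add: left_diff_distrib sum_subtractf)
    moreover have "(\<Sum>m<width P k. ?W $$ (i, m) * (?u k $ m * ?u (k + 1) $ i + (\<Sum>j<r - 1. ?V k $$ (m, j) * ?V (k + 1) $$ (i, j))))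
      = (\<Sum>m<width P k. ?W $$ (i, m) * (?u k $ m * ?u (k + 1) $ i))
        + (\<Sum>m<width P k. ?W $$ (i, m) * (\<Sum>j<r - 1. ?V k $$ (m, j) * ?V (k + 1) $$ (i, j)))"
      by (simp add: distrib_left sum.distrib)
    ultimately show ?thesis
      by (simp only: left_diff_distrib) (simp add: sum_distrib_left mult_ac)
  qed
  also have "\<dots> = eq_form P (Unit1 k i) (gram r (factor P r x))"
    using r ki by (simp add: gram_factor gram_factor_0 uvec_factor[of _ _ "k + 1" _ r] u0_factor[of x P r]
        del: One_nat_def)
  finally show ?thesis using Unit1 by (simp add: eq_const_def)
next
  case (Unit2 k i)
  then show ?thesis using l by (simp add: set_eqs)
qed

lemma ball_ineqs: "(\<forall>l\<in>set (ineqs P). Q l) \<longleftrightarrow> Q Corner \<and>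
    (\<forall>k\<in>{1..<layers P}. (\<forall>i<width P (k + 1). Q (Unit1 k i)) \<and> (\<forall>i<width P (k + 1). Q (Unit2 k i)))"
  by (auto simp: set_ineqs split: constraint.splits)

lemma ball_eqs: "(\<forall>l\<in>set (eqs P). Q l) \<longleftrightarrow> Q Corner \<and>
    (\<forall>k\<in>{1..<layers P}. \<forall>i<width P (k + 1). Q (Unit1 k i))"
  by (auto simp: set_eqs split: constraint.splits)

lemma bm_g_tabulate:
  assumes "wf_data P" "1 \<le> r"
  shows "bm_g P r x = tabulate (ineqs P) (\<lambda>l. ineq_form P l (gram r (factor P r x)))"
proof -
  have "bm_g P r x = tabulate (ineqs P) (unstack (bm_g0 P r x) (bm_g1 P x) (bm_g2 P x))"
    unfolding bm_g_def by (rule stack2_tabulate) (simp_all add: bm_g1_def bm_g2_def uvec_def)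
  also have "\<dots> = tabulate (ineqs P) (\<lambda>l. ineq_form P l (gram r (factor P r x)))"
    by (rule tabulate_cong) (rule ineq_form_gram_factor[OF assms])
  finally show ?thesis .
qed

lemma bm_h_tabulate:
  assumes "wf_data P" "1 \<le> r"
  shows "bm_h P r x = tabulate (eqs P) (\<lambda>l. eq_const l + eq_form P l (gram r (factor P r x)))"
proof -
  have "dim_vec (bm_hk P r x k) = width P (k + 1)" if "k \<in> {1..<layers P}" for k
  proof -
    have "weight P k \<in> carrier_mat (width P (k + 1)) (width P k)"
      using that assms(1) by (auto simp: wf_data_def)
    then show ?thesis by (simp add: bm_hk_def diag_vec_def)
  qed
  then have "bm_h P r x = tabulate (eqs P) (unstack (bm_h0 x) (bm_hk P r x) (bm_hk P r x))"
    unfolding bm_h_def by (rule stack1_tabulate)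
  also have "\<dots> = tabulate (eqs P) (\<lambda>l. eq_const l + eq_form P l (gram r (factor P r x)))"
    by (rule tabulate_cong) (rule eq_form_gram_factor[OF assms])
  finally show ?thesis .
qed

text \<open>The common core of both feasibility notions: it applies to U U^T in the factored problem
  and to X in the semidefinite one.\<close>

definition constraints_hold :: "relu_data \<Rightarrow> (nat \<Rightarrow> nat \<Rightarrow> real) \<Rightarrow> bool" where
  "constraints_hold P X \<longleftrightarrow> (\<forall>l\<in>set (ineqs P). ineq_form P l X \<le> 0) \<and>
     (\<forall>l\<in>set (eqs P). eq_const l + eq_form P l X = 0)"

lemma bm_feasible_iff:
  assumes "wf_data P" "1 \<le> r"
  shows "bm_feasible P r x \<longleftrightarrow> x \<in> carrier_vec (bm_dim P r) \<and> vnorm x \<le> bound P \<and>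
    constraints_hold P (gram r (factor P r x))"
  unfolding bm_feasible_def bm_g_tabulate[OF assms] bm_h_tabulate[OF assms] dim_tabulate
    tabulate_le_0_iff tabulate_eq_0_iff constraints_hold_def by blast

abbreviation entries :: "real mat \<Rightarrow> nat \<Rightarrow> nat \<Rightarrow> real" where
  "entries X \<equiv> (\<lambda>a b. X $$ (a, b))"

lemma sdp_obj_form: "wf_data P \<Longrightarrow> sdp_obj P X = obj_form P (entries X)"
  by (simp add: sdp_obj_def obj_form_def scalar_prod_def Xvec_def ix_def atLeast0LessThan)

lemma sdp_feasible_iff:
  assumes wf: "wf_data P"
  shows "sdp_feasible P r X \<longleftrightarrow> X \<in> carrier_mat (Suc (ntotal P)) (Suc (ntotal P)) \<and>
    psd_fun (Suc (ntotal P)) (entries X) \<and> vec_space.rank (ntotal P + 1) X \<le> r \<and>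
    constraints_hold P (entries X) \<and> (\<Sum>a<Suc (ntotal P). X $$ (a, a)) \<le> (bound P)\<^sup>2"
proof (cases "X \<in> carrier_mat (Suc (ntotal P)) (Suc (ntotal P))")
  case X: True
  have ctr: "center P \<in> carrier_vec (width P 1)" using wf by (simp add: wf_data_def)
  have ball: "mtrace (Xblk P X 1 1) - 2 * (Xvec P X 1 \<bullet> center P) + (vnorm (center P))\<^sup>2 * X0 X
       \<le> (radius P)\<^sup>2 * X0 X \<longleftrightarrow> ineq_form P Corner (entries X) \<le> 0"
    using ctr by (simp add: mtrace_def Xblk_def Xvec_def X0_def scalar_prod_def ix_def atLeast0LessThan
        algebra_simps)
  have unit: "0\<^sub>v (width P (k + 1)) \<le> Xvec P X (k + 1) \<longleftrightarrow>
        (\<forall>i<width P (k + 1). ineq_form P (Unit1 k i) (entries X) \<le> 0)" (is ?A)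
    "weight P k *\<^sub>v Xvec P X k + X0 X \<cdot>\<^sub>v bias P k \<le> Xvec P X (k + 1) \<longleftrightarrow>
        (\<forall>i<width P (k + 1). ineq_form P (Unit2 k i) (entries X) \<le> 0)" (is ?B)
    "diag_vec (Xblk P X (k + 1) (k + 1) - weight P k * Xblk P X k (k + 1)
          - outer (bias P k) (Xvec P X (k + 1))) = 0\<^sub>v (width P (k + 1)) \<longleftrightarrow>
        (\<forall>i<width P (k + 1). eq_const (Unit1 k i) + eq_form P (Unit1 k i) (entries X) = 0)" (is ?C)
    if k: "k \<in> {1..<layers P}" for k
  proof -
    have W: "weight P k \<in> carrier_mat (width P (k + 1)) (width P k)" "bias P k \<in> carrier_vec (width P (k + 1))"
      using wf k by (auto simp: wf_data_def)
    show ?A by (simp add: less_eq_vec_def Xvec_def ix_def)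
    show ?B using W by (simp add: less_eq_vec_def Xvec_def ix_def X0_def scalar_prod_def atLeast0LessThan algebra_simps)
    show ?C using W
      by (simp add: vec_eq_iff diag_vec_def Xblk_def Xvec_def ix_def outer_def scalar_prod_def
          atLeast0LessThan eq_const_def algebra_simps)
  qed
  have "X0 X = 1 \<longleftrightarrow> eq_const Corner + eq_form P Corner (entries X) = 0"
    by (auto simp: X0_def eq_const_def)
  moreover have "mtrace X = (\<Sum>a<Suc (ntotal P). X $$ (a, a))" using X by (simp add: mtrace_def)
  ultimately show ?thesis
    unfolding sdp_feasible_def constraints_hold_def ball_ineqs ball_eqs psd_iff_psd_fun
    using X ball unit by auto
qed (auto simp: sdp_feasible_def psd_def)

section \<open>Gradients and first-order conditions in terms of labels\<close>

lemma grads_tabulate_mult: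
  assumes G: "\<And>x. G x = tabulate ls (\<lambda>l. g l x)" and "distinct ls" "q < dim_vec x"
  shows "(grads G x *\<^sub>v tabulate ls \<mu>) $ q = (\<Sum>l\<in>set ls. \<mu> l * grad (g l) x $ q)"
proof -
  have "(grads G x *\<^sub>v tabulate ls \<mu>) $ q = (\<Sum>j<length ls. grad (\<lambda>x'. G x' $ j) x $ q * \<mu> (ls ! j))"
    using assms(3) by (simp add: grads_def G[of x] scalar_prod_def atLeast0LessThan)
  also have "\<dots> = (\<Sum>j<length ls. \<mu> (ls ! j) * grad (g (ls ! j)) x $ q)"
    by (rule sum.cong) (simp_all add: G mult.commute)
  \<comment> \<open>Distinct labels turn the sum over positions into a sum over labels.\<close>
  also have "\<dots> = (\<Sum>l\<in>set ls. \<mu> l * grad (g l) x $ q)"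
    by (rule sum.reindex_bij_betw[OF bij_betw_nth]) (use assms(2) in auto)
  finally show ?thesis .
qed

text \<open>Moving along the unit vector of a slot moves a single entry of U, and the form becomes a
  quadratic polynomial in \<open>t\<close> whose linear coefficient is its value at the
  corresponding tangent. The constant \<open>c\<close> accommodates \<open>eq_const\<close>.\<close>

lemma grad_lin_form:
  assumes F: "lin_form (Suc (ntotal P)) F" and r: "1 \<le> r" and aj: "(a, j) \<in> free_entries P r"
    and x: "x \<in> carrier_vec (bm_dim P r)"
  shows "grad (\<lambda>x'. c + F (gram r (factor P r x'))) x $ slot P r a j = F (edge (\<lambda>b. factor P r x b j) a)"
proof -
  let ?e = "unit_vec (bm_dim P r) (slot P r a j) :: real vec"
  have a: "a < Suc (ntotal P)" "j < r" using aj by (auto simp: free_entries_def)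
  have "F (gram r (factor P r (x + t \<cdot>\<^sub>v ?e)))
      = F (gram r (factor P r x)) + t * F (edge (\<lambda>b. factor P r x b j) a) + t\<^sup>2 * F (gram r (factor P r ?e))" for t
  proof -
    have "F (gram r (factor P r (x + t \<cdot>\<^sub>v ?e))) = F (gram r (\<lambda>s m. factor P r x s m + t * factor P r ?e s m))"
      by (rule lin_form_D(3)[OF F]) (simp add: gram_def factor_add_smult[OF r x])
    also have "\<dots> = F (gram r (factor P r x))
        + t * (\<Sum>s<Suc (ntotal P). \<Sum>m<r. factor P r ?e s m * F (edge (\<lambda>b. factor P r x b m) s))
        + t\<^sup>2 * F (gram r (factor P r ?e))"
      by (rule lin_form_gram_perturb[OF F])
    also have "(\<Sum>s<Suc (ntotal P). \<Sum>m<r. factor P r ?e s m * F (edge (\<lambda>b. factor P r x b m) s))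
        = (\<Sum>s<Suc (ntotal P). if s = a then (\<Sum>m<r. if m = j then F (edge (\<lambda>b. factor P r x b m) s) else 0) else 0)"
      by (intro sum.cong refl) (auto simp: factor_unit[OF r aj] mult_delta_left intro!: sum.neutral)
    also have "\<dots> = F (edge (\<lambda>b. factor P r x b j) a)" using a by (simp add: mult_delta_left del: sum.lessThan_Suc)
    finally show ?thesis .
  qed
  moreover have "((\<lambda>t. c + (A + t * B + t\<^sup>2 * C)) has_real_derivative B) (at 0)" for A B C :: real
    by (auto intro!: derivative_eq_intros)
  ultimately have "deriv (\<lambda>t. c + F (gram r (factor P r (x + t \<cdot>\<^sub>v ?e)))) 0 = F (edge (\<lambda>b. factor P r x b j) a)"
    by (simp add: DERIV_imp_deriv)
  then show ?thesis using slot_less[OF r aj] x by (simp add: grad_def)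
qed

definition ineq_mult :: "multipliers \<Rightarrow> constraint \<Rightarrow> real" where
  "ineq_mult m = unstack (y0 m) (y1 m) (y2 m)"

definition eq_mult :: "multipliers \<Rightarrow> constraint \<Rightarrow> real" where
  "eq_mult m = unstack (z0 m) (zk m) (zk m)"

text \<open>Brings certificates into the shape of the convex multipliers: equations for the
  Lagrangian at the tangents of U and conditions per label, with no flat vectors left.\<close>

lemma certifies_first_order_iff:
  assumes wf: "wf_data P" and r: "1 \<le> r"
  shows "certifies_first_order P r x m \<longleftrightarrow> bm_feasible P r x \<and> wf_mult P m \<and>
    (\<forall>(a, j)\<in>free_entries P r.
      lagrangian_form P 1 (ineq_mult m) (eq_mult m) (edge (\<lambda>b. factor P r x b j) a) = 0) \<and>
    (\<forall>l\<in>set (ineqs P). ineq_mult m l * ineq_form P l (gram r (factor P r x)) = 0) \<and>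
    (\<forall>l\<in>set (ineqs P). 0 \<le> ineq_mult m l)"
proof (cases "bm_feasible P r x \<and> wf_mult P m")
  case True
  then have x: "x \<in> carrier_vec (bm_dim P r)" and m: "wf_mult P m" by (auto simp: bm_feasible_def)
  have y: "yvec P m = tabulate (ineqs P) (ineq_mult m)"
    unfolding yvec_def ineq_mult_def by (rule stack2_tabulate) (use m in \<open>auto simp: wf_mult_def\<close>)
  have z: "zvec P m = tabulate (eqs P) (eq_mult m)"
    unfolding zvec_def eq_mult_def by (rule stack1_tabulate) (use m in \<open>auto simp: wf_mult_def\<close>)
  let ?G = "grad (bm_f P) x + grads (bm_g P r) x *\<^sub>v yvec P m + grads (bm_h P r) x *\<^sub>v zvec P m"
  have entry: "?G $ slot P r a j = lagrangian_form P 1 (ineq_mult m) (eq_mult m) (edge (\<lambda>b. factor P r x b j) a)"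
    if aj: "(a, j) \<in> free_entries P r" for a j
  proof -
    have q: "slot P r a j < dim_vec x" using slot_less[OF r aj] x by simp
    have "bm_f P = (\<lambda>x'. 0 + obj_form P (gram r (factor P r x')))"
      by (rule ext) (simp add: bm_f_form[OF wf r])
    then have f: "grad (bm_f P) x $ slot P r a j = obj_form P (edge (\<lambda>b. factor P r x b j) a)"
      using grad_lin_form[OF lin_form_obj[OF wf] r aj x, of 0] by (simp only:)
    have g: "(grads (bm_g P r) x *\<^sub>v yvec P m) $ slot P r a j
        = (\<Sum>l\<in>set (ineqs P). ineq_mult m l * ineq_form P l (edge (\<lambda>b. factor P r x b j) a))"
      unfolding y grads_tabulate_mult[OF bm_g_tabulate[OF wf r] distinct_ineqs q]
      using grad_lin_form[OF lin_form_ineq[OF wf] r aj x, of _ 0] by simp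
    have h: "(grads (bm_h P r) x *\<^sub>v zvec P m) $ slot P r a j
        = (\<Sum>l\<in>set (eqs P). eq_mult m l * eq_form P l (edge (\<lambda>b. factor P r x b j) a))"
      unfolding z grads_tabulate_mult[OF bm_h_tabulate[OF wf r] distinct_eqs q]
      using grad_lin_form[OF lin_form_eq r aj x] by simp
    show ?thesis using q f g h by (simp add: lagrangian_form_def grads_def)
  qed
  have "?G = 0\<^sub>v (bm_dim P r) \<longleftrightarrow> (\<forall>q<bm_dim P r. ?G $ q = 0)"
    using x by (auto simp: vec_eq_iff grads_def)
  also have "\<dots> \<longleftrightarrow> (\<forall>(a, j)\<in>free_entries P r.
      lagrangian_form P 1 (ineq_mult m) (eq_mult m) (edge (\<lambda>b. factor P r x b j) a) = 0)"
  proof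
    assume *: "\<forall>q<bm_dim P r. ?G $ q = 0"
    show "\<forall>(a, j)\<in>free_entries P r.
      lagrangian_form P 1 (ineq_mult m) (eq_mult m) (edge (\<lambda>b. factor P r x b j) a) = 0"
    proof clarify
      fix a j assume aj: "(a, j) \<in> free_entries P r"
      then have "?G $ slot P r a j = 0" using * slot_less[OF r] by blast
      then show "lagrangian_form P 1 (ineq_mult m) (eq_mult m) (edge (\<lambda>b. factor P r x b j) a) = 0"
        unfolding entry[OF aj] .
    qed
  next
    assume *: "\<forall>(a, j)\<in>free_entries P r.
      lagrangian_form P 1 (ineq_mult m) (eq_mult m) (edge (\<lambda>b. factor P r x b j) a) = 0"
    show "\<forall>q<bm_dim P r. ?G $ q = 0"
    proof (intro allI impI)
      fix q assume "q < bm_dim P r"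
      then obtain a j where aj: "(a, j) \<in> free_entries P r" "q = slot P r a j"
        using slot_cases[OF r] by blast
      show "?G $ q = 0" unfolding aj(2) entry[OF aj(1)] using * aj(1) by blast
    qed
  qed
  finally have stat: "?G = 0\<^sub>v (bm_dim P r) \<longleftrightarrow> (\<forall>(a, j)\<in>free_entries P r.
      lagrangian_form P 1 (ineq_mult m) (eq_mult m) (edge (\<lambda>b. factor P r x b j) a) = 0)" .
  have "hadamard (yvec P m) (bm_g P r x) = 0\<^sub>v (dim_vec (yvec P m)) \<longleftrightarrow>
      (\<forall>l\<in>set (ineqs P). ineq_mult m l * ineq_form P l (gram r (factor P r x)) = 0)"
    unfolding y bm_g_tabulate[OF wf r] hadamard_tabulate dim_tabulate tabulate_eq_0_iff ..
  moreover have "0\<^sub>v (dim_vec (yvec P m)) \<le> yvec P m \<longleftrightarrow> (\<forall>l\<in>set (ineqs P). 0 \<le> ineq_mult m l)"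
    unfolding y dim_tabulate tabulate_ge_0_iff ..
  ultimately show ?thesis unfolding certifies_first_order_def using True stat by blast
qed (auto simp: certifies_first_order_def)

section \<open>The slack matrix\<close>

lemma sum_tridiagonal:
  fixes T :: "nat \<Rightarrow> nat \<Rightarrow> real"
  assumes "1 \<le> L"
    and "\<And>k k'. k \<in> {1..L} \<Longrightarrow> k' \<in> {1..L} \<Longrightarrow> k \<noteq> k' \<Longrightarrow> k' \<noteq> k + 1 \<Longrightarrow> k \<noteq> k' + 1 \<Longrightarrow> T k k' = 0"
  shows "(\<Sum>k\<in>{1..L}. \<Sum>k'\<in>{1..L}. T k k')
    = (\<Sum>k\<in>{1..L}. T k k) + (\<Sum>k\<in>{1..<L}. T k (k + 1) + T (k + 1) k)"
  using assms
proof (induction L rule: dec_induct)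
  case base
  then show ?case by simp
next
  case (step L)
  have off: "T k k' = 0" if "k \<in> {1..Suc L}" "k' \<in> {1..Suc L}" "k \<noteq> k'" "k' \<noteq> k + 1" "k \<noteq> k' + 1" for k k'
    using step.prems that by blast
  have "(\<Sum>k\<in>{1..L}. T k (Suc L)) = (\<Sum>k\<in>{L}. T k (Suc L))"
    by (rule sum.mono_neutral_right) (use step.hyps off in auto)
  moreover have "(\<Sum>k\<in>{1..L}. T (Suc L) k) = (\<Sum>k\<in>{L}. T (Suc L) k)"
    by (rule sum.mono_neutral_right) (use step.hyps off in auto)
  moreover have "(\<Sum>k\<in>{1..L}. \<Sum>k'\<in>{1..L}. T k k')
      = (\<Sum>k\<in>{1..L}. T k k) + (\<Sum>k\<in>{1..<L}. T k (k + 1) + T (k + 1) k)"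
    by (rule step.IH) (use off in auto)
  moreover have "(\<Sum>k\<in>{1..<Suc L}. F k) = (\<Sum>k\<in>{1..<L}. F k) + F L" for F :: "nat \<Rightarrow> real"
    using step.hyps by simp
  ultimately show ?case using step.hyps(1) by (simp add: sum.distrib)
qed

lemma sum_layers_first:
  fixes f :: "nat \<Rightarrow> real"
  shows "1 \<le> L \<Longrightarrow> (\<Sum>k\<in>{1..L}. f k) = f 1 + (\<Sum>k\<in>{1..<L}. f (k + 1))"
  by (induction L rule: dec_induct) auto

lemma sum_layers_last:
  fixes f :: "nat \<Rightarrow> real"
  shows "1 \<le> L \<Longrightarrow> (\<Sum>k\<in>{1..L}. f k) = (\<Sum>k\<in>{1..<L}. f k) + f L"
  by (induction L rule: dec_induct) auto

lemma slack_entries: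
  assumes "1 \<le> k" "k \<le> layers P" "i < width P k"
  shows "slack P m $$ (0, ix P k i) = slack_vec P m k $ i / 2"
    "slack P m $$ (ix P k i, 0) = slack_vec P m k $ i / 2"
    "1 \<le> k' \<Longrightarrow> k' \<le> layers P \<Longrightarrow> i' < width P k' \<Longrightarrow>
      slack P m $$ (ix P k i, ix P k' i') = slack_blk P m k k' $$ (i, i') / 2"
  using assms by (auto simp: slack_def ix_less layer_of_ix coord_of_ix)

lemma slack_blk_entries:
  assumes wf: "wf_data P" and m: "wf_mult P m" and k: "k \<in> {1..<layers P}"
  shows "i < width P 1 \<Longrightarrow> i' < width P 1 \<Longrightarrow> slack_blk P m 1 1 $$ (i, i') = (if i = i' then 2 * y0 m else 0)"
    "i < width P (k + 1) \<Longrightarrow> i' < width P (k + 1) \<Longrightarrow>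
      slack_blk P m (k + 1) (k + 1) $$ (i, i') = (if i = i' then 2 * zk m k $ i else 0)"
    "i < width P k \<Longrightarrow> i' < width P (k + 1) \<Longrightarrow>
      slack_blk P m k (k + 1) $$ (i, i') = - (weight P k $$ (i', i) * zk m k $ i')"
    "i < width P (k + 1) \<Longrightarrow> i' < width P k \<Longrightarrow>
      slack_blk P m (k + 1) k $$ (i, i') = - (weight P k $$ (i, i') * zk m k $ i)"
proof -
  have W: "weight P k \<in> carrier_mat (width P (k + 1)) (width P k)"
    using wf k by (auto simp: wf_data_def)
  have z: "dim_vec (zk m k) = width P (k + 1)" using m k by (auto simp: wf_mult_def)
  have D: "vec_diag (zk m k) \<in> carrier_mat (width P (k + 1)) (width P (k + 1))"
    using z by (simp add: vec_diag_def)
  have De: "vec_diag (zk m k) $$ (i, i') = (if i = i' then zk m k $ i else 0)"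
    if "i < width P (k + 1)" "i' < width P (k + 1)" for i i'
    using z that by (simp add: vec_diag_def mat_diag_def)
  have prod: "(transpose_mat (weight P k) * vec_diag (zk m k)) $$ (i, i') = weight P k $$ (i', i) * zk m k $ i'"
    if "i < width P k" "i' < width P (k + 1)" for i i'
  proof -
    have "(transpose_mat (weight P k) * vec_diag (zk m k)) $$ (i, i')
        = (\<Sum>j<width P (k + 1). weight P k $$ (j, i) * vec_diag (zk m k) $$ (j, i'))"
      using W D that by (simp add: scalar_prod_def atLeast0LessThan)
    also have "\<dots> = (\<Sum>j<width P (k + 1). if j = i' then weight P k $$ (j, i) * zk m k $ j else 0)"
      by (rule sum.cong) (use that De in auto)
    also have "\<dots> = weight P k $$ (i', i) * zk m k $ i'" using that by (simp del: sum.lessThan_Suc)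
    finally show ?thesis .
  qed
  show "slack_blk P m 1 1 $$ (i, i') = (if i = i' then 2 * y0 m else 0)" if "i < width P 1" "i' < width P 1"
    using that by (simp add: slack_blk_def)
  show "slack_blk P m (k + 1) (k + 1) $$ (i, i') = (if i = i' then 2 * zk m k $ i else 0)"
    if "i < width P (k + 1)" "i' < width P (k + 1)"
    using that k D De[of i i'] by (simp add: slack_blk_def)
  show "slack_blk P m k (k + 1) $$ (i, i') = - (weight P k $$ (i', i) * zk m k $ i')"
    if "i < width P k" "i' < width P (k + 1)"
    using that W D prod[OF that] by (simp add: slack_blk_def del: index_mult_mat(1))
  show "slack_blk P m (k + 1) k $$ (i, i') = - (weight P k $$ (i, i') * zk m k $ i)"
    if "i < width P (k + 1)" "i' < width P k"
    using that W D prod[of i' i] by (simp add: slack_blk_def del: index_mult_mat(1))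
qed

lemma slack_blk_off:
  "k \<noteq> k' \<Longrightarrow> k' \<noteq> k + 1 \<Longrightarrow> k \<noteq> k' + 1 \<Longrightarrow> i < width P k \<Longrightarrow> i' < width P k' \<Longrightarrow>
    slack_blk P m k k' $$ (i, i') = 0"
  by (simp add: slack_blk_def)

lemma slack_vec_entries:
  assumes wf: "wf_data P" and m: "wf_mult P m" and k: "1 \<le> k" "k \<le> layers P" and i: "i < width P k"
  shows "slack_vec P m k $ i
    = (if k < layers P then \<Sum>j<width P (k + 1). weight P k $$ (j, i) * y2 m k $ j else wlast P $ i)
      + (if k = 1 then - (2 * y0 m * center P $ i)
         else - (zk m (k - 1) $ i * bias P (k - 1) $ i + y1 m (k - 1) $ i + y2 m (k - 1) $ i))"
proof -
  have L: "2 \<le> layers P" and c: "center P \<in> carrier_vec (width P 1)" and w: "wlast P \<in> carrier_vec (width P (layers P))"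
    using wf by (auto simp: wf_data_def)
  have Wy: "(transpose_mat (weight P k) *\<^sub>v y2 m k) $ i = (\<Sum>j<width P (k + 1). weight P k $$ (j, i) * y2 m k $ j)"
    "dim_vec (transpose_mat (weight P k) *\<^sub>v y2 m k) = width P k" if "k < layers P"
  proof -
    have "weight P k \<in> carrier_mat (width P (k + 1)) (width P k)" "y2 m k \<in> carrier_vec (width P (k + 1))"
      using wf m k that by (auto simp: wf_data_def wf_mult_def)
    then show "(transpose_mat (weight P k) *\<^sub>v y2 m k) $ i = (\<Sum>j<width P (k + 1). weight P k $$ (j, i) * y2 m k $ j)"
      "dim_vec (transpose_mat (weight P k) *\<^sub>v y2 m k) = width P k"
      using i by (simp_all add: scalar_prod_def atLeast0LessThan)
  qed
  show ?thesis
  proof (cases "k = 1")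
    case True
    then show ?thesis using L c i Wy by (simp add: slack_vec_def)
  next
    case False
    define k1 where "k1 = k - 1"
    have k1: "k1 \<in> {1..<layers P}" "k1 + 1 = k" "k - 1 = k1" using k False by (auto simp: k1_def)
    have y: "y1 m k1 \<in> carrier_vec (width P k)" "y2 m k1 \<in> carrier_vec (width P k)"
      "zk m k1 \<in> carrier_vec (width P k)" "bias P k1 \<in> carrier_vec (width P k)"
      using wf m k1(1) unfolding k1(2)[symmetric] by (auto simp: wf_data_def wf_mult_def)
    have "(vec_diag (zk m k1) *\<^sub>v bias P k1) $ i = zk m k1 $ i * bias P k1 $ i"
    proof -
      have "(vec_diag (zk m k1) *\<^sub>v bias P k1) $ i = (\<Sum>j<width P k. vec_diag (zk m k1) $$ (i, j) * bias P k1 $ j)"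
        using y i by (simp add: scalar_prod_def atLeast0LessThan vec_diag_def mat_diag_def)
      also have "\<dots> = (\<Sum>j<width P k. if j = i then zk m k1 $ j * bias P k1 $ j else 0)"
        by (rule sum.cong) (use y i in \<open>auto simp: vec_diag_def mat_diag_def\<close>)
      also have "\<dots> = zk m k1 $ i * bias P k1 $ i" using i by simp
      finally show ?thesis .
    qed
    moreover have "dim_vec (vec_diag (zk m k1) *\<^sub>v bias P k1) = width P k" using y by (simp add: vec_diag_def mat_diag_def)
    ultimately show ?thesis
      using False k i y w Wy unfolding slack_vec_def k1(3)
      by (cases "k < layers P") (auto simp del: index_mult_mat_vec)
  qed
qed

lemma slack_symmetric:
  assumes wf: "wf_data P" and m: "wf_mult P m" and ab: "a < Suc (ntotal P)" "b < Suc (ntotal P)"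
  shows "slack P m $$ (a, b) = slack P m $$ (b, a)"
proof (cases "a = 0 \<or> b = 0")
  case True
  then show ?thesis using ab by (auto simp: slack_def)
next
  case False
  obtain k i where ki: "1 \<le> k" "k \<le> layers P" "i < width P k" "a = ix P k i"
    using ix_cases[OF ab(1)] False by blast
  obtain k' i' where ki': "1 \<le> k'" "k' \<le> layers P" "i' < width P k'" "b = ix P k' i'"
    using ix_cases[OF ab(2)] False by blast
  have "slack_blk P m k k' $$ (i, i') = slack_blk P m k' k $$ (i', i)"
  proof -
    consider "k = k'" | "k' = k + 1" | "k = k' + 1" | "k \<noteq> k'" "k' \<noteq> k + 1" "k \<noteq> k' + 1" by blast
    then show ?thesis
    proof cases
      case 1
      show ?thesis
      proof (cases "k = 1")
        case True
        then show ?thesis using 1 ki ki' by (auto simp: slack_blk_def)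
      next
        case False
        have n: "k = (k - 1) + 1" "k - 1 \<in> {1..<layers P}" using ki False by auto
        show ?thesis
          using slack_blk_entries(2)[OF wf m n(2), folded n(1), of i i'] slack_blk_entries(2)[OF wf m n(2), folded n(1), of i' i]
            1 ki ki' by auto
      qed
    next
      case 2
      then have "k \<in> {1..<layers P}" using ki ki' by auto
      then show ?thesis using slack_blk_entries(3,4)[OF wf m] 2 ki ki' by simp
    next
      case 3
      then have "k' \<in> {1..<layers P}" using ki ki' by auto
      then show ?thesis using slack_blk_entries(3,4)[OF wf m] 3 ki ki' by simp
    next
      case 4
      then show ?thesis using slack_blk_off[of k k' i P i' m] slack_blk_off[of k' k i' P i m] ki ki' by simp
    qed
  qed
  then show ?thesis using ki ki' by (simp add: slack_entries)
qed

text \<open>Identifies the slack matrix as the coefficient matrix of the Lagrangian under the trace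
  pairing. Each off-diagonal coefficient is split evenly between two mirror entries, so the identity
  is stated for symmetric \<open>X\<close>.\<close>

lemma slack_form:
  assumes wf: "wf_data P" and m: "wf_mult P m"
    and sym: "\<And>a b. a < Suc (ntotal P) \<Longrightarrow> b < Suc (ntotal P) \<Longrightarrow> X a b = X b a"
  shows "(\<Sum>a<Suc (ntotal P). \<Sum>b<Suc (ntotal P). slack P m $$ (a, b) * X a b)
    = lagrangian_form P 1 (ineq_mult m) (eq_mult m) X"
proof -
  define L where "L = layers P"
  have L: "2 \<le> L" using wf by (simp add: L_def wf_data_def)
  define s where "s k i = slack_vec P m k $ i" for k i
  define T where "T k k' = (\<Sum>i<width P k. \<Sum>i'<width P k'. slack_blk P m k k' $$ (i, i') * X (ix P k i) (ix P k' i'))" for k k'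
  define lin where "lin k = (\<Sum>i<width P k. s k i * X (ix P k i) 0)" for k
  have symix: "k' \<in> {1..L} \<Longrightarrow> i' < width P k' \<Longrightarrow> X (ix P k i) (ix P k' i') = X (ix P k' i') (ix P k i)"
    "X 0 (ix P k i) = X (ix P k i) 0"
    if "k \<in> {1..L}" "i < width P k" for k i k' i'
    using that by (auto intro!: sym ix_less simp: L_def)
  have row0: "(\<Sum>b<Suc (ntotal P). slack P m $$ (0, b) * X 0 b) = (slack_corner P m * X 0 0 + (\<Sum>k\<in>{1..L}. lin k)) / 2"
  proof -
    have "(\<Sum>i<width P k. slack P m $$ (0, ix P k i) * X 0 (ix P k i)) = lin k / 2" if k: "k \<in> {1..L}" for k
      unfolding lin_def sum_divide_distrib
      by (rule sum.cong) (use k symix(2)[OF k] in \<open>auto simp: slack_entries s_def L_def\<close>)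
    then have "(\<Sum>k\<in>{1..L}. \<Sum>i<width P k. slack P m $$ (0, ix P k i) * X 0 (ix P k i)) = (\<Sum>k\<in>{1..L}. lin k / 2)"
      by (rule sum.cong[OF refl])
    moreover have "slack P m $$ (0, 0) = slack_corner P m / 2" by (simp add: slack_def)
    ultimately show ?thesis
      unfolding sum_ix L_def[symmetric] by (simp add: sum_divide_distrib add_divide_distrib)
  qed
  have row: "(\<Sum>b<Suc (ntotal P). slack P m $$ (ix P k i, b) * X (ix P k i) b)
      = (s k i * X (ix P k i) 0 + (\<Sum>k'\<in>{1..L}. \<Sum>i'<width P k'. slack_blk P m k k' $$ (i, i') * X (ix P k i) (ix P k' i'))) / 2"
    if "k \<in> {1..L}" "i < width P k" for k i
  proof -
    have "(\<Sum>i'<width P k'. slack P m $$ (ix P k i, ix P k' i') * X (ix P k i) (ix P k' i'))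
        = (\<Sum>i'<width P k'. slack_blk P m k k' $$ (i, i') * X (ix P k i) (ix P k' i')) / 2" if "k' \<in> {1..L}" for k'
      unfolding sum_divide_distrib
      by (rule sum.cong) (use that \<open>k \<in> {1..L}\<close> \<open>i < width P k\<close> in \<open>auto simp: slack_entries L_def\<close>)
    then show ?thesis
      unfolding sum_ix L_def[symmetric] using that
      by (simp add: slack_entries(2) s_def L_def sum_divide_distrib add_divide_distrib)
  qed
  have "(\<Sum>a<Suc (ntotal P). \<Sum>b<Suc (ntotal P). slack P m $$ (a, b) * X a b)
      = (slack_corner P m * X 0 0 + (\<Sum>k\<in>{1..L}. lin k)) / 2
        + (\<Sum>k\<in>{1..L}. \<Sum>i<width P k. (s k i * X (ix P k i) 0
           + (\<Sum>k'\<in>{1..L}. \<Sum>i'<width P k'. slack_blk P m k k' $$ (i, i') * X (ix P k i) (ix P k' i'))) / 2)"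
  proof -
    define H where "H a = (\<Sum>b<Suc (ntotal P). slack P m $$ (a, b) * X a b)" for a
    have "(\<Sum>a<Suc (ntotal P). H a) = H 0 + (\<Sum>k\<in>{1..L}. \<Sum>i<width P k. H (ix P k i))"
      unfolding sum_ix L_def ..
    also have "(\<Sum>k\<in>{1..L}. \<Sum>i<width P k. H (ix P k i)) = (\<Sum>k\<in>{1..L}. \<Sum>i<width P k. (s k i * X (ix P k i) 0
           + (\<Sum>k'\<in>{1..L}. \<Sum>i'<width P k'. slack_blk P m k k' $$ (i, i') * X (ix P k i) (ix P k' i'))) / 2)"
      by (intro sum.cong refl) (simp only: H_def row lessThan_iff)
    finally show ?thesis unfolding H_def row0 .
  qed
  \<comment> \<open>Border row and border column each carry half of \<open>slack_vec\<close>, so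
    together they count \<open>lin\<close> once.\<close>
  also have "\<dots> = slack_corner P m * X 0 0 / 2 + (\<Sum>k\<in>{1..L}. lin k)
        + (\<Sum>k\<in>{1..L}. \<Sum>k'\<in>{1..L}. T k k') / 2"
  proof -
    have "(\<Sum>i<width P k. \<Sum>k'\<in>{1..L}. \<Sum>i'<width P k'. slack_blk P m k k' $$ (i, i') * X (ix P k i) (ix P k' i'))
        = (\<Sum>k'\<in>{1..L}. T k k')" for k
      unfolding T_def by (rule sum.swap)
    then show ?thesis
      by (simp add: lin_def sum.distrib sum_divide_distrib[symmetric] add_divide_distrib)
  qed
  also have "(\<Sum>k\<in>{1..L}. \<Sum>k'\<in>{1..L}. T k k')
      = T 1 1 + (\<Sum>k\<in>{1..<L}. T (k + 1) (k + 1)) + (\<Sum>k\<in>{1..<L}. 2 * T k (k + 1))"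
  proof -
    have "(\<Sum>k\<in>{1..L}. \<Sum>k'\<in>{1..L}. T k k') = (\<Sum>k\<in>{1..L}. T k k) + (\<Sum>k\<in>{1..<L}. T k (k + 1) + T (k + 1) k)"
      by (rule sum_tridiagonal) (use L in \<open>auto simp: T_def slack_blk_off intro!: sum.neutral\<close>)
    moreover have "T (k + 1) k = T k (k + 1)" if k: "k \<in> {1..<L}" for k
    proof -
      have "T (k + 1) k = (\<Sum>i'<width P k. \<Sum>i<width P (k + 1). slack_blk P m (k + 1) k $$ (i, i') * X (ix P (k + 1) i) (ix P k i'))"
        unfolding T_def by (rule sum.swap)
      also have "\<dots> = T k (k + 1)"
        unfolding T_def
      proof (intro sum.cong refl)
        fix i' i assume ii: "i' \<in> {..<width P k}" "i \<in> {..<width P (k + 1)}"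
        have "X (ix P (k + 1) i) (ix P k i') = X (ix P k i') (ix P (k + 1) i)"
          by (rule symix(1)) (use k ii in auto)
        then show "slack_blk P m (k + 1) k $$ (i, i') * X (ix P (k + 1) i) (ix P k i')
            = slack_blk P m k (k + 1) $$ (i', i) * X (ix P k i') (ix P (k + 1) i)"
          using slack_blk_entries(3,4)[OF wf m] k ii by (simp add: L_def)
      qed
      finally show ?thesis .
    qed
    moreover have "(\<Sum>k\<in>{1..L}. T k k) = T 1 1 + (\<Sum>k\<in>{1..<L}. T (k + 1) (k + 1))"
      using L by (intro sum_layers_first) simp
    ultimately show ?thesis by (simp add: sum_distrib_left)
  qed
  finally have lhs: "(\<Sum>a<Suc (ntotal P). \<Sum>b<Suc (ntotal P). slack P m $$ (a, b) * X a b)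
      = slack_corner P m * X 0 0 / 2 + (\<Sum>k\<in>{1..L}. lin k)
        + (T 1 1 + (\<Sum>k\<in>{1..<L}. T (k + 1) (k + 1)) + (\<Sum>k\<in>{1..<L}. 2 * T k (k + 1))) / 2" .
  \<comment> \<open>An interior border block mixes the multipliers of constraints \<open>k\<close>
    and \<open>k - 1\<close>. \<open>up\<close> and \<open>dn\<close> regroup these terms by
    constraint; the first layer leaves over the center, the last one the objective.\<close>
  define up where "up k = (\<Sum>i<width P k. (\<Sum>j<width P (k + 1). weight P k $$ (j, i) * y2 m k $ j) * X (ix P k i) 0)" for k
  define dn where "dn k = (\<Sum>i<width P (k + 1). - (zk m k $ i * bias P k $ i + y1 m k $ i + y2 m k $ i) * X (ix P (k + 1) i) 0)" for k
  have lin: "(\<Sum>k\<in>{1..L}. lin k) = (\<Sum>k\<in>{1..<L}. up k) + obj_form P X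
      + (- 2 * y0 m * (\<Sum>i<width P 1. center P $ i * X (ix P 1 i) 0) + (\<Sum>k\<in>{1..<L}. dn k))"
  proof -
    define A where "A k = (\<Sum>i<width P k. (if k < L then \<Sum>j<width P (k + 1). weight P k $$ (j, i) * y2 m k $ j else wlast P $ i) * X (ix P k i) 0)" for k
    define B where "B k = (\<Sum>i<width P k. (if k = 1 then - (2 * y0 m * center P $ i)
         else - (zk m (k - 1) $ i * bias P (k - 1) $ i + y1 m (k - 1) $ i + y2 m (k - 1) $ i)) * X (ix P k i) 0)" for k
    have "lin k = A k + B k" if "k \<in> {1..L}" for k
      unfolding lin_def A_def B_def sum.distrib[symmetric] distrib_right[symmetric] s_def
      by (rule sum.cong) (use slack_vec_entries[OF wf m] that in \<open>auto simp: L_def\<close>)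
    then have "(\<Sum>k\<in>{1..L}. lin k) = (\<Sum>k\<in>{1..L}. A k) + (\<Sum>k\<in>{1..L}. B k)" by (simp add: sum.distrib)
    also have "(\<Sum>k\<in>{1..L}. A k) = (\<Sum>k\<in>{1..<L}. up k) + obj_form P X"
    proof -
      have "A L = obj_form P X" by (simp add: A_def obj_form_def L_def)
      moreover have "A k = up k" if "k \<in> {1..<L}" for k using that by (simp add: A_def up_def)
      ultimately show ?thesis using sum_layers_last[of L A] L by simp
    qed
    also have "(\<Sum>k\<in>{1..L}. B k) = - 2 * y0 m * (\<Sum>i<width P 1. center P $ i * X (ix P 1 i) 0) + (\<Sum>k\<in>{1..<L}. dn k)"
    proof -
      have "B 1 = - 2 * y0 m * (\<Sum>i<width P 1. center P $ i * X (ix P 1 i) 0)"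
        by (simp add: B_def sum_distrib_left mult.assoc)
      moreover have "B (k + 1) = dn k" if "k \<in> {1..<L}" for k using that by (simp add: B_def dn_def)
      ultimately show ?thesis using sum_layers_first[of L B] L by simp
    qed
    finally show ?thesis .
  qed
  have T1: "T 1 1 = 2 * y0 m * (\<Sum>i<width P 1. X (ix P 1 i) (ix P 1 i))"
  proof -
    have "T 1 1 = (\<Sum>i<width P 1. \<Sum>i'<width P 1. if i' = i then 2 * y0 m * X (ix P 1 i) (ix P 1 i') else 0)"
      unfolding T_def by (intro sum.cong refl) (use L in \<open>auto simp: slack_blk_def\<close>)
    then show ?thesis by (simp add: sum_distrib_left)
  qed
  \<comment> \<open>All terms with multipliers of index \<open>k\<close>. The off-diagonal block
    appears undivided because it stands for itself and its transpose.\<close>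
  have unit: "up k + dn k + T (k + 1) (k + 1) / 2 + T k (k + 1) + (bias P k \<bullet> y2 m k) * X 0 0
      = (\<Sum>i<width P (k + 1). y1 m k $ i * ineq_form P (Unit1 k i) X + y2 m k $ i * ineq_form P (Unit2 k i) X)
        + (\<Sum>i<width P (k + 1). zk m k $ i * eq_form P (Unit1 k i) X)" if k: "k \<in> {1..<L}" for k
  proof -
    have k': "k \<in> {1..<layers P}" using k by (simp add: L_def)
    let ?n = "width P (k + 1)"
    have b: "bias P k \<bullet> y2 m k = (\<Sum>i<?n. bias P k $ i * y2 m k $ i)"
    proof -
      have "dim_vec (y2 m k) = ?n" using m k' by (auto simp: wf_mult_def)
      then show ?thesis by (simp add: scalar_prod_def atLeast0LessThan)
    qed
    have u: "up k = (\<Sum>i<?n. y2 m k $ i * (\<Sum>j<width P k. weight P k $$ (i, j) * X (ix P k j) 0))"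
      unfolding up_def sum_distrib_left sum_distrib_right by (subst sum.swap) (simp add: mult_ac)
    have d: "T (k + 1) (k + 1) / 2 = (\<Sum>i<?n. zk m k $ i * X (ix P (k + 1) i) (ix P (k + 1) i))"
    proof -
      have "T (k + 1) (k + 1) = (\<Sum>i<?n. \<Sum>i'<?n. if i' = i then 2 * zk m k $ i * X (ix P (k + 1) i) (ix P (k + 1) i') else 0)"
        unfolding T_def by (intro sum.cong refl) (use slack_blk_entries(2)[OF wf m k'] in auto)
      then show ?thesis by (simp add: sum_divide_distrib)
    qed
    have o: "T k (k + 1) = - (\<Sum>i<?n. zk m k $ i * (\<Sum>j<width P k. weight P k $$ (i, j) * X (ix P k j) (ix P (k + 1) i)))"
    proof -
      have "T k (k + 1) = (\<Sum>j<width P k. \<Sum>i<?n. - (zk m k $ i * (weight P k $$ (i, j) * X (ix P k j) (ix P (k + 1) i))))"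
        unfolding T_def by (intro sum.cong refl) (use slack_blk_entries(3)[OF wf m k'] in auto)
      also have "\<dots> = (\<Sum>i<?n. \<Sum>j<width P k. - (zk m k $ i * (weight P k $$ (i, j) * X (ix P k j) (ix P (k + 1) i))))"
        by (rule sum.swap)
      finally show ?thesis by (simp add: sum_negf sum_distrib_left)
    qed
    show ?thesis
      unfolding u d o b dn_def ineq_form.simps eq_form.simps
      unfolding sum_distrib_right[of _ _ "X 0 0"] sum_negf[symmetric] sum.distrib[symmetric]
      by (intro sum.cong refl) (simp add: algebra_simps)
  qed
  have corner: "slack_corner P m * X 0 0 / 2 = y0 m * ((vnorm (center P))\<^sup>2 - (radius P)\<^sup>2) * X 0 0
      + (\<Sum>k\<in>{1..<L}. (bias P k \<bullet> y2 m k) * X 0 0) - z0 m * X 0 0"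
    unfolding slack_corner_def L_def sum_distrib_right[symmetric] by (simp add: field_simps)
  have rhs: "lagrangian_form P 1 (ineq_mult m) (eq_mult m) X
      = obj_form P X + (y0 m * ineq_form P Corner X
         + (\<Sum>k\<in>{1..<L}. \<Sum>i<width P (k + 1). y1 m k $ i * ineq_form P (Unit1 k i) X + y2 m k $ i * ineq_form P (Unit2 k i) X))
       + (z0 m * eq_form P Corner X + (\<Sum>k\<in>{1..<L}. \<Sum>i<width P (k + 1). zk m k $ i * eq_form P (Unit1 k i) X))"
    by (simp only: lagrangian_form_def sum_ineqs sum_eqs ineq_mult_def eq_mult_def unstack.simps L_def mult_1)
  define R where "R k = (\<Sum>i<width P (k + 1). y1 m k $ i * ineq_form P (Unit1 k i) X + y2 m k $ i * ineq_form P (Unit2 k i) X)" for k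
  define E where "E k = (\<Sum>i<width P (k + 1). zk m k $ i * eq_form P (Unit1 k i) X)" for k
  have "(\<Sum>k\<in>{1..<L}. R k) + (\<Sum>k\<in>{1..<L}. E k)
      = (\<Sum>k\<in>{1..<L}. up k + dn k + T (k + 1) (k + 1) / 2 + T k (k + 1) + (bias P k \<bullet> y2 m k) * X 0 0)"
    unfolding sum.distrib[of R E, symmetric] by (rule sum.cong[OF refl]) (simp only: R_def E_def unit)
  then have units: "(\<Sum>k\<in>{1..<L}. R k) + (\<Sum>k\<in>{1..<L}. E k)
      = (\<Sum>k\<in>{1..<L}. up k) + (\<Sum>k\<in>{1..<L}. dn k) + (\<Sum>k\<in>{1..<L}. T (k + 1) (k + 1)) / 2
        + (\<Sum>k\<in>{1..<L}. T k (k + 1)) + (\<Sum>k\<in>{1..<L}. (bias P k \<bullet> y2 m k) * X 0 0)"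
    by (simp only: sum.distrib sum_divide_distrib)
  show ?thesis
    unfolding lhs rhs R_def[symmetric] E_def[symmetric] lin T1 corner ineq_form.simps(1) eq_form.simps(1)
    using units by (simp add: sum_distrib_left[symmetric] add_divide_distrib algebra_simps)
qed

section \<open>Optimality\<close>

lemma psd_fun_comb:
  assumes "psd_fun N X" "psd_fun N Y" "0 \<le> s" "0 \<le> t"
  shows "psd_fun N (\<lambda>a b. s * X a b + t * Y a b)"
proof -
  have "bilin N (\<lambda>a b. s * X a b + t * Y a b) w w = s * bilin N X w w + t * bilin N Y w w" for w
    by (simp add: bilin_def sum_distrib_left sum.distrib algebra_simps)
  then show ?thesis using assms by (auto simp: psd_fun_def)
qed

lemma psd_fun_cong:
  assumes "\<And>a b. a < N \<Longrightarrow> b < N \<Longrightarrow> X a b = Y a b"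
  shows "psd_fun N X \<longleftrightarrow> psd_fun N Y"
proof -
  have "bilin N X w w = bilin N Y w w" for w
    using assms by (simp add: bilin_def)
  then show ?thesis using assms by (auto simp: psd_fun_def)
qed

text \<open>Since \<open>X 0 0 = 1\<close>, index 0 is the first pivot, and the Cholesky vectors
  form a U with border row \<open>(u_0, 0)\<close>, as the flat encoding requires. The number of
  vectors is at most the rank.\<close>

lemma psd_factorization:
  assumes r: "1 \<le> r" and X: "psd_fun (Suc (ntotal P)) X" "X 0 0 = 1"
    and rank: "vec_space.rank (Suc (ntotal P)) (mat (Suc (ntotal P)) (Suc (ntotal P)) (\<lambda>(a, b). X a b)) \<le> r"
  shows "\<exists>x\<in>carrier_vec (bm_dim P r). \<forall>a<Suc (ntotal P). \<forall>b<Suc (ntotal P). gram r (factor P r x) a b = X a b"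
proof -
  define N where "N = Suc (ntotal P)"
  obtain I v where I: "I \<subseteq> {0..<N}" "\<forall>a<N. \<forall>b<N. X a b = (\<Sum>j<card I. v j a * v j b)"
      "columns_independent N X I" "0 < N \<longrightarrow> 0 < X 0 0 \<longrightarrow> I \<noteq> {} \<and> (\<forall>j. 0 < j \<longrightarrow> j < card I \<longrightarrow> v j 0 = (0 :: real))"
    using pivoted_cholesky[OF X(1)[folded N_def] le0] not_less0 by blast
  have "columns_independent N (entries (mat N N (\<lambda>(a, b). X a b))) I"
    using I(3) unfolding columns_independent_def by simp
  then have "card I \<le> vec_space.rank N (mat N N (\<lambda>(a, b). X a b))"
    by (intro independent_columns_le_rank) (use I(1) in auto)
  then have card: "card I \<le> r" using rank by (simp add: N_def)
  \<comment> \<open>Zero columns pad the factor to exactly \<open>r\<close> columns.\<close>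
  define M where "M a j = (if j < card I then v j a else 0)" for a j
  obtain x where x: "x \<in> carrier_vec (bm_dim P r)" "\<forall>(a, j)\<in>free_entries P r. factor P r x a j = M a j"
    using factor_surj[OF r] by blast
  have fM: "factor P r x a j = M a j" if "a < N" "j < r" for a j
  proof (cases "a = 0 \<and> j \<noteq> 0")
    case True
    then show ?thesis using I(4) X(2) by (auto simp: factor_def M_def N_def)
  next
    case False
    then have "(a, j) \<in> free_entries P r" using that by (auto simp: free_entries_def N_def)
    then show ?thesis using x(2) by blast
  qed
  have "gram r (factor P r x) a b = X a b" if "a < N" "b < N" for a b
  proof -
    have "gram r (factor P r x) a b = (\<Sum>j<r. M a j * M b j)" using that fM by (simp add: gram_def)
    also have "\<dots> = (\<Sum>j<card I. v j a * v j b)"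
      by (rule sum.mono_neutral_cong_right) (use card in \<open>auto simp: M_def\<close>)
    finally show ?thesis using I(2) that by simp
  qed
  then show ?thesis using x(1) unfolding N_def by blast
qed

lemma constraints_hold_cong:
  assumes wf: "wf_data P" and eq: "\<And>a b. a < Suc (ntotal P) \<Longrightarrow> b < Suc (ntotal P) \<Longrightarrow> X a b = Y a b"
  shows "constraints_hold P X \<longleftrightarrow> constraints_hold P Y"
proof -
  have "ineq_form P l X = ineq_form P l Y" if "l \<in> set (ineqs P)" for l
    by (rule lin_form_D(3)[OF lin_form_ineq[OF wf that] eq])
  moreover have "eq_form P l X = eq_form P l Y" if "l \<in> set (eqs P)" for l
    by (rule lin_form_D(3)[OF lin_form_eq[OF that] eq])
  ultimately show ?thesis by (simp add: constraints_hold_def)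
qed

lemma lin_form_comb:
  "lin_form N F \<Longrightarrow> F (\<lambda>a b. s * X a b + t * Y a b) = s * F X + t * F Y"
  using lin_form_D(1)[of N F "\<lambda>a b. s * X a b" "\<lambda>a b. t * Y a b"] lin_form_D(2)[of N F] by simp

lemma constraints_hold_comb:
  assumes wf: "wf_data P" and XY: "constraints_hold P X" "constraints_hold P Y" and t: "0 < t" "t < 1"
  shows "constraints_hold P (\<lambda>a b. (1 - t) * X a b + t * Y a b)"
proof -
  have "ineq_form P l (\<lambda>a b. (1 - t) * X a b + t * Y a b) \<le> 0" if l: "l \<in> set (ineqs P)" for l
  proof -
    have "(1 - t) * ineq_form P l X \<le> 0" "t * ineq_form P l Y \<le> 0"
      using XY l t by (auto simp: constraints_hold_def mult_le_0_iff)
    then show ?thesis by (simp add: lin_form_comb[OF lin_form_ineq[OF wf l]])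
  qed
  moreover have "eq_const l + eq_form P l (\<lambda>a b. (1 - t) * X a b + t * Y a b) = 0" if l: "l \<in> set (eqs P)" for l
  proof -
    have "eq_form P l X = - eq_const l" "eq_form P l Y = - eq_const l"
      using XY l by (auto simp: constraints_hold_def add_eq_0_iff)
    then show ?thesis unfolding lin_form_comb[OF lin_form_eq[OF l]] by (simp add: algebra_simps)
  qed
  ultimately show ?thesis by (simp add: constraints_hold_def)
qed

lemma sum_eq_const: "(\<Sum>l\<in>set (eqs P). z l * eq_const l) = z Corner"
  by (simp add: sum_eqs eq_const_def)

text \<open>The trace bound is inactive at \<open>Xs\<close>, so by convexity it can be dropped.\<close>

lemma sdp_optimal_without_trace_bound:
  assumes wf: "wf_data P" and Xs: "sdp_optimal P (ntotal P + 1) Xs" "mtrace Xs < (bound P)\<^sup>2"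
    and X: "psd_fun (Suc (ntotal P)) X" "constraints_hold P X"
  shows "sdp_obj P Xs \<le> obj_form P X"
proof -
  define N where "N = Suc (ntotal P)"
  let ?tr = "\<lambda>X. (\<Sum>a<N. X a a) :: real"
  have fs: "Xs \<in> carrier_mat N N" "psd_fun N (entries Xs)" "constraints_hold P (entries Xs)"
    using Xs(1) by (auto simp: sdp_optimal_def sdp_feasible_iff[OF wf] N_def)
  have tr: "?tr (entries Xs) < (bound P)\<^sup>2" using Xs(2) fs(1) by (simp add: mtrace_def)
  define d where "d = \<bar>?tr X - ?tr (entries Xs)\<bar>"
  \<comment> \<open>A step towards \<open>X\<close> so short that the trace gained stays within the
    slack at \<open>Xs\<close>. The 1 in the denominator covers \<open>d = 0\<close>, and 1/2 keeps
    \<open>t < 1\<close>.\<close>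
  define t where "t = min (1 / 2) (((bound P)\<^sup>2 - ?tr (entries Xs)) / (d + 1))"
  have t: "0 < t" "t < 1" using tr by (auto simp: t_def d_def)
  have "t * (d + 1) \<le> (bound P)\<^sup>2 - ?tr (entries Xs)"
    using tr by (simp add: t_def d_def pos_le_divide_eq[symmetric])
  moreover have "t * (?tr X - ?tr (entries Xs)) \<le> t * (d + 1)"
    using t by (intro mult_left_mono) (auto simp: d_def)
  ultimately have tb: "(1 - t) * ?tr (entries Xs) + t * ?tr X \<le> (bound P)\<^sup>2"
    by (simp add: algebra_simps)
  define Z where "Z = (\<lambda>a b. (1 - t) * entries Xs a b + t * X a b)"
  define ZM where "ZM = mat N N (\<lambda>(a, b). Z a b)"
  have ZM: "ZM $$ (a, b) = Z a b" if "a < N" "b < N" for a b using that by (simp add: ZM_def)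
  have "psd_fun N Z" unfolding Z_def using fs(2) X(1) t by (intro psd_fun_comb) (auto simp: N_def)
  moreover have "constraints_hold P Z"
    unfolding Z_def by (rule constraints_hold_comb[OF wf fs(3) X(2) t])
  moreover have "?tr Z \<le> (bound P)\<^sup>2"
    using tb by (simp add: Z_def sum.distrib sum_distrib_left)
  moreover have "vec_space.rank N ZM \<le> N"
    by (rule vec_space.rank_le_nc) (simp add: ZM_def)
  moreover have "psd_fun N (entries ZM) \<longleftrightarrow> psd_fun N Z" by (rule psd_fun_cong) (rule ZM)
  moreover have "constraints_hold P (entries ZM) \<longleftrightarrow> constraints_hold P Z"
    by (rule constraints_hold_cong[OF wf]) (simp add: ZM N_def)
  moreover have "(\<Sum>a<N. ZM $$ (a, a)) = ?tr Z" by (simp add: ZM)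
  ultimately have "sdp_feasible P (ntotal P + 1) ZM"
    unfolding sdp_feasible_iff[OF wf] by (simp add: N_def ZM_def del: sum.lessThan_Suc)
  then have "sdp_obj P Xs \<le> sdp_obj P ZM" using Xs(1) by (simp add: sdp_optimal_def)
  also have "sdp_obj P ZM = obj_form P Z"
    unfolding sdp_obj_form[OF wf] by (rule lin_form_D(3)[OF lin_form_obj[OF wf]]) (simp add: ZM N_def)
  also have "\<dots> = (1 - t) * sdp_obj P Xs + t * obj_form P X"
    unfolding Z_def sdp_obj_form[OF wf] by (rule lin_form_comb[OF lin_form_obj[OF wf]])
  finally have "t * sdp_obj P Xs \<le> t * obj_form P X" by (simp add: algebra_simps)
  then show ?thesis using t by simp
qed

text \<open>The domain is the whole semidefinite cone, with neither rank nor trace condition, so the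
  resulting inequality can be tested at 0, at multiples of U U^T and at perturbed Gram
  matrices.\<close>

lemma sdp_fritz_john:
  assumes wf: "wf_data P" and Xs: "sdp_optimal P (ntotal P + 1) Xs" "mtrace Xs < (bound P)\<^sup>2"
  shows "\<exists>c y z. 0 \<le> c \<and> (\<forall>l\<in>set (ineqs P). 0 \<le> y l) \<and>
    (c \<noteq> 0 \<or> (\<exists>l\<in>set (ineqs P). y l \<noteq> 0) \<or> (\<exists>l\<in>set (eqs P). z l \<noteq> 0)) \<and>
    (\<forall>X. psd_fun (Suc (ntotal P)) X \<longrightarrow> c * sdp_obj P Xs \<le> lagrangian_form P c y z X + z Corner)"
proof -
  define N where "N = Suc (ntotal P)"
  have zero: "psd_fun N (\<lambda>_ _. 0)" by (simp add: psd_fun_def bilin_def)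
  have "\<exists>c y z. 0 \<le> c \<and> (\<forall>l\<in>set (ineqs P). 0 \<le> y l) \<and>
    (c \<noteq> 0 \<or> (\<exists>l\<in>set (ineqs P). y l \<noteq> 0) \<or> (\<exists>l\<in>set (eqs P). z l \<noteq> 0)) \<and>
    (\<forall>X\<in>{X. psd_fun N X}. c * sdp_obj P Xs \<le> c * obj_form P X
      + (\<Sum>l\<in>set (ineqs P). y l * ineq_form P l X) + (\<Sum>l\<in>set (eqs P). z l * (eq_const l + eq_form P l X)))"
  proof (rule fritz_john_multipliers)
    show "finite (set (ineqs P))" "finite (set (eqs P))" by simp_all
    show "{X. psd_fun N X} \<noteq> {}" using zero by blast
    show "sdp_obj P Xs \<le> obj_form P X"
      if "X \<in> {X. psd_fun N X}" "\<And>l. l \<in> set (ineqs P) \<Longrightarrow> ineq_form P l X \<le> 0"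
        "\<And>l. l \<in> set (eqs P) \<Longrightarrow> eq_const l + eq_form P l X = 0" for X
      using that by (intro sdp_optimal_without_trace_bound[OF wf Xs]) (auto simp: N_def constraints_hold_def)
  next
    fix X Y and t :: real
    assume XY: "X \<in> {X. psd_fun N X}" "Y \<in> {X. psd_fun N X}" and t: "0 < t" "t < 1"
    let ?Z = "\<lambda>a b. (1 - t) * X a b + t * Y a b"
    have "?Z \<in> {X. psd_fun N X}" using XY t psd_fun_comb[of N X Y "1 - t" t] by simp
    moreover have "obj_form P ?Z = (1 - t) * obj_form P X + t * obj_form P Y"
      by (rule lin_form_comb[OF lin_form_obj[OF wf]])
    moreover have "ineq_form P l ?Z = (1 - t) * ineq_form P l X + t * ineq_form P l Y" if "l \<in> set (ineqs P)" for l
      by (rule lin_form_comb[OF lin_form_ineq[OF wf that]])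
    moreover have "eq_const l + eq_form P l ?Z = (1 - t) * (eq_const l + eq_form P l X) + t * (eq_const l + eq_form P l Y)"
      if "l \<in> set (eqs P)" for l
      unfolding lin_form_comb[OF lin_form_eq[OF that]] by (simp add: algebra_simps)
    ultimately show "\<exists>Z\<in>{X. psd_fun N X}. obj_form P Z = (1 - t) * obj_form P X + t * obj_form P Y \<and>
      (\<forall>l\<in>set (ineqs P). ineq_form P l Z = (1 - t) * ineq_form P l X + t * ineq_form P l Y) \<and>
      (\<forall>l\<in>set (eqs P). eq_const l + eq_form P l Z = (1 - t) * (eq_const l + eq_form P l X) + t * (eq_const l + eq_form P l Y))"
      by blast
  qed
  then show ?thesis
    by (simp add: lagrangian_form_def distrib_left sum.distrib sum_eq_const N_def algebra_simps)
qed

text \<open>Optimality of U U^T enters only through \<open>lb\<close>. Evaluated at U U^T, it gives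
  complementary slackness; evaluated at 0 and at twice U U^T, it encloses \<open>z Corner\<close>.
  The Lagrangian form is then nonnegative on the cone and zero at U U^T, so it is stationary there
  along all tangents.\<close>

lemma saddle_point_conditions:
  assumes wf: "wf_data P" and y: "\<And>l. l \<in> set (ineqs P) \<Longrightarrow> 0 \<le> y l"
    and lb: "\<And>X. psd_fun (Suc (ntotal P)) X \<Longrightarrow> c * obj_form P (gram r U) \<le> lagrangian_form P c y z X + z Corner"
    and U: "constraints_hold P (gram r U)"
  shows "z Corner = c * obj_form P (gram r U)"
    and "psd_fun (Suc (ntotal P)) X \<Longrightarrow> 0 \<le> lagrangian_form P c y z X"
    and "l \<in> set (ineqs P) \<Longrightarrow> y l * ineq_form P l (gram r U) = 0"
    and "a < Suc (ntotal P) \<Longrightarrow> j < r \<Longrightarrow> lagrangian_form P c y z (edge (\<lambda>b. U b j) a) = 0"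
proof -
  define N where "N = Suc (ntotal P)"
  define Q where "Q = lagrangian_form P c y z"
  define \<phi> where "\<phi> = obj_form P (gram r U)"
  define s where "s = (\<Sum>l\<in>set (ineqs P). y l * ineq_form P l (gram r U))"
  have Q: "lin_form N Q" unfolding Q_def N_def by (rule lin_form_lagrangian[OF wf])
  have G: "psd_fun N (gram r U)" by (rule psd_fun_gram)
  have s_nonpos: "y l * ineq_form P l (gram r U) \<le> 0" if "l \<in> set (ineqs P)" for l
    using y[OF that] U that by (auto simp: constraints_hold_def mult_le_0_iff)
  have "(\<Sum>l\<in>set (eqs P). z l * eq_form P l (gram r U)) = (\<Sum>l\<in>set (eqs P). - (z l * eq_const l))"
    by (rule sum.cong) (use U in \<open>auto simp: constraints_hold_def add_eq_0_iff\<close>)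
  then have QG: "Q (gram r U) = c * \<phi> + s - z Corner"
    by (simp add: Q_def lagrangian_form_def \<phi>_def s_def sum_negf sum_eq_const)
  have "s \<le> 0" unfolding s_def by (rule sum_nonpos) (rule s_nonpos)
  moreover have "0 \<le> s" using lb[OF G[unfolded N_def]] QG by (simp add: Q_def \<phi>_def)
  ultimately have s0: "s = 0" by simp
  have "c * \<phi> \<le> Q (\<lambda>a b. 0 * gram r U a b) + z Corner"
    unfolding Q_def \<phi>_def by (rule lb) (simp add: psd_fun_def bilin_def)
  then have z1: "c * \<phi> \<le> z Corner" unfolding lin_form_D(2)[OF Q] by simp
  \<comment> \<open>Since \<open>s = 0\<close>, doubling gives
    \<open>c * \<phi> \<le> 2 * (c * \<phi> - z Corner) + z Corner\<close>, the converse of the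
    bound at 0.\<close>
  have "c * \<phi> \<le> Q (\<lambda>a b. 2 * gram r U a b) + z Corner"
    unfolding Q_def \<phi>_def
    by (rule lb) (use psd_fun_comb[OF G G, of 2 0] in \<open>simp add: N_def\<close>)
  then have "z Corner \<le> c * \<phi>"
    unfolding lin_form_D(2)[OF Q] QG s0 by (simp add: mult.commute)
  with z1 have z: "z Corner = c * \<phi>" by (rule antisym[rotated])
  then show "z Corner = c * obj_form P (gram r U)" by (simp add: \<phi>_def)
  have nonneg: "0 \<le> Q X" if "psd_fun N X" for X
    using lb[of X] that z by (simp add: Q_def \<phi>_def N_def)
  then show "psd_fun (Suc (ntotal P)) X \<Longrightarrow> 0 \<le> lagrangian_form P c y z X" by (simp add: Q_def N_def)
  show "y l * ineq_form P l (gram r U) = 0" if "l \<in> set (ineqs P)"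
    using s0 sum_nonneg_eq_0_iff[of "set (ineqs P)" "\<lambda>l. - (y l * ineq_form P l (gram r U))"] s_nonpos that
    by (simp add: s_def sum_negf)
  show "lagrangian_form P c y z (edge (\<lambda>b. U b j) a) = 0" if aj: "a < Suc (ntotal P)" "j < r"
  proof -
    \<comment> \<open>The direction that changes only entry \<open>(a, j)\<close>. Perturbed Gram
      matrices stay in the cone for both signs of \<open>t\<close>, so the linear term must
      vanish.\<close>
    define E :: "nat \<Rightarrow> nat \<Rightarrow> real" where "E s m = (if s = a then if m = j then 1 else 0 else 0)" for s m
    have "(\<Sum>s<N. \<Sum>m<r. E s m * Q (edge (\<lambda>b. U b m) s))
        = (\<Sum>s<N. if s = a then (\<Sum>m<r. if m = j then Q (edge (\<lambda>b. U b m) s) else 0) else 0)"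
      by (intro sum.cong refl) (auto simp: E_def mult_delta_left)
    also have "\<dots> = Q (edge (\<lambda>b. U b j) a)" using aj by (simp add: N_def del: sum.lessThan_Suc)
    finally have "0 \<le> t * Q (edge (\<lambda>b. U b j) a) + t\<^sup>2 * Q (gram r E)" for t
      using lin_form_gram_perturb[OF Q, of r U t E] nonneg[OF psd_fun_gram, of r "\<lambda>a j. U a j + t * E a j"]
        QG s0 z by simp
    then show ?thesis using quadratic_nonneg_imp_linear_zero unfolding Q_def by blast
  qed
qed

section \<open>The smallest eigenvalue of the slack matrix\<close>

lemma lambda_min_eq_0:
  assumes S: "psd N S" and u: "u \<in> carrier_vec N" "u \<noteq> 0\<^sub>v N" "S *\<^sub>v u = 0\<^sub>v N"
  shows "lambda_min S = 0"
proof -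
  have SN: "S \<in> carrier_mat N N" using S by (simp add: psd_def)
  have "finite (spectrum S)" using card_finite_spectrum[OF SN] by simp
  moreover have "0 \<in> spectrum S"
    using u SN by (auto simp: spectrum_def eigenvalue_def eigenvector_def intro!: exI[of _ u])
  moreover have "0 \<le> e" if e: "e \<in> spectrum S" for e
  proof -
    obtain v where v: "v \<in> carrier_vec N" "v \<noteq> 0\<^sub>v N" "S *\<^sub>v v = e \<cdot>\<^sub>v v"
      using e SN by (auto simp: spectrum_def eigenvalue_def eigenvector_def)
    have "0 \<le> v \<bullet> (S *\<^sub>v v)" using S v(1) by (simp add: psd_def)
    also have "\<dots> = e * (v \<bullet> v)" using v by simp
    finally have "0 \<le> e * (v \<bullet> v)" .
    moreover have "0 < v \<bullet> v"
      using v(1,2) by (auto simp: scalar_prod_def vec_eq_iff zero_less_mult_iff neq_iff intro!: sum_pos2)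
    ultimately show ?thesis by (simp add: zero_le_mult_iff)
  qed
  ultimately show ?thesis unfolding lambda_min_def by (intro Min_eqI) auto
qed

text \<open>Nonnegativity is used at rank-one matrices, which gives semidefiniteness of the slack
  matrix; the tangents of the vector \<open>u\<close> show that \<open>u\<close> lies in its kernel,
  and \<open>u 0 \<noteq> 0\<close> makes it nonzero.\<close>

lemma lambda_min_slack_eq_0:
  assumes wf: "wf_data P" and m: "wf_mult P m"
    and nonneg: "\<And>X. psd_fun (Suc (ntotal P)) X \<Longrightarrow> 0 \<le> lagrangian_form P 1 (ineq_mult m) (eq_mult m) X"
    and u: "u 0 \<noteq> 0" "\<And>a. a < Suc (ntotal P) \<Longrightarrow> lagrangian_form P 1 (ineq_mult m) (eq_mult m) (edge u a) = 0"
  shows "lambda_min (slack P m) = 0"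
proof (rule lambda_min_eq_0)
  define N where "N = Suc (ntotal P)"
  define S where "S = slack P m"
  have SN: "S \<in> carrier_mat N N" by (simp add: S_def slack_def N_def)
  have sym: "S $$ (a, b) = S $$ (b, a)" if "a < N" "b < N" for a b
    unfolding S_def by (rule slack_symmetric[OF wf m]) (use that in \<open>simp_all add: N_def\<close>)
  have form: "(\<Sum>a<N. \<Sum>b<N. S $$ (a, b) * X a b) = lagrangian_form P 1 (ineq_mult m) (eq_mult m) X"
    if "\<And>a b. a < N \<Longrightarrow> b < N \<Longrightarrow> X a b = X b a" for X
    unfolding S_def N_def by (rule slack_form[OF wf m]) (use that in \<open>simp add: N_def\<close>)
  have "0 \<le> bilin N (entries S) w w" for w
  proof -
    have "bilin N (entries S) w w = (\<Sum>a<N. \<Sum>b<N. S $$ (a, b) * gram 1 (\<lambda>a _. w a) a b)"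
      by (simp add: bilin_def gram_def mult_ac)
    also have "\<dots> = lagrangian_form P 1 (ineq_mult m) (eq_mult m) (gram 1 (\<lambda>a _. w a))"
      by (rule form) (simp add: gram_def mult.commute)
    also have "0 \<le> \<dots>" by (rule nonneg[OF psd_fun_gram])
    finally show ?thesis .
  qed
  then show "psd N (slack P m)" using SN sym by (simp add: psd_iff_psd_fun psd_fun_def S_def)
  show "Matrix.vec N u \<in> carrier_vec N" by simp
  show "Matrix.vec N u \<noteq> 0\<^sub>v N" using u(1) by (auto simp: vec_eq_iff N_def)
  show "slack P m *\<^sub>v Matrix.vec N u = 0\<^sub>v N"
  proof (rule eq_vecI)
    show "dim_vec (slack P m *\<^sub>v Matrix.vec N u) = dim_vec (0\<^sub>v N)" using SN by (simp add: S_def)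
    fix a assume "a < dim_vec (0\<^sub>v N :: real vec)"
    then have a: "a < N" by simp
    \<comment> \<open>By symmetry, pairing with the tangent in row \<open>a\<close> gives twice
      entry \<open>a\<close> of \<open>S u\<close>.\<close>
    have "(\<Sum>b<N. \<Sum>c<N. S $$ (b, c) * edge u a b c)
        = (\<Sum>b<N. (if b = a then \<Sum>c<N. S $$ (b, c) * u c else 0) + S $$ (b, a) * u b)"
      by (intro sum.cong refl)
        (use a in \<open>auto simp: edge_def distrib_left sum.distrib mult_delta_right\<close>)
    also have "\<dots> = (\<Sum>c<N. S $$ (a, c) * u c) + (\<Sum>b<N. S $$ (b, a) * u b)"
      using a by (simp add: sum.distrib)
    also have "(\<Sum>b<N. S $$ (b, a) * u b) = (\<Sum>b<N. S $$ (a, b) * u b)"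
      by (rule sum.cong) (use a sym in auto)
    finally have "2 * (\<Sum>c<N. S $$ (a, c) * u c) = lagrangian_form P 1 (ineq_mult m) (eq_mult m) (edge u a)"
      by (subst form[symmetric]) (auto simp: edge_def)
    also have "\<dots> = 0" using u(2) a by (simp add: N_def)
    finally show "(slack P m *\<^sub>v Matrix.vec N u) $ a = 0\<^sub>v N $ a"
      using a SN by (simp add: S_def scalar_prod_def atLeast0LessThan)
  qed
qed

theorem theorem4p3:
  fixes P :: relu_data and r :: nat and Xs :: "real mat" and x :: "real vec"
  assumes "wf_data P"
    and "1 \<le> r" and "r \<le> ntotal P + 1"
    and trace_inactive: "\<And>X. sdp_optimal P r X \<Longrightarrow> mtrace X < (bound P)\<^sup>2"
    and "max_rank_solution P Xs" and "mtrace Xs < (bound P)\<^sup>2"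
    and "vec_space.rank (ntotal P + 1) Xs \<le> r"
    and "bm_optimal P r x"
    and nonzero_u: "\<And>k i. k \<in> {1..<layers P} \<Longrightarrow> i < width P (k + 1) \<Longrightarrow>
      unit_vec (width P (k + 1)) i \<bullet> (weight P k *\<^sub>v uvec P x k + u0 x \<cdot>\<^sub>v bias P k) \<noteq> 0"
    and nonzero_V: "\<And>k i. k \<in> {1..<layers P} \<Longrightarrow> i < width P (k + 1) \<Longrightarrow>
      row (weight P k * Vmat P r x k) i \<noteq> 0\<^sub>v (r - 1)"
  shows "(\<exists>m. certifies_first_order P r x m) \<and>
    (\<forall>m. certifies_first_order P r x m \<longrightarrow>
       phi P r = u0 x * (wlast P \<bullet> uvec P x (layers P)) \<and>
       u0 x * (wlast P \<bullet> uvec P x (layers P))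
         = z0 m + (bound P)\<^sup>2 * min 0 (lambda_min (slack P m)))"
proof -
  note wf = assms(1) and r = assms(2)
  define N where "N = Suc (ntotal P)"
  define U where "U = factor P r x"
  define \<phi> where "\<phi> = obj_form P (gram r U)"
  have feas: "bm_feasible P r x" and opt: "\<And>x'. bm_feasible P r x' \<Longrightarrow> bm_f P x \<le> bm_f P x'"
    using assms(8) by (auto simp: bm_optimal_def)
  then have x: "x \<in> carrier_vec (bm_dim P r)" "vnorm x \<le> bound P" and G: "constraints_hold P (gram r U)"
    by (auto simp: bm_feasible_iff[OF wf r] U_def)
  have fx: "bm_f P x = \<phi>" by (simp add: bm_f_form[OF wf r] \<phi>_def U_def)
  have Xs: "sdp_optimal P (ntotal P + 1) Xs" using assms(5) by (simp add: max_rank_solution_def)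
  then have Xsf: "Xs \<in> carrier_mat N N" "psd_fun N (entries Xs)" "constraints_hold P (entries Xs)"
    "(\<Sum>a<N. Xs $$ (a, a)) \<le> (bound P)\<^sup>2"
    by (auto simp: sdp_optimal_def sdp_feasible_iff[OF wf] N_def simp del: sum.lessThan_Suc)
  have R: "0 < bound P" using wf by (simp add: wf_data_def)

  \<comment> \<open>The rank bound enters here: \<open>Xs\<close> has a factor with \<open>r\<close>
    columns, whose flat vector is feasible for (BM-r) and competes with \<open>x\<close>.\<close>
  have "\<phi> \<le> sdp_obj P Xs"
  proof -
    have "eq_const Corner + eq_form P Corner (entries Xs) = 0"
      using Xsf(3) by (simp add: constraints_hold_def ball_eqs)
    then have "Xs $$ (0, 0) = 1" by (simp add: eq_const_def)
    moreover have "mat N N (\<lambda>(a, b). Xs $$ (a, b)) = Xs" using Xsf(1) by auto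
    ultimately obtain x' where x': "x' \<in> carrier_vec (bm_dim P r)"
      "\<forall>a<N. \<forall>b<N. gram r (factor P r x') a b = Xs $$ (a, b)"
      using psd_factorization[OF r, of P "entries Xs"] Xsf(2) assms(7) unfolding N_def by auto
    have "(vnorm x')\<^sup>2 \<le> (bound P)\<^sup>2"
      using Xsf(4) x'(2) unfolding vnorm_square_factor[OF r x'(1)] N_def by simp
    then have "vnorm x' \<le> bound P" using R by (simp add: power2_le_iff_abs_le)
    moreover have "constraints_hold P (gram r (factor P r x'))"
      using constraints_hold_cong[OF wf, of "gram r (factor P r x')" "entries Xs"] x'(2) Xsf(3) by (simp add: N_def)
    ultimately have "\<phi> \<le> bm_f P x'" using opt x'(1) fx by (simp add: bm_feasible_iff[OF wf r])
    also have "bm_f P x' = sdp_obj P Xs"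
      unfolding bm_f_form[OF wf r] sdp_obj_form[OF wf]
      by (rule lin_form_D(3)[OF lin_form_obj[OF wf]]) (use x'(2) in \<open>simp add: N_def\<close>)
    finally show ?thesis .
  qed
  define XG where "XG = mat N N (\<lambda>(a, b). gram r U a b)"
  have XG_entries: "XG $$ (a, b) = gram r U a b" if "a < N" "b < N" for a b using that by (simp add: XG_def)
  have XG: "sdp_feasible P r XG"
  proof -
    have "psd_fun N (entries XG)" using psd_fun_cong[of N "entries XG" "gram r U"] XG_entries psd_fun_gram by simp
    moreover have "vec_space.rank N XG \<le> r" unfolding XG_def by (rule rank_gram_le)
    moreover have "constraints_hold P (entries XG)"
      using constraints_hold_cong[OF wf, of "entries XG" "gram r U"] XG_entries G by (simp add: N_def)
    moreover have "(\<Sum>a<N. XG $$ (a, a)) \<le> (bound P)\<^sup>2"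
    proof -
      have "(\<Sum>a<N. XG $$ (a, a)) = (vnorm x)\<^sup>2"
        using XG_entries by (simp add: vnorm_square_factor[OF r x(1)] U_def N_def)
      also have "\<dots> \<le> (bound P)\<^sup>2" using x(2) by (intro power_mono) (simp_all add: vnorm_def scalar_prod_def sum_nonneg)
      finally show ?thesis .
    qed
    ultimately show ?thesis by (simp add: sdp_feasible_iff[OF wf] XG_def N_def del: sum.lessThan_Suc)
  qed
  have objG: "sdp_obj P XG = \<phi>"
    unfolding sdp_obj_form[OF wf] \<phi>_def
    by (rule lin_form_D(3)[OF lin_form_obj[OF wf]]) (simp add: XG_entries N_def)
  have lower: "sdp_obj P Xs \<le> sdp_obj P X" if "sdp_feasible P r X" for X
  proof -
    have "sdp_feasible P (ntotal P + 1) X" using that assms(3) unfolding sdp_feasible_iff[OF wf] by auto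
    then show ?thesis using Xs by (simp add: sdp_optimal_def)
  qed
  have objXs: "sdp_obj P Xs = \<phi>" using \<open>\<phi> \<le> sdp_obj P Xs\<close> lower[OF XG] objG by simp
  \<comment> \<open>The infimum is attained at \<open>XG\<close>: its value equals the optimum over
    all ranks, which bounds every matrix of rank at most \<open>r\<close> from below.\<close>
  have phi: "phi P r = \<phi>"
    unfolding phi_def by (rule cInf_eq_minimum) (use XG objG lower objXs in auto)

  have U0: "U 0 0 \<noteq> 0" "\<And>j. 0 < j \<Longrightarrow> U 0 j = 0"
  proof -
    have "eq_const Corner + eq_form P Corner (gram r U) = 0"
      using G by (simp add: constraints_hold_def ball_eqs)
    then have "U 0 0 * U 0 0 = 1" using r by (simp add: eq_const_def U_def gram_factor_0)
    then show "U 0 0 \<noteq> 0" by auto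
    show "\<And>j. 0 < j \<Longrightarrow> U 0 j = 0" by (simp add: U_def factor_row_0)
  qed
  have wk: "weight P k \<in> carrier_mat (width P (k + 1)) (width P k)" "bias P k \<in> carrier_vec (width P (k + 1))"
    if "k \<in> {1..<layers P}" for k
    using that wf by (auto simp: wf_data_def)
  have nzu: "(\<Sum>j<width P k. weight P k $$ (i, j) * U (ix P k j) 0) + bias P k $ i * U 0 0 \<noteq> 0"
    if k: "k \<in> {1..<layers P}" and i: "i < width P (k + 1)" for k i
  proof -
    have d: "dim_vec (uvec P x k) = width P k" by (simp add: uvec_def)
    have "unit_vec (width P (k + 1)) i \<bullet> (weight P k *\<^sub>v uvec P x k + u0 x \<cdot>\<^sub>v bias P k)
        = (weight P k *\<^sub>v uvec P x k + u0 x \<cdot>\<^sub>v bias P k) $ i"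
      using wk[OF k] i by (intro scalar_prod_left_unit carrier_vecI) simp_all
    also have "\<dots> = (\<Sum>j<width P k. weight P k $$ (i, j) * U (ix P k j) 0) + bias P k $ i * U 0 0"
      using wk[OF k] i d by (simp add: scalar_prod_def atLeast0LessThan uvec_factor[where r = r]
          u0_factor[of x P r] U_def)
    finally show ?thesis using nonzero_u[OF k i] by simp
  qed
  \<comment> \<open>Columns \<open>1, ..., r - 1\<close> of U are the columns of V with the index
    raised by one.\<close>
  have nzV: "\<exists>j\<in>{1..<r}. (\<Sum>m<width P k. weight P k $$ (i, m) * U (ix P k m) j) \<noteq> 0"
    if k: "k \<in> {1..<layers P}" and i: "i < width P (k + 1)" for k i
  proof (rule ccontr)
    assume none: "\<not> ?thesis"
    have "row (weight P k * Vmat P r x k) i $ j = 0" if j: "j < r - 1" for j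
    proof -
      have V: "Vmat P r x k \<in> carrier_mat (width P k) (r - 1)" by (simp add: Vmat_def)
      have "row (weight P k * Vmat P r x k) i $ j = (\<Sum>m<width P k. weight P k $$ (i, m) * Vmat P r x k $$ (m, j))"
        using wk[OF k] V i j by (simp add: scalar_prod_def atLeast0LessThan)
      also have "\<dots> = (\<Sum>m<width P k. weight P k $$ (i, m) * U (ix P k m) (Suc j))"
        using k j by (simp add: Vmat_factor U_def)
      also have "\<dots> = 0" using none j by auto
      finally show ?thesis .
    qed
    moreover have "dim_vec (row (weight P k * Vmat P r x k) i) = r - 1" by (simp add: Vmat_def)
    ultimately have "row (weight P k * Vmat P r x k) i = 0\<^sub>v (r - 1)" by (intro eq_vecI) auto
    then show False using nonzero_V[OF k i] by simp
  qed
  have compl: "eq_form P (Unit1 k i) (gram r U) = 0" if "k \<in> {1..<layers P}" "i < width P (k + 1)" for k i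
  proof -
    have "eq_const (Unit1 k i) + eq_form P (Unit1 k i) (gram r U) = 0"
      using G that by (simp only: constraints_hold_def ball_eqs)
    then show ?thesis by (simp add: eq_const_def)
  qed
  note independent = multipliers_zero[OF wf r U0 compl nzu nzV]

  obtain c y z where c: "0 \<le> c" and y: "\<forall>l\<in>set (ineqs P). 0 \<le> y l"
    and nontriv: "c \<noteq> 0 \<or> (\<exists>l\<in>set (ineqs P). y l \<noteq> 0) \<or> (\<exists>l\<in>set (eqs P). z l \<noteq> 0)"
    and lb: "\<forall>X. psd_fun (Suc (ntotal P)) X \<longrightarrow> c * sdp_obj P Xs \<le> lagrangian_form P c y z X + z Corner"
    using sdp_fritz_john[OF wf Xs assms(6)] by blast
  have lb': "c * obj_form P (gram r U) \<le> lagrangian_form P c y z X + z Corner"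
    if "psd_fun (Suc (ntotal P)) X" for X
    using lb that objXs by (simp add: \<phi>_def)
  note saddle = saddle_point_conditions[where c = c and y = y and z = z and U = U and r = r,
      OF wf bspec[OF y] lb' G, folded \<phi>_def N_def]
  have "c \<noteq> 0"
  proof
    assume "c = 0"
    \<comment> \<open>With \<open>c = 0\<close> the saddle conditions are those of an abnormal
      multiplier at \<open>U\<close>, so all multipliers would vanish, against
      \<open>nontriv\<close>.\<close>
    moreover have "(\<forall>l\<in>set (ineqs P). y l = 0) \<and> (\<forall>l\<in>set (eqs P). z l = 0)"
      by (rule independent) (use saddle(3,4) \<open>c = 0\<close> in \<open>auto simp: N_def\<close>)
    ultimately show False using nontriv by blast
  qed
  then have c: "0 < c" using c by simp

  define m where "m = \<lparr>y0 = y Corner / c,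
    y1 = (\<lambda>k. Matrix.vec (width P (k + 1)) (\<lambda>i. y (Unit1 k i) / c)),
    y2 = (\<lambda>k. Matrix.vec (width P (k + 1)) (\<lambda>i. y (Unit2 k i) / c)), z0 = z Corner / c,
    zk = (\<lambda>k. Matrix.vec (width P (k + 1)) (\<lambda>i. z (Unit1 k i) / c))\<rparr>"
  have wfm: "wf_mult P m" by (simp add: wf_mult_def m_def)
  have ym: "ineq_mult m l = y l / c" if "l \<in> set (ineqs P)" for l
    by (cases l) (use that in \<open>auto simp: ineq_mult_def m_def set_ineqs\<close>)
  have zm: "eq_mult m l = z l / c" if "l \<in> set (eqs P)" for l
    by (cases l) (use that in \<open>auto simp: eq_mult_def m_def set_eqs\<close>)
  have Lm: "lagrangian_form P 1 (ineq_mult m) (eq_mult m) X = lagrangian_form P c y z X / c" for X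
    using c by (simp add: lagrangian_form_def ym zm add_divide_distrib sum_divide_distrib)
  \<comment> \<open>Stationarity is known at every entry of U, in particular at the free ones, which
    are the variables of (BM-r).\<close>
  have cert: "certifies_first_order P r x m"
    unfolding certifies_first_order_iff[OF wf r] Lm
    using feas wfm saddle(3,4) y c by (auto simp: ym free_entries_def U_def N_def)
  show ?thesis
  proof (intro conjI allI impI)
    show "\<exists>m. certifies_first_order P r x m" using cert by blast
    fix m' assume cert': "certifies_first_order P r x m'"
    note iff = certifies_first_order_iff[OF wf r, where x = x, folded U_def]
    have wfm': "wf_mult P m'" using cert' by (simp add: iff)
    \<comment> \<open>The objective cancels in the difference of two certificates. Wherever the
      difference is nonzero, one of the two multipliers is, so its constraint is active.\<close>
    have diff: "lagrangian_form P 0 (\<lambda>l. ineq_mult m' l - ineq_mult m l) (\<lambda>l. eq_mult m' l - eq_mult m l) X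
      = lagrangian_form P 1 (ineq_mult m') (eq_mult m') X - lagrangian_form P 1 (ineq_mult m) (eq_mult m) X" for X
      by (simp add: lagrangian_form_def left_diff_distrib sum_subtractf)
    have "(\<forall>l\<in>set (ineqs P). ineq_mult m' l - ineq_mult m l = 0) \<and> (\<forall>l\<in>set (eqs P). eq_mult m' l - eq_mult m l = 0)"
    proof (rule independent)
      fix l assume l: "l \<in> set (ineqs P)" "ineq_mult m' l - ineq_mult m l \<noteq> 0"
      then have "ineq_mult m' l * ineq_form P l (gram r U) = 0" "ineq_mult m l * ineq_form P l (gram r U) = 0"
        using cert cert' by (simp_all add: iff)
      then show "ineq_form P l (gram r U) = 0" using l(2) by auto
    next
      fix a j assume "a < Suc (ntotal P)" "j < r" "a = 0 \<Longrightarrow> j = 0"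
      then have "(a, j) \<in> free_entries P r" by (auto simp: free_entries_def)
      then show "lagrangian_form P 0 (\<lambda>l. ineq_mult m' l - ineq_mult m l) (\<lambda>l. eq_mult m' l - eq_mult m l) (edge (\<lambda>a. U a j) a) = 0"
        using cert cert' unfolding diff iff by fastforce
    qed simp_all
    then have eq: "ineq_mult m' l = ineq_mult m l" if "l \<in> set (ineqs P)" for l using that by simp
    have eq': "eq_mult m' l = eq_mult m l" if "l \<in> set (eqs P)" for l
      using that \<open>_ \<and> _\<close> by simp
    have Lm': "lagrangian_form P 1 (ineq_mult m') (eq_mult m') X = lagrangian_form P c y z X / c" for X
      unfolding Lm[symmetric] by (simp add: lagrangian_form_def eq eq')
    \<comment> \<open>Column 0 of U serves as the kernel vector; its first entry is
      \<open>u_0\<close>, which is nonzero.\<close>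
    have "lambda_min (slack P m') = 0"
      by (rule lambda_min_slack_eq_0[OF wf wfm', of "\<lambda>b. U b 0"])
        (use saddle(2,4) U0(1) c r in \<open>auto simp: Lm' N_def\<close>)
    moreover have "z0 m' = \<phi>"
      using eq'[of Corner] saddle(1) c by (simp add: set_eqs eq_mult_def m_def)
    moreover have "u0 x * (wlast P \<bullet> uvec P x (layers P)) = \<phi>" using fx by (simp add: bm_f_def)
    ultimately show "phi P r = u0 x * (wlast P \<bullet> uvec P x (layers P))"
      "u0 x * (wlast P \<bullet> uvec P x (layers P)) = z0 m' + (bound P)\<^sup>2 * min 0 (lambda_min (slack P m'))"
      using phi by simp_all
  qed
qed

end
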